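(* Let $\mathbb{M}:(\mathbb{R}^3,\leq)\to \mathbf{Vec}_{\Bbbk}$ be a pointwise finite-dimensional 3-parameter persistence module satisfying 3-parameter strong exactness. Then $\mathbb{M}$ decomposes uniquely (up to isomorphism and reordering of the terms) as a direct sum of block modules: $$\mathbb{M}\cong \bigoplus_{B:\ \text{blocks}}\mathbb{M}_B,\qquad \mathbb{M}_B\cong\bigoplus_{i=1}^{n_B}\Bbbk_B ,$$ where the multiplicities are determined by the counting functor: $n_B=\dim \mathcal{CF}_B(\mathbb{M})$.
   Context: Fix a field $\Bbbk$. $\mathbb{R}^3$ carries the product order. A pointwise finite-dimensional (pfd) 3-parameter persistence module is a functor $\mathbb{M}$ from $(\mathbb{R}^3,\leq)$ to finite-dimensional $\Bbbk$-vector spaces; write $\mathbb{M}_t=\mathbb{M}(t)$ and $\rho_s^t=\mathbb{M}(s\le t)$. Strong exactness. A 2-parameter persistence module $N$ over $\mathbb{R}^2$ is 2-parameter strongly exact if for all $(x_1,x_2)\le(y_1,y_2)$ the sequence $N_{(x_1,x_2)}\to N_{(x_1,y_2)}\oplus N_{(y_1,x_2)}\to N_{(y_1,y_2)}$ is exact, the first map being the pair of structure maps and the second the difference of the structure maps. For $x\le y$ in $\mathbb{R}^3$ and $S=\{1,2,3\}$ let $\mathcal{X}:\mathcal{P}(S)\to\mathbf{Vec}_{\Bbbk}$ be the cube $\mathcal{X}(T)=\mathbb{M}_{z(T)}$, where $z(T)_i=y_i$ if $i\in T$ and $z(T)_i=x_i$ otherwise; let $\psi:\mathcal{X}(\emptyset)\to\lim_{T\ne\emptyset}\mathcal{X}(T)$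 and $\varphi:\operatorname{colim}_{T\neq S}\mathcal{X}(T)\to\mathcal{X}(S)$ be the canonical maps. $\mathbb{M}$ is 3-parameter strongly exact if (i) for every $r\in\mathbb{R}$ the restrictions of $\mathbb{M}$ to $\{r\}\times\mathbb{R}\times\mathbb{R}$, $\mathbb{R}\times\{r\}\times\mathbb{R}$, $\mathbb{R}\times\mathbb{R}\times\{r\}$ are 2-parameter strongly exact, and (ii) for all $x\le y$ in $\mathbb{R}^3$, $\psi$ is surjective and $\varphi$ is injective. Blocks. A cut $c=(c^-,c^+)$ is a partition of $\mathbb{R}$ into two disjoint (possibly empty) subsets with $x<y$ for all $x\in c^-$, $y\in c^+$. A cuboid is a nonempty set $C=(c_1^+\cap c^{1-})\times(c_2^+\cap c^{2-})\times(c_3^+\cap c^{3-})$ for cuts $c_i,c^i$ ($i=1,2,3$), where $c^{i\pm}$ denotes $(c^i)^\pm$. It is a birth block if $c^{1+}=c^{2+}=c^{3+}=\emptyset$; a death block if $c_1^-=c_2^-=c_3^-=\emptyset$; an $i$-layer block if $c_j^-=c^{j+}=\emptyset$ for all $j\ne i$. A block is a cuboid that is a birth block, a death block or an $i$-layer block for some $i$. For a block $B$, the block module $\Bbbk_B$ has $(\Bbbk_B)_t=\Bbbk$ for $t\in B$ and $0$ otherwise, with $\rho_s^t=\mathrm{id}$ if $s,t\in B$ and $\rho_s^t=0$ otherwise. Counting functor. For a cuboid $C$ and $t\in C$ put $I^+_{C,t}=\bigcap_{s\in C,\,s\le t}\operatorname{Im}\rho_s^t$, $I^-_{C,t}=\sum_{s\notin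 C,\,s\le t}\operatorname{Im}\rho_s^t$, $K^+_{C,t}=\bigcap_{u\notin C,\,u\ge t}\operatorname{Ker}\rho_t^u$, $K^-_{C,t}=\sum_{u\in C,\,u\ge t}\operatorname{Ker}\rho_t^u$ (an empty intersection is $\mathbb{M}_t$, an empty sum is $0$); $\mathrm{Im}^+_{C,t}=I^+_{C,t}$, $\mathrm{Im}^-_{C,t}=I^-_{C,t}\cap I^+_{C,t}$, $\mathrm{Ker}^+_{C,t}=K^+_{C,t}+K^-_{C,t}$, $\mathrm{Ker}^-_{C,t}=K^-_{C,t}$; $V^+_{C,t}=\mathrm{Im}^+_{C,t}\cap\mathrm{Ker}^+_{C,t}$, $V^-_{C,t}=\mathrm{Im}^+_{C,t}\cap\mathrm{Ker}^-_{C,t}+\mathrm{Im}^-_{C,t}\cap\mathrm{Ker}^+_{C,t}$. Then $\mathcal{CF}_C(\mathbb{M})=\varprojlim_{t\in C}V^+_{C,t}/V^-_{C,t}$, with transition maps induced by the $\rho_s^t$. *)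

theory Defs
  imports "HOL-Analysis.Analysis" "HOL-Algebra.QuotRing" "Jordan_Normal_Form.VS_Connect"
begin

text \<open>
  The ground field is a type \<open>'k :: field\<close>, regarded as the ring record \<^term>\<open>class_ring\<close>;
  vector spaces are carrier-based (\<^const>\<open>vectorspace\<close>). The fields \<^const>\<open>mult\<close> and
  \<^const>\<open>one\<close>, which module records inherit from ring records, carry no meaning for vector
  spaces and are left \<^const>\<open>undefined\<close> below.
\<close>

no_notation vec_index (infixl "$" 100)

section \<open>Constructions on vector spaces\<close>

definition vs_dsum :: "'i set \<Rightarrow> ('i \<Rightarrow> ('k, 'v) module) \<Rightarrow> ('k, 'i \<Rightarrow> 'v) module" where
  "vs_dsum I V =
    \<lparr>carrier = {f \<in> (\<Pi>\<^sub>E i\<in>I. carrier (V i)). finite {i \<in> I. f i \<noteq> \<zero>\<^bsub>V i\<^esub>}},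
     mult = undefined, one = undefined,
     zero = (\<lambda>i\<in>I. \<zero>\<^bsub>V i\<^esub>),
     add = (\<lambda>f g. \<lambda>i\<in>I. f i \<oplus>\<^bsub>V i\<^esub> g i),
     smult = (\<lambda>c f. \<lambda>i\<in>I. c \<odot>\<^bsub>V i\<^esub> f i)\<rparr>"

text \<open>Quotient space: scalar multiplication of cosets is written as multiplication of cosets
  in \<^const>\<open>FactRing\<close>.\<close>

definition vs_quot :: "('k, 'v) module \<Rightarrow> 'v set \<Rightarrow> ('k, 'v set) module" where
  "vs_quot V W =
    \<lparr>carrier = a_rcosets\<^bsub>V\<^esub> W,
     mult = undefined, one = undefined,
     zero = W,
     add = set_add V,
     smult = (\<lambda>c X. \<Union>x\<in>X. W +>\<^bsub>V\<^esub> (c \<odot>\<^bsub>V\<^esub> x))\<rparr>"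

text \<open>The map induced by \<open>f\<close> from cosets to cosets of \<open>W\<close> in \<open>V\<close>.\<close>

definition quot_map :: "('k, 'v) module \<Rightarrow> 'v set \<Rightarrow> ('u \<Rightarrow> 'v) \<Rightarrow> 'u set \<Rightarrow> 'v set" where
  "quot_map V W f X = (\<Union>x\<in>X. W +>\<^bsub>V\<^esub> f x)"

abbreviation vs_span :: "('k::field, 'v) module \<Rightarrow> 'v set \<Rightarrow> 'v set" where
  "vs_span V \<equiv> LinearCombinations.module.span class_ring V"

definition subspace_Sum :: "('k::field, 'v) module \<Rightarrow> 'v set set \<Rightarrow> 'v set" where
  "subspace_Sum V \<W> = vs_span V (\<Union>\<W>)"

section \<open>Functors from a poset to vector spaces\<close>

text \<open>\<open>tr M s t\<close> is the structure map from \<open>obj M s\<close> to \<open>obj M t\<close>; only its values for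
  \<open>s \<le> t\<close> on \<open>carrier (obj M s)\<close> matter.\<close>

record ('p, 'k, 'v) pers_mod =
  obj :: "'p \<Rightarrow> ('k, 'v) module"
  tr :: "'p \<Rightarrow> 'p \<Rightarrow> 'v \<Rightarrow> 'v"

definition persistence_module :: "('p::order, 'k::field, 'v) pers_mod \<Rightarrow> bool" where
  "persistence_module M \<longleftrightarrow>
    (\<forall>t. vectorspace class_ring (obj M t)) \<and>
    (\<forall>s t. s \<le> t \<longrightarrow> linear_map class_ring (obj M s) (obj M t) (tr M s t)) \<and>
    (\<forall>t. \<forall>v\<in>carrier (obj M t). tr M t t v = v) \<and>
    (\<forall>r s t. r \<le> s \<longrightarrow> s \<le> t \<longrightarrow>
      (\<forall>v\<in>carrier (obj M r). tr M s t (tr M r s v) = tr M r t v))"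

definition pfd_persistence_module :: "('p::order, 'k::field, 'v) pers_mod \<Rightarrow> bool" where
  "pfd_persistence_module M \<longleftrightarrow>
    persistence_module M \<and> (\<forall>t. vectorspace.fin_dim class_ring (obj M t))"

definition pm_iso ::
    "('p::order, 'k::field, 'v) pers_mod \<Rightarrow> ('p, 'k, 'w) pers_mod \<Rightarrow> bool" (infix "\<cong>\<^sub>P" 50) where
  "M \<cong>\<^sub>P N \<longleftrightarrow> (\<exists>f.
    (\<forall>t. linear_map class_ring (obj M t) (obj N t) (f t) \<and>
         bij_betw (f t) (carrier (obj M t)) (carrier (obj N t))) \<and>
    (\<forall>s t. s \<le> t \<longrightarrow> (\<forall>v\<in>carrier (obj M s). tr N s t (f s v) = f t (tr M s t v))))"

definition pm_dsum ::
    "'i set \<Rightarrow> ('i \<Rightarrow> ('p, 'k, 'v) pers_mod) \<Rightarrow> ('p, 'k, 'i \<Rightarrow> 'v) pers_mod" where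
  "pm_dsum I N =
    \<lparr>obj = (\<lambda>t. vs_dsum I (\<lambda>i. obj (N i) t)),
     tr = (\<lambda>s t f. \<lambda>i\<in>I. tr (N i) s t (f i))\<rparr>"

text \<open>Precomposition with a monotone map, for restricting a module to a plane or to a cube.\<close>

definition reindex :: "('q \<Rightarrow> 'p) \<Rightarrow> ('p, 'k, 'v) pers_mod \<Rightarrow> ('q, 'k, 'v) pers_mod" where
  "reindex h M = \<lparr>obj = (\<lambda>a. obj M (h a)), tr = (\<lambda>a b. tr M (h a) (h b))\<rparr>"

text \<open>Limit and colimit of the restriction of \<open>N\<close> to the full subposet \<open>D\<close>; \<open>N\<close> need only be
  functorial on \<open>D\<close>.\<close>

definition pm_limit :: "'p::order set \<Rightarrow> ('p, 'k, 'v) pers_mod \<Rightarrow> ('k, 'p \<Rightarrow> 'v) module" where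
  "pm_limit D N =
    \<lparr>carrier = {f \<in> (\<Pi>\<^sub>E t\<in>D. carrier (obj N t)).
                 \<forall>s\<in>D. \<forall>t\<in>D. s \<le> t \<longrightarrow> tr N s t (f s) = f t},
     mult = undefined, one = undefined,
     zero = (\<lambda>t\<in>D. \<zero>\<^bsub>obj N t\<^esub>),
     add = (\<lambda>f g. \<lambda>t\<in>D. f t \<oplus>\<^bsub>obj N t\<^esub> g t),
     smult = (\<lambda>c f. \<lambda>t\<in>D. c \<odot>\<^bsub>obj N t\<^esub> f t)\<rparr>"

definition dsum_inj :: "'i set \<Rightarrow> ('i \<Rightarrow> ('k, 'v) module) \<Rightarrow> 'i \<Rightarrow> 'v \<Rightarrow> 'i \<Rightarrow> 'v" where
  "dsum_inj I V j v = (\<lambda>i\<in>I. if i = j then v else \<zero>\<^bsub>V i\<^esub>)"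

definition colimit_rel :: "'p::order set \<Rightarrow> ('p, 'k::field, 'v) pers_mod \<Rightarrow> ('p \<Rightarrow> 'v) set" where
  "colimit_rel D N = vs_span (vs_dsum D (obj N))
    {dsum_inj D (obj N) s v \<ominus>\<^bsub>vs_dsum D (obj N)\<^esub> dsum_inj D (obj N) t (tr N s t v) | s t v.
      s \<in> D \<and> t \<in> D \<and> s \<le> t \<and> v \<in> carrier (obj N s)}"

definition pm_colimit ::
    "'p::order set \<Rightarrow> ('p, 'k::field, 'v) pers_mod \<Rightarrow> ('k, ('p \<Rightarrow> 'v) set) module" where
  "pm_colimit D N = vs_quot (vs_dsum D (obj N)) (colimit_rel D N)"

text \<open>Canonical maps for a lower bound, respectively an upper bound, \<open>p\<close> of \<open>D\<close>. The second one
  takes the class of a family \<open>f\<close> to the sum of the images of its (finitely many nonzero)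
  components.\<close>

definition to_limit :: "'p \<Rightarrow> 'p set \<Rightarrow> ('p, 'k, 'v) pers_mod \<Rightarrow> 'v \<Rightarrow> 'p \<Rightarrow> 'v" where
  "to_limit p D N v = (\<lambda>t\<in>D. tr N p t v)"

definition from_colimit :: "'p set \<Rightarrow> 'p \<Rightarrow> ('p, 'k, 'v) pers_mod \<Rightarrow> ('p \<Rightarrow> 'v) set \<Rightarrow> 'v" where
  "from_colimit D p N X = the_elem
    ((\<lambda>f. \<Oplus>\<^bsub>obj N p\<^esub> t\<in>{t \<in> D. f t \<noteq> \<zero>\<^bsub>obj N t\<^esub>}. tr N t p (f t)) ` X)"

section \<open>Strong exactness\<close>

definition strongly_exact_2 :: "(real^2, 'k::field, 'v) pers_mod \<Rightarrow> bool" where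
  "strongly_exact_2 N \<longleftrightarrow> (\<forall>x y. x \<le> y \<longrightarrow>
    (let p = vector [x$1, y$2]; q = vector [y$1, x$2] in
      mod_hom.im (obj N x) (\<lambda>v. (tr N x p v, tr N x q v)) =
      mod_hom.ker (direct_sum (obj N p) (obj N q)) (obj N y)
        (\<lambda>w. tr N p y (fst w) \<ominus>\<^bsub>obj N y\<^esub> tr N q y (snd w))))"

text \<open>The set \<open>{1,2,3}\<close> of coordinates is \<open>UNIV :: 3 set\<close>, and its power set is the type
  \<open>3 set\<close>, ordered by inclusion.\<close>

definition cube_vertex :: "real^3 \<Rightarrow> real^3 \<Rightarrow> 3 set \<Rightarrow> real^3" where
  "cube_vertex x y T = (\<chi> i. if i \<in> T then y$i else x$i)"

definition cube :: "real^3 \<Rightarrow> real^3 \<Rightarrow> (real^3, 'k, 'v) pers_mod \<Rightarrow> (3 set, 'k, 'v) pers_mod" where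
  "cube x y M = reindex (cube_vertex x y) M"

definition strongly_exact_3 :: "(real^3, 'k::field, 'v) pers_mod \<Rightarrow> bool" where
  "strongly_exact_3 M \<longleftrightarrow>
    (\<forall>r. strongly_exact_2 (reindex (\<lambda>a. vector [r, a$1, a$2]) M) \<and>
         strongly_exact_2 (reindex (\<lambda>a. vector [a$1, r, a$2]) M) \<and>
         strongly_exact_2 (reindex (\<lambda>a. vector [a$1, a$2, r]) M)) \<and>
    (\<forall>x y. x \<le> y \<longrightarrow>
      to_limit {} {T. T \<noteq> {}} (cube x y M) ` carrier (obj (cube x y M) {}) =
        carrier (pm_limit {T. T \<noteq> {}} (cube x y M)) \<and>
      inj_on (from_colimit {T. T \<noteq> UNIV} UNIV (cube x y M))
        (carrier (pm_colimit {T. T \<noteq> UNIV} (cube x y M))))"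

section \<open>Blocks\<close>

definition is_cut :: "real set \<times> real set \<Rightarrow> bool" where
  "is_cut c \<longleftrightarrow> fst c \<union> snd c = UNIV \<and> fst c \<inter> snd c = {} \<and> (\<forall>x\<in>fst c. \<forall>y\<in>snd c. x < y)"

text \<open>\<open>c i\<close> and \<open>d i\<close> stand for the lower and the upper cut in the \<open>i\<close>-th coordinate; the
  first component of a cut is its lower part.\<close>

definition cuboid_of :: "(3 \<Rightarrow> real set \<times> real set) \<Rightarrow> (3 \<Rightarrow> real set \<times> real set) \<Rightarrow> (real^3) set" where
  "cuboid_of c d = {t. \<forall>i. t$i \<in> snd (c i) \<inter> fst (d i)}"

definition cuboid_with ::
    "(3 \<Rightarrow> real set \<times> real set) \<Rightarrow> (3 \<Rightarrow> real set \<times> real set) \<Rightarrow> (real^3) set \<Rightarrow> bool" where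
  "cuboid_with c d C \<longleftrightarrow>
    (\<forall>i. is_cut (c i) \<and> is_cut (d i)) \<and> C = cuboid_of c d \<and> C \<noteq> {}"

definition birth_block :: "(real^3) set \<Rightarrow> bool" where
  "birth_block C \<longleftrightarrow> (\<exists>c d. cuboid_with c d C \<and> (\<forall>i. snd (d i) = {}))"

definition death_block :: "(real^3) set \<Rightarrow> bool" where
  "death_block C \<longleftrightarrow> (\<exists>c d. cuboid_with c d C \<and> (\<forall>i. fst (c i) = {}))"

definition layer_block :: "3 \<Rightarrow> (real^3) set \<Rightarrow> bool" where
  "layer_block i C \<longleftrightarrow>
    (\<exists>c d. cuboid_with c d C \<and> (\<forall>j. j \<noteq> i \<longrightarrow> fst (c j) = {} \<and> snd (d j) = {}))"

definition blocks :: "(real^3) set set" where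
  "blocks = {B. birth_block B \<or> death_block B \<or> (\<exists>i. layer_block i B)}"

definition block_module :: "'p set \<Rightarrow> ('p, 'k::field, 'k) pers_mod" where
  "block_module B =
    \<lparr>obj = (\<lambda>t. \<lparr>carrier = (if t \<in> B then UNIV else {0}), mult = undefined, one = undefined,
                 zero = 0, add = (+), smult = (*)\<rparr>),
     tr = (\<lambda>s t v. if s \<in> B \<and> t \<in> B then v else 0)\<rparr>"

section \<open>The counting functor\<close>

context
  fixes M :: "('p::order, 'k::field, 'v) pers_mod" and C :: "'p set"
begin

definition I_plus :: "'p \<Rightarrow> 'v set" where
  "I_plus t = carrier (obj M t) \<inter> (\<Inter>s\<in>{s \<in> C. s \<le> t}. mod_hom.im (obj M s) (tr M s t))"

definition I_minus :: "'p \<Rightarrow> 'v set" where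
  "I_minus t = subspace_Sum (obj M t) {mod_hom.im (obj M s) (tr M s t) | s. s \<notin> C \<and> s \<le> t}"

definition K_plus :: "'p \<Rightarrow> 'v set" where
  "K_plus t = carrier (obj M t) \<inter>
    (\<Inter>u\<in>{u. u \<notin> C \<and> t \<le> u}. mod_hom.ker (obj M t) (obj M u) (tr M t u))"

definition K_minus :: "'p \<Rightarrow> 'v set" where
  "K_minus t =
    subspace_Sum (obj M t) {mod_hom.ker (obj M t) (obj M u) (tr M t u) | u. u \<in> C \<and> t \<le> u}"

definition Im_plus :: "'p \<Rightarrow> 'v set" where
  "Im_plus t = I_plus t"

definition Im_minus :: "'p \<Rightarrow> 'v set" where
  "Im_minus t = I_minus t \<inter> I_plus t"

definition Ker_plus :: "'p \<Rightarrow> 'v set" where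
  "Ker_plus t = K_plus t <+>\<^bsub>obj M t\<^esub> K_minus t"

definition Ker_minus :: "'p \<Rightarrow> 'v set" where
  "Ker_minus t = K_minus t"

definition V_plus :: "'p \<Rightarrow> 'v set" where
  "V_plus t = Im_plus t \<inter> Ker_plus t"

definition V_minus :: "'p \<Rightarrow> 'v set" where
  "V_minus t = (Im_plus t \<inter> Ker_minus t) <+>\<^bsub>obj M t\<^esub> (Im_minus t \<inter> Ker_plus t)"

definition V_quot :: "('p, 'k, 'v set) pers_mod" where
  "V_quot =
    \<lparr>obj = (\<lambda>t. vs_quot ((obj M t)\<lparr>carrier := V_plus t\<rparr>) (V_minus t)),
     tr = (\<lambda>s t. quot_map (obj M t) (V_minus t) (tr M s t))\<rparr>"

definition counting_functor :: "('k, 'p \<Rightarrow> 'v set) module" where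
  "counting_functor = pm_limit C V_quot"

end

end

(* Exactness makes a pfd module decompose as soon as every nonzero module has a block as a direct
   summand: Zorn's lemma, applied to pairs (independent family of block submodules, complement),
   does the rest, because at each point the dimension of the complement stabilises.

   A block summand is found by minimising a dimension. If some vector dies in two different
   directions, a smallest intersection of kernels in at least two directions carries a death block.
   Otherwise, if some vector dies in direction i, the kernels in direction i are constant along the
   other two directions, and a smallest intersection of such a kernel with an image carries a layer
   block. Otherwise all structure maps are injective, and a nonzero space of smallest dimension
   carries a birth block. In each case one vector g at one point t suffices: it lifts downwards by a
   Mittag-Leffler argument, and a submodule maximal among those that contain every image from
   outside the block and avoid g is a complement.

   Conversely, in coordinates adapted to any decomposition into blocks, all subspaces that enter
   the counting functor of a block B are coordinate subspaces, and the index set of V+ minus that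
   of V- consists of the summands supported on B. This gives n_B and hence uniqueness. *)

theory Submission
  imports Defs "HOL-Library.Function_Algebras"
begin

text \<open>Minimality acts as an all-or-nothing rule. The vectors of a minimal subspace that meet a
  further kernel or image condition form a subspace of the same kind, so either only 0 meets it or
  every vector does. The cuts of the block are the places where the answer changes, and any nonzero
  vector of the minimal subspace can serve as g.

  The three cases draw on different parts of exactness. Kernels in two directions lift along the
  third one by surjectivity onto the limit of the cube; kernels in a single direction lift through
  squares; when all maps are injective, the squares lift g, and injectivity from the colimit shows
  that g never becomes a sum of images from outside the block.

  An edge of a block may be open, so that g has to be lifted to infinitely many points without a
  lowest one; this is why compatible lifts take a limit argument. The splitting can be repeated
  because a direct summand inherits exactness, and infinitely many summands may occur although only
  finitely many live at each point.\<close>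

no_notation vector_scalar_mult (infixl "*s" 70)

section \<open>Submodules of persistence modules\<close>

context vector_space
begin

text \<open>A vector of \<open>W'\<close> outside \<open>W\<close> would enlarge a basis of
  \<open>W\<close> beyond \<open>dim W'\<close>. The finite set \<open>A\<close> keeps
  \<open>dim\<close> meaningful: without finite generation the cardinality of a basis degenerates to
  0.\<close>

lemma subspace_dim_eqI:
  assumes "subspace W" "W \<subseteq> W'" "finite A" "W' \<subseteq> span A" "dim W' \<le> dim W"
  shows "W = W'"
proof (rule ccontr)
  assume "W \<noteq> W'"
  then obtain x where x: "x \<in> W'" "x \<notin> W" using assms(2) by blast
  obtain B where B: "B \<subseteq> W" "independent B" "W \<subseteq> span B" "card B = dim W"
    using basis_exists by blast
  have sB: "span B = W" by (metis B(1,3) assms(1) span_minimal subset_antisym)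
  have ind: "independent (insert x B)" using B x sB by (simp add: independent_insert)
  have sub: "insert x B \<subseteq> W'" using B assms x by blast
  obtain B' where B': "B' \<subseteq> W'" "independent B'" "W' \<subseteq> span B'" "card B' = dim W'"
    using basis_exists by blast
  have fB': "finite B'" using independent_span_bound[OF assms(3) B'(2)] order_trans[OF B'(1) assms(4)] by simp
  have "finite (insert x B) \<and> card (insert x B) \<le> card B'"
    by (rule independent_span_bound[OF fB' ind order_trans[OF sub B'(3)]])
  moreover have "x \<notin> B" using x sB span_superset by blast
  ultimately show False using B(4) B'(4) assms(5) by (auto simp: card_insert_if)
qed

lemma dim_subset_finite:
  assumes "W \<subseteq> W'" "finite A" "W' \<subseteq> span A"
  shows "dim W \<le> dim W'"
proof -
  obtain B where B: "B \<subseteq> W" "independent B" "W \<subseteq> span B" "card B = dim W"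
    using basis_exists by blast
  obtain B' where B': "B' \<subseteq> W'" "independent B'" "W' \<subseteq> span B'" "card B' = dim W'"
    using basis_exists by blast
  have fB': "finite B'" using independent_span_bound[OF assms(2) B'(2)] order_trans[OF B'(1) assms(3)] by simp
  have "B \<subseteq> span B'" using B(1) assms(1) B'(3) by (meson order_trans)
  then show ?thesis using independent_span_bound[OF fB' B(2)] B(4) B'(4) by simp
qed

text \<open>The coefficients belong to indices and not to the vectors \<open>f x\<close>, so
  independence of an indexed family applies directly, even though two indices might a priori share a
  vector.\<close>

lemma span_imageE:
  assumes "v \<in> span (f ` I)"
  obtains A a where "finite A" "A \<subseteq> I" "v = (\<Sum>x\<in>A. a x *s f x)"
proof -
  have "\<exists>A a. finite A \<and> A \<subseteq> I \<and> v = (\<Sum>x\<in>A. a x *s f x)" using assms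
  proof (induction rule: span_induct_alt)
    case base
    then show ?case by (intro exI[of _ "{}"]) simp
  next
    case (step c y v)
    then obtain A a where A: "finite A" "A \<subseteq> I" "v = (\<Sum>x\<in>A. a x *s f x)" by blast
    obtain i where i: "i \<in> I" "y = f i" using step by blast
    define b where "b = (\<lambda>x. if x = i then c + (if i \<in> A then a i else 0) else a x)"
    have "(\<Sum>x\<in>insert i A. b x *s f x) = b i *s f i + (\<Sum>x\<in>A - {i}. b x *s f x)"
      using A(1) by (simp add: sum.insert_remove)
    also have "(\<Sum>x\<in>A - {i}. b x *s f x) = (\<Sum>x\<in>A - {i}. a x *s f x)"
      by (rule sum.cong) (auto simp: b_def)
    also have "b i *s f i + (\<Sum>x\<in>A - {i}. a x *s f x) = c *s y + v"
      using A(1,3) i(2) by (cases "i \<in> A") (auto simp: b_def scale_left_distrib sum.remove add.assoc)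
    finally show ?case using A i(1) by (intro exI[of _ "insert i A"] exI[of _ b]) auto
  qed
  then show ?thesis using that by blast
qed

end

text \<open>All spaces are subspaces of one ambient space, and \<open>T s t\<close> is linear on the
  whole of it. A submodule is then just another family \<open>E\<close> with the same
  \<open>T\<close>, so the locale can be reinterpreted on a summand.\<close>

locale pmod = vector_space scale
  for scale :: "'k::field \<Rightarrow> 'a::ab_group_add \<Rightarrow> 'a" (infixr "*s" 75) +
  fixes E :: "'p::order \<Rightarrow> 'a set" and T :: "'p \<Rightarrow> 'p \<Rightarrow> 'a \<Rightarrow> 'a"
  assumes sub_E: "subspace (E t)"
    and T_add: "T s t (x + y) = T s t x + T s t y"
    and T_scale: "T s t (c *s x) = c *s T s t x"
    and T_in: "s \<le> t \<Longrightarrow> v \<in> E s \<Longrightarrow> T s t v \<in> E t"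
    and T_id: "v \<in> E t \<Longrightarrow> T t t v = v"
    and T_comp: "r \<le> s \<Longrightarrow> s \<le> t \<Longrightarrow> v \<in> E r \<Longrightarrow> T s t (T r s v) = T r t v"
    and fin_E: "\<exists>A. finite A \<and> E t \<subseteq> span A"
begin

lemma T_0: "T s t 0 = 0"
  using T_add[of s t 0 0] by simp

lemma T_neg: "T s t (- x) = - T s t x"
  using T_add[of s t x "- x"] T_0 by (metis add.right_inverse add_eq_0_iff)

lemma T_diff: "T s t (x - y) = T s t x - T s t y"
  using T_add[of s t x "- y"] T_neg by simp

lemma T_sum: "T s t (\<Sum>x\<in>A. f x) = (\<Sum>x\<in>A. T s t (f x))"
  by (induction A rule: infinite_finite_induct) (simp_all add: T_0 T_add)

lemma dim_eqI: "subspace W \<Longrightarrow> W \<subseteq> W' \<Longrightarrow> W' \<subseteq> E t \<Longrightarrow> dim W' \<le> dim W \<Longrightarrow> W = W'"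
  using fin_E[of t] subspace_dim_eqI by (metis order_trans)

lemma subspace_T_image:
  assumes "subspace W" shows "subspace (T s t ` W)"
proof (rule subspaceI)
  show "0 \<in> T s t ` W" using subspace_0[OF assms] T_0 by (intro image_eqI[where x = 0]) auto
  show "x + y \<in> T s t ` W" if "x \<in> T s t ` W" "y \<in> T s t ` W" for x y
    using that subspace_add[OF assms] by (auto simp: T_add[symmetric])
  show "c *s x \<in> T s t ` W" if "x \<in> T s t ` W" for c x
    using that subspace_scale[OF assms] by (auto simp: T_scale[symmetric])
qed

lemma T_span_in:
  assumes "v \<in> span A" "subspace W" "\<And>a. a \<in> A \<Longrightarrow> T s t a \<in> W"
  shows "T s t v \<in> W"
  using assms(1)
proof (induction rule: span_induct_alt)
  case base
  show ?case using T_0 assms(2) subspace_0 by simp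
next
  case (step c x y)
  then show ?case using assms by (simp add: T_add T_scale subspace_add subspace_scale)
qed

text \<open>The smallest submodule that fills \<open>E\<close> off \<open>B\<close>; any complement
  of a copy of the block module of \<open>B\<close> must contain it. It is the I^- of the counting
  functor.\<close>

definition outer :: "'p set \<Rightarrow> 'p \<Rightarrow> 'a set" where
  "outer B u = span (\<Union>s\<in>{s. s \<notin> B \<and> s \<le> u}. T s u ` E s)"

lemma outer_subset: "outer B u \<subseteq> E u"
  unfolding outer_def by (rule span_minimal) (auto intro: T_in sub_E)

lemma outer_T:
  assumes "u \<le> t" "v \<in> outer B u" shows "T u t v \<in> outer B t"
proof -
  have "T u t a \<in> outer B t" if a: "a \<in> (\<Union>s\<in>{s. s \<notin> B \<and> s \<le> u}. T s u ` E s)" for a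
  proof -
    from a obtain s e where s: "s \<notin> B" "s \<le> u" "e \<in> E s" "a = T s u e" by blast
    have "T u t a = T s t e" using T_comp s assms(1) by simp
    then show ?thesis unfolding outer_def using s assms(1) by (intro span_base) auto
  qed
  then show ?thesis using assms(2) T_span_in[of v _ "outer B t" u t]
    by (metis (no_types, lifting) outer_def subspace_span)
qed

text \<open>A maximal submodule that contains all images from outside \<open>B\<close> and avoids the family \<open>g\<close>
  is a complement: enlarging it by a vector \<open>v\<close> captures some \<open>g t\<close>, and doing this twice,
  for \<open>v\<close> and for a suitable \<open>v - c *s g u\<close>, would capture \<open>g\<close> in the submodule itself.\<close>

lemma exists_complement:
  assumes dir: "\<And>a b. a \<in> B \<Longrightarrow> b \<in> B \<Longrightarrow> \<exists>c\<in>B. a \<le> c \<and> b \<le> c"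
    and g_in: "\<And>s. s \<in> B \<Longrightarrow> g s \<in> E s"
    and g_T: "\<And>s t. s \<in> B \<Longrightarrow> s \<le> t \<Longrightarrow> T s t (g s) = (if t \<in> B then g t else 0)"
    and g_out: "\<And>u. u \<in> B \<Longrightarrow> g u \<notin> outer B u"
  obtains N where "\<And>t. subspace (N t)" "\<And>t. N t \<subseteq> E t"
    "\<And>s t v. s \<le> t \<Longrightarrow> v \<in> N s \<Longrightarrow> T s t v \<in> N t"
    "\<And>t. t \<notin> B \<Longrightarrow> N t = E t" "\<And>t. t \<in> B \<Longrightarrow> g t \<notin> N t"
    "\<And>t v. t \<in> B \<Longrightarrow> v \<in> E t \<Longrightarrow> \<exists>c. v - c *s g t \<in> N t"
proof -
  \<comment> \<open>A candidate submodule is coded as its set of pairs (point, vector), so that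
    Zorn's lemma for inclusion applies.\<close>
  define F where "F X s = {v. (s, v) \<in> X}" for X :: "('p \<times> 'a) set" and s
  define ok where "ok X \<longleftrightarrow> (\<forall>s. subspace (F X s) \<and> F X s \<subseteq> E s) \<and>
     (\<forall>s t v. s \<le> t \<longrightarrow> v \<in> F X s \<longrightarrow> T s t v \<in> F X t) \<and> (\<forall>s. s \<notin> B \<longrightarrow> E s \<subseteq> F X s) \<and>
     (\<forall>u\<in>B. g u \<notin> F X u)" for X
  have ok0: "ok {(u, v). v \<in> outer B u}"
  proof -
    have F0: "F {(u, v). v \<in> outer B u} s = outer B s" for s by (simp add: F_def)
    have "E s \<subseteq> outer B s" if "s \<notin> B" for s
    proof
      fix x assume x: "x \<in> E s"
      then have "T s s x \<in> outer B s" unfolding outer_def using that by (intro span_base) blast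
      then show "x \<in> outer B s" using T_id x by simp
    qed
    moreover have "subspace (outer B s)" for s unfolding outer_def by (rule subspace_span)
    ultimately show ?thesis unfolding ok_def F0
      using outer_T outer_subset g_out by simp
  qed
  have chain: "ok (\<Union>C)" if C: "C \<noteq> {}" "subset.chain {X. ok X} C" for C
  proof -
    have okC: "\<And>X. X \<in> C \<Longrightarrow> ok X" and lin: "\<And>X Y. X \<in> C \<Longrightarrow> Y \<in> C \<Longrightarrow> X \<subseteq> Y \<or> Y \<subseteq> X"
      using C(2) by (auto simp: subset.chain_def)
    have FU: "F (\<Union>C) s = (\<Union>X\<in>C. F X s)" for s by (auto simp: F_def)
    have mono: "F X s \<subseteq> F Y s" if "X \<subseteq> Y" for X Y s using that by (auto simp: F_def)
    have C1: "subspace (F X s)" "F X s \<subseteq> E s" if "X \<in> C" for X s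
      using okC[OF that] by (simp_all add: ok_def)
    have C2: "T s t v \<in> F X t" if "X \<in> C" "s \<le> t" "v \<in> F X s" for X s t v
      using okC[OF that(1)] that(2,3) by (simp add: ok_def)
    have C3: "E s \<subseteq> F X s" if "X \<in> C" "s \<notin> B" for X s
      using okC[OF that(1)] that(2) by (simp add: ok_def)
    have C4: "g u \<notin> F X u" if "X \<in> C" "u \<in> B" for X u
      using okC[OF that(1)] that(2) by (simp add: ok_def)
    obtain X0 where X0: "X0 \<in> C" using C(1) by blast
    have "subspace (F (\<Union>C) s)" for s
    proof (unfold FU, rule subspaceI)
      show "0 \<in> (\<Union>X\<in>C. F X s)" using X0 subspace_0[OF C1(1)[OF X0]] by (rule UN_I)
      show "x + y \<in> (\<Union>X\<in>C. F X s)" if "x \<in> (\<Union>X\<in>C. F X s)" "y \<in> (\<Union>X\<in>C. F X s)" for x y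
      proof -
        from that obtain X Y where XY: "X \<in> C" "Y \<in> C" "x \<in> F X s" "y \<in> F Y s" by auto
        have "X \<subseteq> Y \<or> Y \<subseteq> X" using lin XY by simp
        then show ?thesis
        proof
          assume "X \<subseteq> Y"
          then have "x \<in> F Y s" using mono XY by (meson subsetD)
          then show ?thesis using subspace_add[OF C1(1)[OF XY(2)]] XY by (intro UN_I[OF XY(2)])
        next
          assume "Y \<subseteq> X"
          then have "y \<in> F X s" using mono XY by (meson subsetD)
          then show ?thesis using subspace_add[OF C1(1)[OF XY(1)]] XY by (intro UN_I[OF XY(1)])
        qed
      qed
      show "c *s x \<in> (\<Union>X\<in>C. F X s)" if "x \<in> (\<Union>X\<in>C. F X s)" for x c
        using that subspace_scale[OF C1(1)] by (elim UN_E) (rule UN_I)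
    qed
    moreover have "F (\<Union>C) s \<subseteq> E s" for s using C1(2) unfolding FU by (rule UN_least)
    moreover have "T s t v \<in> F (\<Union>C) t" if "s \<le> t" "v \<in> F (\<Union>C) s" for s t v
      using that C2 unfolding FU by (elim UN_E) (rule UN_I)
    moreover have "E s \<subseteq> F (\<Union>C) s" if "s \<notin> B" for s
      unfolding FU using C3[OF X0 that] X0 by (meson UN_upper order_trans)
    moreover have "g u \<notin> F (\<Union>C) u" if "u \<in> B" for u
      unfolding FU using C4 that by simp
    ultimately show ?thesis unfolding ok_def by simp
  qed
  have "\<exists>M\<in>{X. ok X}. \<forall>X\<in>{X. ok X}. M \<subseteq> X \<longrightarrow> X = M"
    by (rule subset_Zorn_nonempty) (use ok0 chain in auto)
  then obtain X where X: "ok X" and Xmax: "\<And>Y. ok Y \<Longrightarrow> X \<subseteq> Y \<Longrightarrow> Y = X" by blast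
  have subX: "subspace (F X s)" and XE: "F X s \<subseteq> E s" for s using X by (auto simp: ok_def)
  have XT: "T s t v \<in> F X t" if "s \<le> t" "v \<in> F X s" for s t v using X that by (auto simp: ok_def)
  have Xout: "E s \<subseteq> F X s" if "s \<notin> B" for s using X that by (simp add: ok_def)
  have Xg: "g u \<notin> F X u" if "u \<in> B" for u using X that by (simp add: ok_def)
  have key: "\<exists>t\<in>B. \<exists>n c. u \<le> t \<and> n \<in> F X t \<and> g t = n + c *s T u t v"
    if u: "v \<in> E u" "v \<notin> F X u" for u v
  proof -
    \<comment> \<open>\<open>Y\<close> is generated by \<open>X\<close> and \<open>v\<close>; at
      points not above \<open>u\<close> it adds nothing. The conditions of \<open>ok\<close> other
      than avoidance of \<open>g\<close> persist, so maximality of \<open>X\<close> makes that one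
      fail.\<close>
    define Y where "Y = {(t, w). \<exists>n\<in>F X t. \<exists>c. w = n + (if u \<le> t then c *s T u t v else 0)}"
    have FY: "F Y t = {w. \<exists>n\<in>F X t. \<exists>c. w = n + (if u \<le> t then c *s T u t v else 0)}" for t
      by (auto simp: F_def Y_def)
    have FXY: "F X t \<subseteq> F Y t" for t
      unfolding FY by (auto intro!: bexI exI[of _ 0])
    then have XY: "X \<subseteq> Y" by (fastforce simp: F_def)
    have "v \<in> F Y u" unfolding FY
      using T_id u subX subspace_0 by (auto intro!: bexI[of _ 0] exI[of _ 1])
    then have "X \<noteq> Y" using u by blast
    then have nok: "\<not> ok Y" using Xmax XY by blast
    have "subspace (F Y t)" for t
    proof (rule subspaceI)
      show "0 \<in> F Y t" using FXY subX subspace_0 by blast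
    next
      fix x y assume "x \<in> F Y t" "y \<in> F Y t"
      then obtain n c m d where "n \<in> F X t" "x = n + (if u \<le> t then c *s T u t v else 0)"
        "m \<in> F X t" "y = m + (if u \<le> t then d *s T u t v else 0)" unfolding FY by blast
      then show "x + y \<in> F Y t" unfolding FY using subX
        by (auto intro!: bexI[of _ "n + m"] exI[of _ "c + d"] simp: scale_left_distrib subspace_add)
    next
      fix a x assume "x \<in> F Y t"
      then obtain n c where "n \<in> F X t" "x = n + (if u \<le> t then c *s T u t v else 0)"
        unfolding FY by blast
      then show "a *s x \<in> F Y t" unfolding FY using subX
        by (auto intro!: bexI[of _ "a *s n"] exI[of _ "a * c"] simp: scale_right_distrib subspace_scale)
    qed
    moreover have "F Y t \<subseteq> E t" for t
    proof
      fix w assume "w \<in> F Y t"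
      then obtain n c where n: "n \<in> F X t" "w = n + (if u \<le> t then c *s T u t v else 0)"
        unfolding FY by blast
      have "(if u \<le> t then c *s T u t v else 0) \<in> E t"
        using T_in[OF _ u(1)] subspace_scale[OF sub_E] subspace_0[OF sub_E] by simp
      then show "w \<in> E t" unfolding n(2) using subsetD[OF XE n(1)] by (intro subspace_add[OF sub_E])
    qed
    moreover have "T s t w \<in> F Y t" if "s \<le> t" "w \<in> F Y s" for s t w
    proof -
      from that(2) obtain n c where n: "n \<in> F X s" "w = n + (if u \<le> s then c *s T u s v else 0)"
        unfolding FY by blast
      show ?thesis
      proof (cases "u \<le> s")
        case True
        have "T s t w = T s t n + c *s T u t v" using n True T_comp[OF True that(1) u(1)]
          by (simp add: T_add T_scale)
        then show ?thesis unfolding FY using XT[OF that(1) n(1)] True that(1) by auto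
      next
        case False
        then have "T s t w \<in> F X t" using n XT[OF that(1)] by simp
        then show ?thesis using FXY by blast
      qed
    qed
    moreover have "E s \<subseteq> F Y s" if "s \<notin> B" for s
      using Xout[OF that] FXY[of s] by (rule order_trans)
    ultimately have "\<exists>t\<in>B. g t \<in> F Y t" using nok by (simp add: ok_def)
    then obtain t where t: "t \<in> B" "g t \<in> F Y t" by (rule bexE)
    then obtain n c where "n \<in> F X t" "g t = n + (if u \<le> t then c *s T u t v else 0)"
      unfolding FY by blast
    moreover have "u \<le> t" using Xg[OF t(1)] calculation by (auto split: if_splits)
    ultimately show ?thesis using t by auto
  qed
  have "\<exists>c. v - c *s g u \<in> F X u" if u: "u \<in> B" "v \<in> E u" for u v
  proof (rule ccontr)
    assume neg: "\<nexists>c. v - c *s g u \<in> F X u"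
    have "v \<notin> F X u" using neg by (metis diff_zero scale_zero_left)
    then obtain t n c where t: "t \<in> B" "u \<le> t" "n \<in> F X t" "g t = n + c *s T u t v"
      using key u by blast
    have c: "c \<noteq> 0" using t(3,4) Xg[OF t(1)] by auto
    \<comment> \<open>The coefficient \<open>inverse c\<close> makes the images of \<open>v\<close>
      cancel at \<open>t\<close>: only a multiple of \<open>n\<close>, a vector of \<open>X\<close>,
      remains.\<close>
    define v' where "v' = v - inverse c *s g u"
    have v'E: "v' \<in> E u" unfolding v'_def
      using u g_in by (intro subspace_diff subspace_scale sub_E) auto
    have "T u t v' = T u t v - inverse c *s g t"
      using g_T[OF u(1) t(2)] t(1) by (simp add: v'_def T_diff T_scale)
    also have "\<dots> = - (inverse c *s n)" using c by (simp add: t(4) scale_right_distrib)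
    finally have T1: "T u t v' \<in> F X t" using t subX by (simp add: subspace_neg subspace_scale)
    have "v' \<notin> F X u" using neg v'_def by blast
    then obtain t' n' c' where t': "t' \<in> B" "u \<le> t'" "n' \<in> F X t'" "g t' = n' + c' *s T u t' v'"
      using key v'E by blast
    \<comment> \<open>Above both \<open>t\<close> and \<open>t'\<close> the image of
      \<open>v'\<close> lies in \<open>X\<close>, so the second expression, for \<open>g t'\<close>,
      puts \<open>g w\<close> into \<open>X\<close> itself.\<close>
    obtain w where w: "w \<in> B" "t \<le> w" "t' \<le> w" using dir t t' by blast
    have "T u w v' \<in> F X w" using XT[OF w(2) T1] T_comp[OF t(2) w(2) v'E] by simp
    moreover have "g w = T t' w n' + c' *s T u w v'"
      using g_T[OF t'(1) w(3)] w(1) t'(4) T_comp[OF t'(2) w(3) v'E] by (simp add: T_add T_scale)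
    ultimately have "g w \<in> F X w"
      using XT[OF w(3) t'(3)] subX by (simp add: subspace_add subspace_scale)
    then show False using Xg w by simp
  qed
  moreover have "F X t = E t" if "t \<notin> B" for t using XE Xout[OF that] by (intro subset_antisym)
  ultimately show ?thesis using that[of "F X"] subX XE XT Xg by simp
qed

text \<open>The images of \<open>R m\<close> in stage \<open>n\<close> shrink as \<open>m\<close>
  grows and stabilise by finite dimension. The stable images map onto each other, so lifts can be
  chosen one step at a time.\<close>

lemma mittag_leffler:
  fixes s :: "nat \<Rightarrow> 'p"
  assumes dec: "\<And>m n. m \<le> n \<Longrightarrow> s n \<le> s m"
    and sub: "\<And>n. subspace (R n)" and RE: "\<And>n. R n \<subseteq> E (s n)"
    and RT: "\<And>m n v. m \<le> n \<Longrightarrow> v \<in> R n \<Longrightarrow> T (s n) (s m) v \<in> R m"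
    and g: "\<And>n. \<exists>w\<in>R n. T (s n) (s 0) w = g"
  obtains w where "w 0 = g" "\<And>n. w n \<in> R n" "\<And>n. T (s (Suc n)) (s n) (w (Suc n)) = w n"
proof -
  define I where "I n m = T (s m) (s n) ` R m" for n m
  have subI: "subspace (I n m)" for n m unfolding I_def using sub subspace_T_image by blast
  have IE: "I n m \<subseteq> E (s n)" if "n \<le> m" for n m
    unfolding I_def using RE T_in dec[OF that] by blast
  have anti: "I n k \<subseteq> I n m" if "n \<le> m" "m \<le> k" for n m k
  proof
    fix x assume "x \<in> I n k"
    then obtain w where w: "w \<in> R k" "x = T (s k) (s n) w" unfolding I_def by blast
    have "x = T (s m) (s n) (T (s k) (s m) w)"
      using T_comp[OF dec[OF that(2)] dec[OF that(1)] subsetD[OF RE w(1)]] w(2) by simp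
    then show "x \<in> I n m" unfolding I_def using RT[OF that(2) w(1)] by blast
  qed
  have stable: "\<exists>m\<ge>n. \<forall>k\<ge>m. I n k = I n m" for n
  proof -
    obtain m where m: "m \<ge> n" and min: "\<And>k. k \<ge> n \<Longrightarrow> dim (I n m) \<le> dim (I n k)"
      using ex_has_least_nat[of "\<lambda>m. m \<ge> n" n "\<lambda>m. dim (I n m)"] by blast
    have "I n k = I n m" if "k \<ge> m" for k
      by (rule dim_eqI[OF subI anti[OF m that] IE[OF m]]) (use min m that in auto)
    then show ?thesis using m by blast
  qed
  define S where "S n = (\<Inter>m\<in>{n..}. I n m)" for n
  have onto: "\<exists>w'\<in>S (Suc n). T (s (Suc n)) (s n) w' = w" if "w \<in> S n" for n w
  proof -
    \<comment> \<open>The lift is taken from a stage \<open>m\<close> where the images in stage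
      \<open>Suc n\<close> are already stable; the image of \<open>w0\<close> then lies in all of
      them.\<close>
    obtain m where m: "m \<ge> Suc n" "\<And>k. k \<ge> m \<Longrightarrow> I (Suc n) k = I (Suc n) m"
      using stable by blast
    have "w \<in> I n m" using that m(1) by (auto simp: S_def)
    then obtain w0 where w0: "w0 \<in> R m" "w = T (s m) (s n) w0" unfolding I_def by blast
    have "T (s m) (s (Suc n)) w0 \<in> I (Suc n) k" if "k \<ge> Suc n" for k
    proof (cases "k \<ge> m")
      case True
      have "T (s m) (s (Suc n)) w0 \<in> I (Suc n) m" using w0(1) unfolding I_def by (rule imageI)
      then show ?thesis using m(2)[OF True] by simp
    next
      case False
      then have "I (Suc n) m \<subseteq> I (Suc n) k" using anti that by simp
      moreover have "T (s m) (s (Suc n)) w0 \<in> I (Suc n) m" using w0(1) unfolding I_def by (rule imageI)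
      ultimately show ?thesis by (rule subsetD)
    qed
    moreover have "T (s (Suc n)) (s n) (T (s m) (s (Suc n)) w0) = w"
      using T_comp[OF dec[OF m(1)] dec subsetD[OF RE w0(1)], of n] w0(2) by simp
    ultimately show ?thesis unfolding S_def by (intro bexI[of _ "T (s m) (s (Suc n)) w0"]) auto
  qed
  have gS: "g \<in> S 0"
  proof -
    have "g \<in> I 0 m" for m unfolding I_def using g[of m] by (elim bexE) (auto intro: rev_image_eqI)
    then show ?thesis unfolding S_def by simp
  qed
  have "\<exists>w. \<forall>n. (w n \<in> S n \<and> (n = 0 \<longrightarrow> w n = g)) \<and> T (s (Suc n)) (s n) (w (Suc n)) = w n"
    by (rule dependent_nat_choice) (use gS onto in auto)
  then obtain w where w: "\<And>n. w n \<in> S n" "w 0 = g" "\<And>n. T (s (Suc n)) (s n) (w (Suc n)) = w n"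
    by auto
  have "S n \<subseteq> R n" for n
  proof
    fix x assume "x \<in> S n"
    then have "x \<in> I n n" by (auto simp: S_def)
    then show "x \<in> R n" using RT[of n n] by (auto simp: I_def)
  qed
  then show ?thesis using that[OF w(2) _ w(3)] w(1) by (simp add: subset_iff)
qed

end

section \<open>Splitting off a block\<close>

text \<open>The unqualified names denote facts about the vectors of \<^theory>\<open>Jordan_Normal_Form.Matrix\<close>.\<close>

lemmas cvec_eq_iff = Finite_Cartesian_Product.vec_eq_iff
lemmas cvec_le_iff = Finite_Cartesian_Product.less_eq_vec_def

section \<open>Changing one coordinate of a point\<close>

definition upd :: "real^'n \<Rightarrow> 'n \<Rightarrow> real \<Rightarrow> real^'n" where
  "upd x i a = (\<chi> j. if j = i then a else x$j)"

lemma upd_nth [simp]: "upd x i a $ j = (if j = i then a else x$j)"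
  by (simp add: upd_def)

lemma upd_same [simp]: "upd x i (x$i) = x"
  by (simp add: cvec_eq_iff)

lemma upd_upd [simp]: "upd (upd x i a) i b = upd x i b"
  by (simp add: cvec_eq_iff)

lemma upd_commute: "i \<noteq> j \<Longrightarrow> upd (upd x i a) j b = upd (upd x j b) i a"
  by (simp add: cvec_eq_iff)

lemma le_upd: "x$i \<le> a \<Longrightarrow> x \<le> upd x i a"
  by (simp add: cvec_le_iff)

lemma upd_le: "a \<le> x$i \<Longrightarrow> upd x i a \<le> x"
  by (simp add: cvec_le_iff)

lemma upd_le_upd: "x \<le> y \<Longrightarrow> a \<le> b \<Longrightarrow> upd x i a \<le> upd y i b"
  by (simp add: cvec_le_iff)

lemma ex_3: "(\<exists>j::3. P j) \<longleftrightarrow> P 1 \<or> P 2 \<or> P 3"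
  by (metis exhaust_3)

lemma third_coordinate:
  assumes "i \<noteq> (k::3)"
  obtains j where "j \<noteq> i" "j \<noteq> k" "\<And>l. l = i \<or> l = j \<or> l = k"
proof -
  have "\<exists>j. j \<noteq> i \<and> j \<noteq> k \<and> (\<forall>l. l = i \<or> l = j \<or> l = k)"
    using assms exhaust_3[of i] exhaust_3[of k] by (elim disjE) (auto simp: ex_3 forall_3)
  then show ?thesis using that by blast
qed

lemma other_coordinates:
  obtains j k where "j \<noteq> i" "k \<noteq> i" "j \<noteq> k" "\<And>l::3. l = i \<or> l = j \<or> l = k"
proof -
  have "i + 1 \<noteq> i" by simp
  then obtain k where "k \<noteq> i + 1" "k \<noteq> i" "\<And>l. l = i + 1 \<or> l = k \<or> l = i"
    using third_coordinate[of "i + 1" i] by metis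
  then show ?thesis using that[of "i + 1" k] by (metis \<open>i + 1 \<noteq> i\<close>)
qed

definition pbox :: "('n \<Rightarrow> real set) \<Rightarrow> (real^'n) set" where
  "pbox J = {u. \<forall>i. u$i \<in> J i}"

text \<open>Mittag-Leffler runs along sequences, so a box must be exhausted from below by countably
  many points. If \<open>X\<close> has no least element, a rational lies between any element and a
  smaller one, so it suffices to pick an element of \<open>X\<close> below each rational that has
  one; running minima make the choice decreasing.\<close>

lemma coinitial_sequence:
  fixes X :: "real set"
  assumes a: "a \<in> X"
  obtains x :: "nat \<Rightarrow> real" where "x 0 = a" "\<And>n. x n \<in> X" "\<And>m n. m \<le> n \<Longrightarrow> x n \<le> x m"
    "\<And>c. c \<in> X \<Longrightarrow> \<exists>n. x n \<le> c"
proof (cases "\<exists>m\<in>X. \<forall>c\<in>X. m \<le> c")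
  case True
  then obtain m where m: "m \<in> X" "\<And>c. c \<in> X \<Longrightarrow> m \<le> c" by blast
  show ?thesis
  proof (rule that[of "\<lambda>n. if n = 0 then a else m"])
    show "\<exists>n::nat. (if n = 0 then a else m) \<le> c" if "c \<in> X" for c
      using m(2)[OF that] by (intro exI[of _ "Suc 0"]) simp
  qed (use m a in auto)
next
  case False
  obtain q :: "nat \<Rightarrow> rat" where q: "surj q" using surj_nat_to_rat_surj by blast
  define f where "f n = (if \<exists>c\<in>X. c < of_rat (q n) then SOME c. c \<in> X \<and> c < of_rat (q n) else a)" for n
  have f: "f n \<in> X" "(\<exists>c\<in>X. c < of_rat (q n)) \<Longrightarrow> f n < of_rat (q n)" for n
    using someI_ex[of "\<lambda>c. c \<in> X \<and> c < of_rat (q n)"] a unfolding f_def by (auto simp: Bex_def)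
  define x where "x n = Min (insert a (f ` {..<n}))" for n
  have xin: "x n \<in> insert a (f ` {..<n})" for n unfolding x_def by (rule Min_in) auto
  have "x n \<in> X" for n using xin[of n] f(1) a by auto
  moreover have "x n \<le> x m" if "m \<le> n" for m n
    unfolding x_def using that by (intro Min_antimono) auto
  moreover have "\<exists>n. x n \<le> c" if "c \<in> X" for c
  proof -
    from that obtain c' where c': "c' \<in> X" "c' < c" using False by force
    obtain r where r: "c' < of_rat r" "of_rat r < c" using of_rat_dense c'(2) by blast
    obtain n where n: "r = q n" using q by (metis surjD)
    have "f n < of_rat (q n)" by (rule f(2)) (use c' r n in blast)
    moreover have "x (Suc n) \<le> f n" unfolding x_def by (rule Min_le) auto
    ultimately show ?thesis using r(2)[unfolded n] by (intro exI[of _ "Suc n"]) linarith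
  qed
  moreover have "x 0 = a" by (simp add: x_def)
  ultimately show ?thesis using that by blast
qed

section \<open>Compatible lifts over a box\<close>

context pmod
begin

text \<open>Internal direct sum of \<open>N\<close> with the submodule spanned by the vectors
  \<open>h t\<close>, a copy of the block module of \<open>B\<close>. Where that copy vanishes,
  \<open>N\<close> is everything.\<close>

definition is_summand :: "'p set \<Rightarrow> ('p \<Rightarrow> 'a) \<Rightarrow> ('p \<Rightarrow> 'a set) \<Rightarrow> bool" where
  "is_summand B h N \<longleftrightarrow>
    (\<forall>t. subspace (N t) \<and> N t \<subseteq> E t) \<and> (\<forall>s t v. s \<le> t \<longrightarrow> v \<in> N s \<longrightarrow> T s t v \<in> N t) \<and>
    (\<forall>t. t \<notin> B \<longrightarrow> N t = E t) \<and>
    (\<forall>t\<in>B. h t \<in> E t \<and> h t \<notin> N t \<and> (\<forall>v\<in>E t. \<exists>c. v - c *s h t \<in> N t)) \<and>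
    (\<forall>s\<in>B. \<forall>t. s \<le> t \<longrightarrow> T s t (h s) = (if t \<in> B then h t else 0))"

end

locale pmod_vec = pmod scale E T
  for scale :: "'k::field \<Rightarrow> 'a::ab_group_add \<Rightarrow> 'a" (infixr "*s" 75)
    and E :: "real^'n::finite \<Rightarrow> 'a set" and T :: "real^'n \<Rightarrow> real^'n \<Rightarrow> 'a \<Rightarrow> 'a"
begin

text \<open>The assumed lifts need not fit together. They are made compatible along one decreasing
  sequence that is coinitial in the box, and the value at any other point is pushed up from a term
  of the sequence below it.\<close>

lemma exists_family:
  assumes t: "t \<in> pbox J"
    and lift: "\<And>s. s \<in> pbox J \<Longrightarrow> s \<le> t \<Longrightarrow>
      \<exists>w\<in>E s. T s t w = g \<and> (\<forall>u. s \<le> u \<longrightarrow> u \<notin> pbox J \<longrightarrow> T s u w = 0)"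
  obtains h where "h t = g" "\<And>s. s \<in> pbox J \<Longrightarrow> h s \<in> E s"
    "\<And>s u. s \<in> pbox J \<Longrightarrow> s \<le> u \<Longrightarrow> T s u (h s) = (if u \<in> pbox J then h u else 0)"
proof -
  have "\<exists>x :: nat \<Rightarrow> real. x 0 = t$i \<and> (\<forall>n. x n \<in> {c \<in> J i. c \<le> t$i}) \<and>
      (\<forall>m n. m \<le> n \<longrightarrow> x n \<le> x m) \<and> (\<forall>c\<in>{c \<in> J i. c \<le> t$i}. \<exists>n. x n \<le> c)" for i
  proof -
    have "t$i \<in> {c \<in> J i. c \<le> t$i}" using t by (simp add: pbox_def)
    then show ?thesis
    proof (rule coinitial_sequence)
      fix x :: "nat \<Rightarrow> real"
      assume "x 0 = t$i" "\<And>n. x n \<in> {c \<in> J i. c \<le> t$i}"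
        "\<And>m n. m \<le> n \<Longrightarrow> x n \<le> x m" "\<And>c. c \<in> {c \<in> J i. c \<le> t$i} \<Longrightarrow> \<exists>n. x n \<le> c"
      then show ?thesis by (intro exI[of _ x] conjI allI impI ballI)
    qed
  qed
  then obtain x :: "'n \<Rightarrow> nat \<Rightarrow> real" where x0: "\<And>i. x i 0 = t$i"
    and xJ: "\<And>i n. x i n \<in> J i" and xt: "\<And>i n. x i n \<le> t$i" and xd: "\<And>i m n. m \<le> n \<Longrightarrow> x i n \<le> x i m"
    and xc: "\<And>i c. c \<in> J i \<Longrightarrow> c \<le> t$i \<Longrightarrow> \<exists>n. x i n \<le> c"
    by (simp add: choice_iff) metis
  define s where "s n = (\<chi> i. x i n)" for n
  have s0: "s 0 = t" by (simp add: s_def cvec_eq_iff x0)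
  have dec: "s n \<le> s m" if "m \<le> n" for m n using xd[OF that] by (simp add: s_def cvec_le_iff)
  have sB: "s n \<in> pbox J" for n using xJ by (simp add: s_def pbox_def)
  have st: "s n \<le> t" for n using xt by (simp add: s_def cvec_le_iff)
  have cof: "\<exists>n. s n \<le> u" if u: "u \<in> pbox J" for u
  proof -
    \<comment> \<open>The sequence is coinitial only below \<open>t$i\<close>, so coordinates of
      \<open>u\<close> beyond \<open>t\<close> are first cut down.\<close>
    have "\<exists>n. x i n \<le> min (u$i) (t$i)" for i
      using xc[of "min (u$i) (t$i)" i] u t by (auto simp: pbox_def min_def split: if_splits)
    then obtain n where n: "\<And>i. x i (n i) \<le> min (u$i) (t$i)" by metis
    \<comment> \<open>One index serves all coordinates at once, because there are finitely many of
      them.\<close>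
    have "x i (Max (range n)) \<le> u$i" for i
      using n[of i] xd[of "n i" "Max (range n)" i] by (simp add: min_le_iff_disj)
    then show ?thesis by (auto simp: s_def cvec_le_iff)
  qed
  \<comment> \<open>Vanishing on exit from the box is built into the spaces of the inverse system,
    so that it survives the choice of compatible lifts.\<close>
  define R where "R n = {w \<in> E (s n). \<forall>u. s n \<le> u \<longrightarrow> u \<notin> pbox J \<longrightarrow> T (s n) u w = 0}" for n
  have "subspace (R n)" for n
    unfolding R_def using sub_E[of "s n"]
    by (intro subspaceI) (auto simp: subspace_0 subspace_add subspace_scale T_0 T_add T_scale)
  moreover have RE: "R n \<subseteq> E (s n)" for n unfolding R_def by blast
  moreover have "T (s n) (s m) v \<in> R m" if "m \<le> n" "v \<in> R n" for m n v
    using that dec[OF that(1)] T_in T_comp unfolding R_def by (auto intro: order_trans)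
  moreover have "\<exists>w\<in>R n. T (s n) (s 0) w = g" for n
    using lift[OF sB st, of n] unfolding R_def s0 by blast
  ultimately obtain w where w: "w 0 = g" "\<And>n. w n \<in> R n" "\<And>n. T (s (Suc n)) (s n) (w (Suc n)) = w n"
    using mittag_leffler[of s R g] dec by metis
  have wE: "w n \<in> E (s n)" for n using w(2) RE by blast
  have wle: "T (s n) (s m) (w n) = w m" if "m \<le> n" for m n
    using that
  proof (induction n rule: dec_induct)
    case base
    then show ?case using T_id wE by simp
  next
    case (step n)
    have "T (s (Suc n)) (s m) (w (Suc n)) = T (s n) (s m) (T (s (Suc n)) (s n) (w (Suc n)))"
      using T_comp[OF dec dec wE] step by simp
    then show ?case using w(3) step by simp
  qed
  define N where "N u = (SOME n. s n \<le> u)" for u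
  have N: "s (N u) \<le> u" if "u \<in> pbox J" for u
    unfolding N_def using cof[OF that] by (rule someI_ex)
  define h where "h u = T (s (N u)) u (w (N u))" for u
  have indep: "T (s m) u (w m) = T (s n) u (w n)" if "s n \<le> u" "s m \<le> u" for m n u
  proof (cases "m \<le> n")
    case True
    then show ?thesis using T_comp[OF dec[OF True] that(2) wE[of n]] wle[OF True] by simp
  next
    case False
    then have "n \<le> m" by simp
    then show ?thesis using T_comp[OF dec[OF \<open>n \<le> m\<close>] that(1) wE[of m]] wle[OF \<open>n \<le> m\<close>] by simp
  qed
  have "h t = g" unfolding h_def using indep[OF _ N[OF t], of 0] s0 T_id w(1) wE[of 0] by simp
  moreover have "h u \<in> E u" if "u \<in> pbox J" for u
    unfolding h_def using T_in[OF N[OF that] wE] .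
  moreover have "T r u (h r) = (if u \<in> pbox J then h u else 0)" if r: "r \<in> pbox J" "r \<le> u" for r u
  proof -
    have le: "s (N r) \<le> u" using N[OF r(1)] r(2) by (rule order_trans)
    have "T r u (h r) = T (s (N r)) u (w (N r))"
      unfolding h_def using T_comp[OF N[OF r(1)] r(2) wE] .
    also have "\<dots> = (if u \<in> pbox J then h u else 0)"
    proof (cases "u \<in> pbox J")
      case True
      then show ?thesis using indep[OF N[OF True] le] by (simp add: h_def)
    next
      case False
      then show ?thesis using w(2)[of "N r"] le unfolding R_def by simp
    qed
    finally show ?thesis .
  qed
  ultimately show ?thesis using that by blast
qed

text \<open>Membership in \<open>outer\<close> moves upwards, so it has to be excluded only above
  \<open>t\<close>: any point of the box has a common upper bound with \<open>t\<close>
  there.\<close>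

lemma exists_summand:
  assumes t: "t \<in> pbox J"
    and lift: "\<And>s. s \<in> pbox J \<Longrightarrow> s \<le> t \<Longrightarrow>
      \<exists>w\<in>E s. T s t w = g \<and> (\<forall>u. s \<le> u \<longrightarrow> u \<notin> pbox J \<longrightarrow> T s u w = 0)"
    and out: "\<And>u. u \<in> pbox J \<Longrightarrow> t \<le> u \<Longrightarrow> T t u g \<notin> outer (pbox J) u"
  shows "\<exists>h N. is_summand (pbox J) h N"
proof -
  obtain h where h: "h t = g" "\<And>s. s \<in> pbox J \<Longrightarrow> h s \<in> E s"
    "\<And>s u. s \<in> pbox J \<Longrightarrow> s \<le> u \<Longrightarrow> T s u (h s) = (if u \<in> pbox J then h u else 0)"
    using exists_family[OF t lift] by metis
  have dir: "\<exists>c\<in>pbox J. a \<le> c \<and> b \<le> c" if "a \<in> pbox J" "b \<in> pbox J" for a b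
  proof (rule bexI)
    show "a \<le> (\<chi> i. max (a$i) (b$i)) \<and> b \<le> (\<chi> i. max (a$i) (b$i))"
      by (simp add: cvec_le_iff)
    show "(\<chi> i. max (a$i) (b$i)) \<in> pbox J" using that by (simp add: pbox_def max_def)
  qed
  have "h u \<notin> outer (pbox J) u" if u: "u \<in> pbox J" for u
  proof
    assume "h u \<in> outer (pbox J) u"
    obtain c where c: "c \<in> pbox J" "u \<le> c" "t \<le> c" using dir u t by blast
    have "h c \<in> outer (pbox J) c" using outer_T[OF c(2) \<open>h u \<in> _\<close>] h(3)[OF u c(2)] c(1) by simp
    moreover have "h c = T t c g" using h(1) h(3)[OF t c(3)] c(1) by simp
    ultimately show False using out[OF c(1,3)] by simp
  qed
  note hout = this
  show ?thesis
  proof (rule exists_complement[of "pbox J" h, OF dir h(2) h(3) hout])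
    fix N assume N: "\<And>t. subspace (N t)" "\<And>t. N t \<subseteq> E t"
      "\<And>s t v. s \<le> t \<Longrightarrow> v \<in> N s \<Longrightarrow> T s t v \<in> N t"
      "\<And>t. t \<notin> pbox J \<Longrightarrow> N t = E t" "\<And>t. t \<in> pbox J \<Longrightarrow> h t \<notin> N t"
      "\<And>t v. t \<in> pbox J \<Longrightarrow> v \<in> E t \<Longrightarrow> \<exists>c. v - c *s h t \<in> N t"
  have "is_summand (pbox J) h N" unfolding is_summand_def
  proof (intro conjI allI ballI impI)
    show "h u \<in> E u" if "u \<in> pbox J" for u using h(2) that .
    show "h u \<notin> N u" if "u \<in> pbox J" for u using N(5) that .
    show "T s u (h s) = (if u \<in> pbox J then h u else 0)" if "s \<in> pbox J" "s \<le> u" for s u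
      using h(3) that .
    qed (use N in simp_all)
    then show ?thesis by blast
  qed
qed

end

text \<open>The parts of strong exactness that are used: \<open>cube_lift\<close> is surjectivity onto the limit
  of the punctured cube for compatible families of the form \<open>(g, 0, 0)\<close>, and \<open>cube_colift\<close>
  is what injectivity of the map from the colimit says about one component.\<close>

locale exact_pmod = pmod_vec scale E T
  for scale :: "'k::field \<Rightarrow> 'a::ab_group_add \<Rightarrow> 'a" (infixr "*s" 75)
    and E :: "real^3 \<Rightarrow> 'a set" and T :: "real^3 \<Rightarrow> real^3 \<Rightarrow> 'a \<Rightarrow> 'a" +
  assumes square_lift: "i \<noteq> j \<Longrightarrow> x$i \<le> a \<Longrightarrow> x$j \<le> b \<Longrightarrow> p \<in> E (upd x i a) \<Longrightarrow> q \<in> E (upd x j b) \<Longrightarrow>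
      T (upd x i a) (upd (upd x i a) j b) p = T (upd x j b) (upd (upd x i a) j b) q \<Longrightarrow>
      \<exists>w\<in>E x. T x (upd x i a) w = p \<and> T x (upd x j b) w = q"
    and cube_lift: "i \<noteq> j \<Longrightarrow> i \<noteq> k \<Longrightarrow> j \<noteq> k \<Longrightarrow> x$i \<le> a \<Longrightarrow> x$j \<le> b \<Longrightarrow> x$k \<le> c \<Longrightarrow>
      g \<in> E (upd x k c) \<Longrightarrow> T (upd x k c) (upd (upd x k c) i a) g = 0 \<Longrightarrow>
      T (upd x k c) (upd (upd x k c) j b) g = 0 \<Longrightarrow>
      \<exists>w\<in>E x. T x (upd x k c) w = g \<and> T x (upd x i a) w = 0 \<and> T x (upd x j b) w = 0"
    and cube_colift: "i \<noteq> j \<Longrightarrow> i \<noteq> k \<Longrightarrow> j \<noteq> k \<Longrightarrow> a \<le> y$i \<Longrightarrow> b \<le> y$j \<Longrightarrow> c \<le> y$k \<Longrightarrow>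
      w \<in> E (upd y k c) \<Longrightarrow> p \<in> E (upd y i a) \<Longrightarrow> q \<in> E (upd y j b) \<Longrightarrow>
      T (upd y k c) y w = T (upd y i a) y p + T (upd y j b) y q \<Longrightarrow>
      \<exists>r\<in>E (upd (upd y k c) i a). \<exists>r'\<in>E (upd (upd y k c) j b).
        w = T (upd (upd y k c) i a) (upd y k c) r + T (upd (upd y k c) j b) (upd y k c) r'"
begin

section \<open>Lifting vectors with prescribed kernels\<close>

definition killed :: "real^3 \<Rightarrow> 3 set \<Rightarrow> (3 \<Rightarrow> real) \<Rightarrow> 'a set" where
  "killed t A y = {v \<in> E t. \<forall>i\<in>A. T t (upd t i (y i)) v = 0}"

lemma subspace_killed: "subspace (killed t A y)"
  unfolding killed_def using sub_E[of t]
  by (intro subspaceI) (auto simp: subspace_0 subspace_add subspace_scale T_0 T_add T_scale)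

lemma killed_subset: "killed t A y \<subseteq> E t"
  by (auto simp: killed_def)

text \<open>Of the two directions other than \<open>k\<close>, either both are in \<open>A\<close>,
  and the cube lifts \<open>w\<close> while killing in both, or only \<open>i\<close> is, and a
  square with 0 on one side does it. A condition in direction \<open>k\<close> itself is inherited
  from \<open>w\<close>, since its threshold lies beyond \<open>c\<close>.\<close>

lemma killed_lift_one:
  assumes c: "s$k \<le> c" and A: "i \<in> A" "i \<noteq> k"
    and y: "\<And>j. j \<in> A \<Longrightarrow> upd s k c $ j \<le> y j" and w: "w \<in> killed (upd s k c) A y"
  shows "\<exists>v\<in>killed s A y. T s (upd s k c) v = w"
proof -
  have wE: "w \<in> E (upd s k c)" and w0: "\<And>j. j \<in> A \<Longrightarrow> T (upd s k c) (upd (upd s k c) j (y j)) w = 0"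
    using w by (auto simp: killed_def)
  have si: "s$i \<le> y i" using y[OF A(1)] A(2) by simp
  obtain j where j: "j \<noteq> i" "j \<noteq> k" "\<And>l. l = i \<or> l = j \<or> l = k" using third_coordinate A(2) by blast
  have "\<exists>v\<in>E s. T s (upd s k c) v = w \<and> (\<forall>l\<in>A - {k}. T s (upd s l (y l)) v = 0)"
  proof (cases "j \<in> A")
    case True
    have "s$j \<le> y j" using y[OF True] j by simp
    then obtain v where v: "v \<in> E s" "T s (upd s k c) v = w" "T s (upd s i (y i)) v = 0" "T s (upd s j (y j)) v = 0"
      using cube_lift[of i j k s "y i" "y j" c w] j A(2) si c wE w0 A(1) True by blast
    have "T s (upd s l (y l)) v = 0" if "l \<in> A - {k}" for l
      using j(3)[of l] that v(3,4) by auto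
    then show ?thesis using v(1,2) by blast
  next
    case False
    have "T (upd s k c) (upd (upd s k c) i (y i)) w = T (upd s i (y i)) (upd (upd s k c) i (y i)) 0"
      using w0 A(1) by (simp add: T_0)
    then obtain v where v: "v \<in> E s" "T s (upd s k c) v = w" "T s (upd s i (y i)) v = 0"
      using square_lift[of k i s c "y i" w 0] A(2) si c wE subspace_0[OF sub_E] by metis
    have "T s (upd s l (y l)) v = 0" if "l \<in> A - {k}" for l
      using j(3)[of l] that v(3) False by auto
    then show ?thesis using v(1,2) by blast
  qed
  then obtain v where v: "v \<in> E s" "T s (upd s k c) v = w" "\<And>l. l \<in> A \<Longrightarrow> l \<noteq> k \<Longrightarrow> T s (upd s l (y l)) v = 0"
    by blast
  have "T s (upd s k (y k)) v = 0" if "k \<in> A"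
  proof -
    have "c \<le> y k" using y[OF that] by simp
    then have "T s (upd s k (y k)) v = T (upd s k c) (upd s k (y k)) (T s (upd s k c) v)"
      using T_comp[OF le_upd[OF c] _ v(1)] by (simp add: upd_le_upd)
    then show ?thesis using v(2) w0[OF that] by simp
  qed
  then show ?thesis using v unfolding killed_def by blast
qed

text \<open>Coordinates are lowered one by one. Two distinct elements of \<open>A\<close> are
  demanded because each step along \<open>k\<close> uses a killed direction other than
  \<open>k\<close>.\<close>

lemma killed_lift:
  assumes le: "s \<le> t" and A: "i \<in> A" "j \<in> A" "i \<noteq> j"
    and y: "\<And>l. l \<in> A \<Longrightarrow> t$l \<le> y l" and w: "w \<in> killed t A y"
  shows "\<exists>v\<in>killed s A y. T s t v = w"
proof -
  define r1 where "r1 = upd s 1 (t$1)"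
  define r2 where "r2 = upd r1 2 (t$2)"
  have le': "s$l \<le> t$l" for l using le by (simp add: cvec_le_iff)
  have t: "upd r2 3 (t$3) = t" by (simp add: r2_def r1_def cvec_eq_iff forall_3)
  have A': "\<exists>l\<in>A. l \<noteq> k" for k using A by metis
  have step: "\<exists>v\<in>killed r A y. T r (upd r k (t$k)) v = u"
    if "s \<le> r" "r \<le> t" "u \<in> killed (upd r k (t$k)) A y" for r k u
  proof -
    obtain l where "l \<in> A" "l \<noteq> k" using A' by blast
    moreover have "r$l \<le> t$l" for l using that(2) by (simp add: cvec_le_iff)
    moreover have "upd r k (t$k) $ l \<le> y l" if "l \<in> A" for l
      using y[OF that] calculation(3)[of l] by auto
    ultimately show ?thesis using killed_lift_one[of r k "t$k" l A y u] that(3) by blast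
  qed
  have r: "s \<le> r1" "r1 \<le> t" "r1 \<le> r2" "r2 \<le> t" "s \<le> r2"
    using le' by (simp_all add: r1_def r2_def cvec_le_iff)
  obtain v2 where v2: "v2 \<in> killed r2 A y" "T r2 t v2 = w"
    using step[OF r(5,4), of w 3] w t by auto
  obtain v1 where v1: "v1 \<in> killed r1 A y" "T r1 r2 v1 = v2"
    using step[OF r(1,2), of v2 2] v2 unfolding r2_def by auto
  obtain v where v: "v \<in> killed s A y" "T s r1 v = v1"
    using step[OF order_refl le, of v1 1] v1 unfolding r1_def by auto
  have "T s t v = w"
    using v v1 v2 T_comp r killed_subset by (metis subsetD)
  then show ?thesis using v by blast
qed

end

section \<open>Existence of a block summand\<close>

lemma pbox_birth:
  assumes up: "\<And>i a b. a \<in> U i \<Longrightarrow> a \<le> b \<Longrightarrow> b \<in> U i" and t: "t \<in> pbox U"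
  shows "pbox U \<in> blocks"
proof -
  have "cuboid_with (\<lambda>i. (- U i, U i)) (\<lambda>i. (UNIV, {})) (pbox U)"
    unfolding cuboid_with_def cuboid_of_def is_cut_def pbox_def
    using t up by (auto simp: pbox_def) (meson linorder_not_less)
  then have "birth_block (pbox U)" unfolding birth_block_def by fastforce
  then show ?thesis by (simp add: blocks_def)
qed

lemma pbox_death:
  assumes down: "\<And>i a b. b \<in> D i \<Longrightarrow> a \<le> b \<Longrightarrow> a \<in> D i" and t: "t \<in> pbox D"
  shows "pbox D \<in> blocks"
proof -
  have "cuboid_with (\<lambda>i. ({}, UNIV)) (\<lambda>i. (D i, - D i)) (pbox D)"
    unfolding cuboid_with_def cuboid_of_def is_cut_def pbox_def
    using t down by (auto simp: pbox_def) (meson linorder_not_less)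
  then have "death_block (pbox D)" unfolding death_block_def by fastforce
  then show ?thesis by (simp add: blocks_def)
qed

lemma pbox_layer:
  assumes conv: "\<And>a b x. a \<in> J \<Longrightarrow> b \<in> J \<Longrightarrow> a \<le> x \<Longrightarrow> x \<le> b \<Longrightarrow> x \<in> J"
    and t: "t$i \<in> J"
  shows "pbox (\<lambda>l. if l = i then J else UNIV) \<in> blocks"
proof -
  define L where "L = {x. \<exists>y\<in>J. y \<le> x}"
  define D where "D = {x. \<exists>y\<in>J. x \<le> y}"
  have J: "J = L \<inter> D" using conv by (auto simp: L_def D_def)
  have L: "b \<in> L" if "a \<le> b" "a \<in> L" for a b
    using that unfolding L_def by (blast intro: order_trans)
  have D: "a \<in> D" if "a \<le> b" "b \<in> D" for a b
    using that unfolding D_def by (blast intro: order_trans)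
  have "pbox (\<lambda>l. if l = i then J else UNIV) = {u. u$i \<in> J}" by (auto simp: pbox_def)
  moreover have "cuboid_with (\<lambda>l. if l = i then (- L, L) else ({}, UNIV))
      (\<lambda>l. if l = i then (D, - D) else (UNIV, {})) {u. u$i \<in> J}"
    unfolding cuboid_with_def
  proof (intro conjI allI)
    show "is_cut (if l = i then (- L, L) else ({}, UNIV))" for l
      using L unfolding is_cut_def by (auto simp: not_le[symmetric])
    show "is_cut (if l = i then (D, - D) else (UNIV, {}))" for l
      using D unfolding is_cut_def by (auto simp: not_le[symmetric])
    show "{u. u$i \<in> J} = cuboid_of (\<lambda>l. if l = i then (- L, L) else ({}, UNIV))
      (\<lambda>l. if l = i then (D, - D) else (UNIV, {}))"
      by (auto simp: cuboid_of_def J)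
    show "{u. u$i \<in> J} \<noteq> {}" using t by blast
  qed
  ultimately have "layer_block i (pbox (\<lambda>l. if l = i then J else UNIV))"
    unfolding layer_block_def
    by (intro exI[of _ "\<lambda>l. if l = i then (- L, L) else ({}, UNIV)"]
        exI[of _ "\<lambda>l. if l = i then (D, - D) else (UNIV, {})"]) simp
  then show ?thesis by (auto simp: blocks_def)
qed

section \<open>Splitting off a death block\<close>

context exact_pmod
begin

text \<open>All-or-nothing for minimal kernels: imposing the condition that \<open>v\<close>
  satisfies cuts out a nonzero intersection of the same kind, which by minimality is the whole of
  \<open>killed t A y\<close>.\<close>

lemma killed_insert_constant:
  assumes P: "i \<in> A" "j \<in> A" "i \<noteq> j" "\<And>l. l \<in> A \<Longrightarrow> t$l \<le> y l"
    and min: "\<And>A' y'. \<exists>i\<in>A'. \<exists>j\<in>A'. i \<noteq> j \<Longrightarrow> \<forall>l\<in>A'. t$l \<le> y' l \<Longrightarrow> killed t A' y' \<noteq> {0} \<Longrightarrow>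
      dim (killed t A y) \<le> dim (killed t A' y')"
    and v: "v \<in> killed t A y" "v \<noteq> 0" "t$k \<le> c" "T t (upd t k c) v = 0"
    and w: "w \<in> killed t A y"
  shows "T t (upd t k c) w = 0"
proof (cases "k \<in> A \<and> y k \<le> c")
  case True
  then have "T t (upd t k c) w = T (upd t k (y k)) (upd t k c) (T t (upd t k (y k)) w)"
    using T_comp[OF le_upd[OF P(4)] _ subsetD[OF killed_subset w]] by (simp add: upd_le_upd)
  then show ?thesis using w True by (simp add: killed_def T_0)
next
  case False
  \<comment> \<open>If \<open>k\<close> was in \<open>A\<close> with a threshold beyond
    \<open>c\<close>, the new threshold replaces it; this only strengthens the condition.\<close>
  define y' where "y' = y(k := c)"
  have "killed t (insert k A) y' \<subseteq> killed t A y"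
  proof
    fix x assume x: "x \<in> killed t (insert k A) y'"
    have "T t (upd t l (y l)) x = 0" if l: "l \<in> A" for l
    proof (cases "l = k")
      case True
      then have "c \<le> y k" using False l by simp
      then have "T t (upd t k (y k)) x = T (upd t k c) (upd t k (y k)) (T t (upd t k c) x)"
        using T_comp[OF le_upd[OF v(3)] _ subsetD[OF killed_subset x]] by (simp add: upd_le_upd)
      then show ?thesis using x True by (simp add: killed_def y'_def T_0)
    next
      case False
      then show ?thesis using x l by (auto simp: killed_def y'_def)
    qed
    then show "x \<in> killed t A y" using x by (simp add: killed_def)
  qed
  moreover have v': "v \<in> killed t (insert k A) y'" using v(1,4) by (auto simp: killed_def y'_def)
  moreover have "dim (killed t A y) \<le> dim (killed t (insert k A) y')"
  proof (rule min)
    show "\<exists>i\<in>insert k A. \<exists>j\<in>insert k A. i \<noteq> j" using P by blast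
    show "\<forall>l\<in>insert k A. t$l \<le> y' l" using P v(3) by (auto simp: y'_def)
    show "killed t (insert k A) y' \<noteq> {0}" using v' v(2) by blast
  qed
  ultimately have "killed t (insert k A) y' = killed t A y"
    using dim_eqI[OF subspace_killed _ killed_subset] by blast
  then have "w \<in> killed t (insert k A) y'" using w by simp
  then show ?thesis by (simp add: killed_def y'_def)
qed

lemma death_summand:
  assumes ex: "i0 \<noteq> j0" "v0 \<in> E t0" "v0 \<noteq> 0" "t0$i0 \<le> a0" "t0$j0 \<le> b0"
    "T t0 (upd t0 i0 a0) v0 = 0" "T t0 (upd t0 j0 b0) v0 = 0"
  shows "\<exists>B\<in>blocks. \<exists>h N. is_summand B h N"
proof -
  define P where "P = (\<lambda>(t, A, y). (\<exists>i\<in>A. \<exists>j\<in>A. i \<noteq> j) \<and> (\<forall>l\<in>A. t$l \<le> y l) \<and> killed t A y \<noteq> {0})"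
  have "v0 \<in> killed t0 {i0, j0} (\<lambda>l. if l = i0 then a0 else b0)" using ex by (auto simp: killed_def)
  then have "P (t0, {i0, j0}, \<lambda>l. if l = i0 then a0 else b0)" using ex unfolding P_def by auto
  then have "\<exists>z. P z \<and> (\<forall>z'. P z' \<longrightarrow> (\<lambda>(t, A, y). dim (killed t A y)) z \<le> (\<lambda>(t, A, y). dim (killed t A y)) z')"
    by (rule ex_has_least_nat)
  then obtain t A y where P: "P (t, A, y)"
    and min: "\<And>t' A' y'. P (t', A', y') \<Longrightarrow> dim (killed t A y) \<le> dim (killed t' A' y')"
    by (auto simp: split_paired_all)
  obtain i j where A: "i \<in> A" "j \<in> A" "i \<noteq> j" and y: "\<And>l. l \<in> A \<Longrightarrow> t$l \<le> y l"
    and ne: "killed t A y \<noteq> {0}" using P unfolding P_def by auto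
  define Q where "Q = killed t A y"
  obtain g where g: "g \<in> Q" "g \<noteq> 0" using ne subspace_0[OF subspace_killed] unfolding Q_def by blast
  have QE: "Q \<subseteq> E t" unfolding Q_def by (rule killed_subset)
  have kill: "T t (upd t k c) w = 0"
    if "v \<in> Q" "v \<noteq> 0" "t$k \<le> c" "T t (upd t k c) v = 0" "w \<in> Q" for k c v w
  proof -
    have m: "dim (killed t A y) \<le> dim (killed t A' y')"
      if "\<exists>i\<in>A'. \<exists>j\<in>A'. i \<noteq> j" "\<forall>l\<in>A'. t$l \<le> y' l" "killed t A' y' \<noteq> {0}" for A' y'
      using min[of t A' y'] that by (simp add: P_def)
    show ?thesis
      by (rule killed_insert_constant[OF A y m that(1)[unfolded Q_def] that(2-4) that(5)[unfolded Q_def]])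
  qed
  \<comment> \<open>The levels in direction \<open>k\<close> at which no nonzero vector of
    \<open>Q\<close> has died; at all other levels the whole of \<open>Q\<close> is dead by
    \<open>kill\<close>. The maximum puts everything below \<open>t\<close> into
    \<open>D k\<close>.\<close>
  define D where "D k = {c. \<forall>v\<in>Q. T t (upd t k (max c (t$k))) v = 0 \<longrightarrow> v = 0}" for k
  have mono0: "T s (upd s k c') v = 0" if "s$k \<le> c" "c \<le> c'" "v \<in> E s" "T s (upd s k c) v = 0" for s k c c' v
    using T_comp[OF le_upd[OF that(1)] upd_le_upd[OF order_refl that(2)] that(3)] that(4) by (simp add: T_0)
  have down: "c' \<in> D k" if "c \<in> D k" "c' \<le> c" for k c c'
  proof -
    have "v = 0" if v: "v \<in> Q" "T t (upd t k (max c' (t$k))) v = 0" for v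
    proof -
      have "T t (upd t k (max c (t$k))) v = 0"
        using mono0[of t k "max c' (t$k)" "max c (t$k)" v] v QE \<open>c' \<le> c\<close> by auto
      then show ?thesis using \<open>c \<in> D k\<close> v(1) by (simp add: D_def)
    qed
    then show ?thesis by (simp add: D_def)
  qed
  have tD: "t$k \<in> D k" for k using QE T_id by (auto simp: D_def)
  have notD: "t$k < c" "\<And>w. w \<in> Q \<Longrightarrow> T t (upd t k c) w = 0" if c: "c \<notin> D k" for k c
  proof -
    show lt: "t$k < c" using down[OF tD] c by (meson linorder_not_less)
    obtain v where "v \<in> Q" "T t (upd t k c) v = 0" "v \<noteq> 0" using c lt by (auto simp: D_def max_def)
    then show "T t (upd t k c) w = 0" if "w \<in> Q" for w using kill lt that by simp
  qed
  have yD: "y l \<notin> D l" if "l \<in> A" for l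
    using g y[OF that] that by (auto simp: D_def Q_def killed_def max_def)
  have tB: "t \<in> pbox D" using tD by (simp add: pbox_def)
  have "\<exists>h N. is_summand (pbox D) h N"
  proof (rule exists_summand[OF tB, of g])
    fix s assume s: "s \<in> pbox D" "s \<le> t"
    have sl: "s$k \<le> c" if "c \<notin> D k" for k c
      using s(2) notD(1)[OF that] by (simp add: cvec_le_iff) (meson dual_order.trans less_imp_le)
    \<comment> \<open>The lift has to die at every level outside \<open>D k\<close>, and there may
      be infinitely many of them without a least one. The kernels at \<open>s\<close> shrink towards
      the edge, and one of smallest dimension is contained in all others, so a single level
      \<open>c k\<close> suffices.\<close>
    have "\<exists>c. D k \<noteq> UNIV \<longrightarrow> c \<notin> D k \<and>
        (\<forall>c'. c' \<notin> D k \<longrightarrow> killed s {k} (\<lambda>_. c) \<subseteq> killed s {k} (\<lambda>_. c'))" for k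
    proof (cases "D k = UNIV")
      case False
      then obtain c0 where "c0 \<notin> D k" by blast
      then obtain c where c: "c \<notin> D k"
        and cmin: "\<And>c'. c' \<notin> D k \<Longrightarrow> dim (killed s {k} (\<lambda>_. c)) \<le> dim (killed s {k} (\<lambda>_. c'))"
        using ex_has_least_nat[of "\<lambda>c. c \<notin> D k" c0 "\<lambda>c. dim (killed s {k} (\<lambda>_. c))"] by blast
      have kmono: "killed s {k} (\<lambda>_. a) \<subseteq> killed s {k} (\<lambda>_. b)" if "a \<notin> D k" "a \<le> b" for a b
        using mono0[OF sl[OF that(1)] that(2)] by (auto simp: killed_def)
      have "killed s {k} (\<lambda>_. c) \<subseteq> killed s {k} (\<lambda>_. c')" if c': "c' \<notin> D k" for c'
      proof (cases "c \<le> c'")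
        case True then show ?thesis using kmono[OF c] by simp
      next
        case False
        then have "killed s {k} (\<lambda>_. c') \<subseteq> killed s {k} (\<lambda>_. c)" using kmono[OF c'] by simp
        then show ?thesis
          using dim_eqI[OF subspace_killed _ killed_subset cmin[OF c']] by blast
      qed
      then show ?thesis using c by blast
    qed simp
    then obtain c where c: "\<And>k. D k \<noteq> UNIV \<Longrightarrow> c k \<notin> D k"
      "\<And>k c'. c' \<notin> D k \<Longrightarrow> killed s {k} (\<lambda>_. c k) \<subseteq> killed s {k} (\<lambda>_. c')"
      by (metis UNIV_I)
    \<comment> \<open>All bounded directions are prescribed at once; they include \<open>A\<close>,
      so there are at least two of them and \<open>killed_lift\<close> applies.\<close>
    have "g \<in> killed t {k. D k \<noteq> UNIV} c"
      using g(1) QE notD(2)[OF c(1)] by (auto simp: killed_def)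
    moreover have "A \<subseteq> {k. D k \<noteq> UNIV}" using yD by blast
    moreover have "t$l \<le> c l" if "l \<in> {k. D k \<noteq> UNIV}" for l
      using notD(1)[OF c(1)] that by (simp add: less_imp_le)
    ultimately obtain w where w: "w \<in> killed s {k. D k \<noteq> UNIV} c" "T s t w = g"
      using killed_lift[OF s(2), of i "{k. D k \<noteq> UNIV}" j c g] A by blast
    have "T s u w = 0" if u: "s \<le> u" "u \<notin> pbox D" for u
    proof -
      from u(2) obtain k where k: "u$k \<notin> D k" by (auto simp: pbox_def)
      then have "w \<in> killed s {k} (\<lambda>_. c k)" using w(1) by (auto simp: killed_def)
      then have "T s (upd s k (u$k)) w = 0" using c(2)[OF k] by (auto simp: killed_def)
      moreover have "T s u w = T (upd s k (u$k)) u (T s (upd s k (u$k)) w)"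
        using u(1) sl[OF k] subsetD[OF killed_subset w(1)]
        by (intro T_comp[symmetric]) (auto simp: cvec_le_iff)
      ultimately show ?thesis by (simp add: T_0)
    qed
    then show "\<exists>w\<in>E s. T s t w = g \<and> (\<forall>u. s \<le> u \<longrightarrow> u \<notin> pbox D \<longrightarrow> T s u w = 0)"
      using w killed_subset by blast
  next
    fix u assume u: "u \<in> pbox D" "t \<le> u"
    \<comment> \<open>The box is closed downwards, so \<open>outer\<close> vanishes, and it remains
      to see that \<open>g\<close> survives in the box.\<close>
    have "s \<in> pbox D" if "s \<le> u" for s
      using u(1) that down unfolding pbox_def cvec_le_iff by blast
    then have "(\<Union>s\<in>{s. s \<notin> pbox D \<and> s \<le> u}. T s u ` E s) = {}" by blast
    then have out0: "outer (pbox D) u = {0}" by (simp add: outer_def)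
    \<comment> \<open>A vector of \<open>Q\<close> cannot die by raising coordinate \<open>k\<close>
      inside \<open>D k\<close>: its image at \<open>r\<close> lifts back to a vector
      \<open>v1\<close> of \<open>Q\<close> that already dies at \<open>t\<close> in direction
      \<open>k\<close>, hence is 0.\<close>
    have inj: "T t r v = 0" if r: "r \<in> pbox D" "t \<le> r" "r$k = t$k" and cD: "c \<in> D k" "t$k \<le> c"
      and v: "v \<in> Q" "T t (upd r k c) v = 0" for r k c v
    proof -
      define y' where "y' = y(k := c)"
      have vE: "v \<in> E t" using v QE by blast
      have rc: "r \<le> upd r k c" using r cD by (intro le_upd) simp
      have ry: "r$l \<le> y' l" if "l \<in> insert k A" for l
      proof (cases "l = k")
        case False
        then have "y l \<notin> D l" using yD that by blast
        moreover have "r$l \<in> D l" using r by (simp add: pbox_def)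
        ultimately show ?thesis using down False unfolding y'_def by (metis fun_upd_other nle_le)
      qed (use r cD in \<open>simp add: y'_def\<close>)
      have cy: "c \<le> y k" if "k \<in> A" using yD[OF that] cD down by (meson nle_le)
      have "T t r v \<in> killed r (insert k A) y'"
      proof -
        have "T r (upd r l (y' l)) (T t r v) = 0" if l: "l \<in> insert k A" for l
        proof (cases "l = k")
          case True
          then show ?thesis using T_comp[OF r(2) rc vE] v(2) by (simp add: y'_def)
        next
          case False
          have tl: "t$l \<le> y l" using y l False by simp
          have le: "upd t l (y l) \<le> upd r l (y l)" using r(2) by (simp add: upd_le_upd)
          have "T r (upd r l (y l)) (T t r v) = T t (upd r l (y l)) v"
            using T_comp[OF r(2) le_upd vE, of l "y l"] ry[OF l] False by (simp add: y'_def)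
          also have "\<dots> = T (upd t l (y l)) (upd r l (y l)) (T t (upd t l (y l)) v)"
            using T_comp[OF le_upd[OF tl] le vE] by simp
          also have "\<dots> = 0" using v(1) l False by (auto simp: Q_def killed_def T_0)
          finally show ?thesis using False by (simp add: y'_def)
        qed
        then show ?thesis using T_in[OF r(2) vE] by (simp add: killed_def)
      qed
      then obtain v1 where v1: "v1 \<in> killed t (insert k A) y'" "T t r v1 = T t r v"
        using killed_lift[OF r(2), of i "insert k A" j y' "T t r v"] A ry by blast
      have v1k: "T t (upd t k c) v1 = 0" using v1(1) by (simp add: killed_def y'_def)
      have v1E: "v1 \<in> E t" using v1(1) killed_subset by blast
      have "T t (upd t l (y l)) v1 = 0" if l: "l \<in> A" for l
      proof (cases "l = k")
        case True
        then show ?thesis using mono0[OF cD(2) cy v1E v1k] l by simp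
      next
        case False
        then show ?thesis using v1(1) l by (auto simp: killed_def y'_def)
      qed
      then have "v1 \<in> Q" using v1E by (simp add: Q_def killed_def)
      then have "v1 = 0" using v1k cD by (simp add: D_def max_def)
      then show ?thesis using v1(2) by (simp add: T_0)
    qed
    show "T t u g \<notin> outer (pbox D) u"
    proof
      assume "T t u g \<in> outer (pbox D) u"
      then have 0: "T t u g = 0" using out0 by simp
      have uD: "u$k \<in> D k" "t$k \<le> u$k" for k using u by (auto simp: pbox_def cvec_le_iff)
      \<comment> \<open>The coordinates of \<open>u\<close> are lowered to those of \<open>t\<close>
        one at a time, with \<open>inj\<close> applied to each.\<close>
      define r1 where "r1 = upd u 1 (t$1)"
      define r2 where "r2 = upd r1 2 (t$2)"
      have r: "r1 \<in> pbox D" "t \<le> r1" "r2 \<in> pbox D" "t \<le> r2" "r1$1 = t$1" "r2$2 = t$2"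
        using uD tD by (auto simp: r1_def r2_def pbox_def cvec_le_iff)
      have e: "upd r1 1 (u$1) = u" "upd r2 2 (u$2) = r1" "upd t 3 (u$3) = r2"
        by (auto simp: r1_def r2_def cvec_eq_iff forall_3)
      have "T t r1 g = 0" using inj[OF r(1,2,5) uD[of 1] g(1)] 0 e by simp
      then have "T t r2 g = 0" using inj[OF r(3,4,6) uD[of 2] g(1)] e by simp
      then have "T t t g = 0" using inj[OF tB order_refl refl uD[of 3] g(1)] e by simp
      then show False using T_id g QE by auto
    qed
  qed
  moreover have "pbox D \<in> blocks" by (rule pbox_death[OF _ tB]) (rule down)
  ultimately show ?thesis by blast
qed

section \<open>Splitting off a layer block\<close>

definition images :: "3 \<Rightarrow> real set \<Rightarrow> real^3 \<Rightarrow> 'a set" where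
  "images i X u = insert 0 {T (upd u i c) u m | c m. c \<in> X \<and> c \<le> u$i \<and> m \<in> E (upd u i c)}"

lemma imagesI: "c \<in> X \<Longrightarrow> c \<le> u$i \<Longrightarrow> m \<in> E (upd u i c) \<Longrightarrow> T (upd u i c) u m \<in> images i X u"
  by (auto simp: images_def)

lemma imagesE:
  assumes "v \<in> images i X u" "v = 0 \<Longrightarrow> P"
    "\<And>c m. c \<in> X \<Longrightarrow> c \<le> u$i \<Longrightarrow> m \<in> E (upd u i c) \<Longrightarrow> v = T (upd u i c) u m \<Longrightarrow> P"
  shows P
  using assms by (auto simp: images_def)

lemma T_upd_upd:
  assumes "c \<le> c'" "c' \<le> u$i" "m \<in> E (upd u i c)"
  shows "T (upd u i c') u (T (upd u i c) (upd u i c') m) = T (upd u i c) u m"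
  using assms by (intro T_comp) (auto simp: upd_le_upd upd_le)

lemma T_upd_in: "c \<le> c' \<Longrightarrow> m \<in> E (upd u i c) \<Longrightarrow> T (upd u i c) (upd u i c') m \<in> E (upd u i c')"
  by (intro T_in) (auto simp: upd_le_upd)

lemma images_subset: "images i X u \<subseteq> E u"
  using subspace_0[OF sub_E] by (auto simp: images_def intro!: T_in upd_le)

text \<open>Images from different levels are nested, so the union is closed under sums; the inserted
  0 covers the case of no level below \<open>u$i\<close>.\<close>

lemma subspace_images: "subspace (images i X u)"
proof (rule subspaceI)
  show "0 \<in> images i X u" by (simp add: images_def)
  show "x + y \<in> images i X u" if "x \<in> images i X u" "y \<in> images i X u" for x y
    using that(1)
  proof (rule imagesE)
    fix c m assume c: "c \<in> X" "c \<le> u$i" "m \<in> E (upd u i c)" "x = T (upd u i c) u m"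
    show ?thesis using that(2)
    proof (rule imagesE)
      fix c' m' assume c': "c' \<in> X" "c' \<le> u$i" "m' \<in> E (upd u i c')" "y = T (upd u i c') u m'"
      show ?thesis
      proof (cases "c \<le> c'")
        case True
        have "x + y = T (upd u i c') u (T (upd u i c) (upd u i c') m + m')"
          using T_upd_upd[OF True c'(2) c(3)] c(4) c'(4) by (simp add: T_add)
        then show ?thesis
          using imagesI[OF c'(1,2) subspace_add[OF sub_E T_upd_in[OF True c(3)] c'(3)]] by simp
      next
        case False
        then have F: "c' \<le> c" by simp
        have "x + y = T (upd u i c) u (m + T (upd u i c') (upd u i c) m')"
          using T_upd_upd[OF F c(2) c'(3)] c(4) c'(4) by (simp add: T_add)
        then show ?thesis
          using imagesI[OF c(1,2) subspace_add[OF sub_E c(3) T_upd_in[OF F c'(3)]]] by simp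
      qed
    qed (use that in simp)
  qed (use that in simp)
  show "a *s x \<in> images i X u" if "x \<in> images i X u" for a x
    using that
  proof (rule imagesE)
    fix c m assume c: "c \<in> X" "c \<le> u$i" "m \<in> E (upd u i c)" "x = T (upd u i c) u m"
    then show ?thesis using imagesI[OF c(1,2) subspace_scale[OF sub_E c(3), of a]] by (simp add: T_scale)
  qed (simp add: images_def)
qed

text \<open>By \<open>inj2\<close> the kernels in direction \<open>i\<close> embed along the other
  two directions, and squares make these maps onto. For the kernels only the coordinate
  \<open>i\<close> matters, so the problem becomes one-dimensional.\<close>

lemma layer_summand:
  assumes inj2: "\<And>j k t a b v. j \<noteq> k \<Longrightarrow> v \<in> E t \<Longrightarrow> t$j \<le> a \<Longrightarrow> t$k \<le> b \<Longrightarrow>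
      T t (upd t j a) v = 0 \<Longrightarrow> T t (upd t k b) v = 0 \<Longrightarrow> v = 0"
    and ex: "v0 \<in> E t0" "v0 \<noteq> 0" "t0$i \<le> a0" "T t0 (upd t0 i a0) v0 = 0"
  shows "\<exists>B\<in>blocks. \<exists>h N. is_summand B h N"
proof -
  obtain l m where lm: "l \<noteq> i" "m \<noteq> i" "l \<noteq> m" "\<And>k::3. k = i \<or> k = l \<or> k = m"
    using other_coordinates by blast
  define R where "R t a = killed t {i} (\<lambda>_. a)" for t a
  have R: "v \<in> R t a \<longleftrightarrow> v \<in> E t \<and> T t (upd t i a) v = 0" for v t a
    by (auto simp: R_def killed_def)
  have subR: "subspace (R t a)" for t a unfolding R_def by (rule subspace_killed)
  have mono0: "T s (upd s i c') v = 0" if "s$i \<le> c" "c \<le> c'" "v \<in> E s" "T s (upd s i c) v = 0" for s c c' v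
    using T_comp[OF le_upd[OF that(1)] upd_le_upd[OF order_refl that(2)] that(3)] that(4) by (simp add: T_0)
  have RT: "T s r v \<in> R r a" if "s \<le> r" "r$i \<le> a" "v \<in> R s a" for s r a v
  proof -
    have vE: "v \<in> E s" and v0: "T s (upd s i a) v = 0" using that(3) by (auto simp: R)
    have sa: "s$i \<le> a" using that(1,2) by (auto simp: cvec_le_iff intro: order_trans)
    have "T r (upd r i a) (T s r v) = T s (upd r i a) v"
      using T_comp[OF that(1) le_upd[OF that(2)] vE] .
    also have "\<dots> = T (upd s i a) (upd r i a) (T s (upd s i a) v)"
      using T_comp[OF le_upd[OF sa] upd_le_upd[OF that(1) order_refl] vE] by simp
    finally show ?thesis using T_in[OF that(1) vE] v0 by (simp add: R T_0)
  qed
  have onto1: "\<exists>v\<in>R s a. T s (upd s k c) v = w" if "k \<noteq> i" "s$k \<le> c" "s$i \<le> a" "w \<in> R (upd s k c) a" for s k c a w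
    using killed_lift_one[of s k c i "{i}" "\<lambda>_. a" w] that unfolding R_def by auto
  have inj1: "v = 0" if "k \<noteq> i" "s$k \<le> c" "s$i \<le> a" "v \<in> R s a" "T s (upd s k c) v = 0" for s k c a v
    using inj2[of i k v s a c] that by (auto simp: R)
  have two: "s \<le> upd s l (s'$l)" "upd s l (s'$l) \<le> s'" "upd (upd s l (s'$l)) m (s'$m) = s'"
      "upd s l (s'$l) $ i = s$i" "s$l \<le> s'$l" "upd s l (s'$l) $ m \<le> s'$m"
    if "s \<le> s'" "s$i = s'$i" for s s'
  proof -
    have le: "s$k \<le> s'$k" for k using that(1) by (simp add: cvec_le_iff)
    show "s \<le> upd s l (s'$l)" using le by (simp add: le_upd)
    show "upd s l (s'$l) \<le> s'" using le by (simp add: cvec_le_iff)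
    have "upd (upd s l (s'$l)) m (s'$m) $ k = s'$k" for k
      using lm(4)[of k] that(2) lm(1-3) by auto
    then show "upd (upd s l (s'$l)) m (s'$m) = s'" by (simp add: cvec_eq_iff)
    show "upd s l (s'$l) $ i = s$i" using lm by auto
    show "s$l \<le> s'$l" by (rule le)
    show "upd s l (s'$l) $ m \<le> s'$m" using lm le by auto
  qed
  have onto: "\<exists>v\<in>R s a. T s s' v = w" if s: "s \<le> s'" "s$i = s'$i" and sa: "s$i \<le> a" "w \<in> R s' a" for s s' a w
  proof -
    note t = two[OF s]
    obtain v1 where v1: "v1 \<in> R (upd s l (s'$l)) a" "T (upd s l (s'$l)) s' v1 = w"
      using onto1[OF lm(2) t(6), of a w] t(3,4) sa by auto
    obtain v where v: "v \<in> R s a" "T s (upd s l (s'$l)) v = v1"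
      using onto1[OF lm(1) t(5), of a v1] v1 sa by auto
    have "T s s' v = w" using T_comp[OF t(1,2), of v] v v1 by (simp add: R)
    then show ?thesis using v by blast
  qed
  have inj: "v = 0" if s: "s \<le> s'" "s$i = s'$i" and "s$i \<le> a" "v \<in> R s a" "T s s' v = 0" for s s' a v
  proof -
    note t = two[OF s]
    have "T s (upd s l (s'$l)) v \<in> R (upd s l (s'$l)) a"
      using RT[OF t(1) _ that(4)] t(4) that(3) by simp
    moreover have "T (upd s l (s'$l)) s' (T s (upd s l (s'$l)) v) = 0"
      using T_comp[OF t(1,2)] that(4,5) by (simp add: R)
    ultimately have "T s (upd s l (s'$l)) v = 0"
      using inj1[OF lm(2) t(6), of a] t(3,4) that(3) by simp
    then show ?thesis using inj1[OF lm(1) t(5) that(3,4)] by simp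
  qed
  \<comment> \<open>Vectors that die at level \<open>a\<close> and come from level \<open>c\<close>,
    both in direction \<open>i\<close>. Bounding from both sides lets one minimal subspace determine
    both ends of the layer.\<close>
  define P where "P t c a = R t a \<inter> images i {c} t" for t c a
  have subP: "subspace (P t c a)" for t c a
    unfolding P_def using subR subspace_images by (rule subspace_inter)
  have PE: "P t c a \<subseteq> E t" for t c a by (auto simp: P_def R)
  have Pmono: "P t c a \<subseteq> P t c' a" if "c \<le> c'" "c' \<le> t$i" for t c c' a
  proof
    fix v assume v: "v \<in> P t c a"
    then have "v \<in> images i {c} t" by (simp add: P_def)
    then have "v \<in> images i {c'} t"
    proof (rule imagesE)
      fix d x assume d: "d \<in> {c}" "x \<in> E (upd t i d)" "v = T (upd t i d) t x"
      then have x: "x \<in> E (upd t i c)" "v = T (upd t i c) t x" by simp_all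
      have "T (upd t i c') t (T (upd t i c) (upd t i c') x) \<in> images i {c'} t"
        by (rule imagesI[OF singletonI that(2) T_upd_in[OF that(1) x(1)]])
      then show ?thesis using T_upd_upd[OF that x(1)] x(2) by simp
    qed (simp add: images_def)
    then show "v \<in> P t c' a" using v by (simp add: P_def)
  qed
  define good where "good = (\<lambda>(t, c, a). c \<le> t$i \<and> t$i \<le> a \<and> P t c a \<noteq> {0})"
  have "v0 \<in> P t0 (t0$i) a0"
    using ex imagesI[of "t0$i" "{t0$i}" t0 i v0] T_id by (simp add: P_def R)
  then have "good (t0, t0$i, a0)" using ex unfolding good_def by auto
  then have "\<exists>z. good z \<and> (\<forall>z'. good z' \<longrightarrow> (\<lambda>(t, c, a). dim (P t c a)) z \<le> (\<lambda>(t, c, a). dim (P t c a)) z')"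
    by (rule ex_has_least_nat)
  then obtain t c0 a where gd: "good (t, c0, a)"
    and min: "\<And>t' c' a'. good (t', c', a') \<Longrightarrow> dim (P t c0 a) \<le> dim (P t' c' a')"
    by (auto simp: split_paired_all)
  have c0: "c0 \<le> t$i" and ta: "t$i \<le> a" and ne: "P t c0 a \<noteq> {0}" using gd by (auto simp: good_def)
  define Q where "Q = P t c0 a"
  obtain g where g: "g \<in> Q" "g \<noteq> 0" using ne subspace_0[OF subP] unfolding Q_def by blast
  have QE: "Q \<subseteq> E t" unfolding Q_def by (rule PE)
  have Qa: "T t (upd t i a) v = 0" if "v \<in> Q" for v using that by (simp add: Q_def P_def R)
  have gR: "g \<in> R t a" using g by (simp add: Q_def P_def)
  \<comment> \<open>Below \<open>t$i\<close>: the levels from which some nonzero vector killed at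
    \<open>a\<close> still comes. Above: the levels at which no nonzero vector of \<open>Q\<close>
    has died. Minimality turns both into statements on all of \<open>Q\<close>, in \<open>QP\<close>
    and \<open>notup\<close>.\<close>
  define J where "J = {c. c \<le> t$i \<and> P t c a \<noteq> {0}} \<union> {c. t$i \<le> c \<and> (\<forall>v\<in>Q. T t (upd t i c) v = 0 \<longrightarrow> v = 0)}"
  have lowJ: "c \<in> J \<longleftrightarrow> P t c a \<noteq> {0}" if "c \<le> t$i" for c
  proof -
    have "P t (t$i) a \<noteq> {0}" using Pmono[OF c0 order_refl] g unfolding Q_def by blast
    then show ?thesis using that unfolding J_def by auto
  qed
  have upJ: "c \<in> J \<longleftrightarrow> (\<forall>v\<in>Q. T t (upd t i c) v = 0 \<longrightarrow> v = 0)" if "t$i \<le> c" for c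
    using that T_id QE unfolding J_def by auto
  have tJ: "t$i \<in> J" using upJ[of "t$i"] T_id QE by auto
  have cJ: "x \<in> J" if "b \<in> J" "d \<in> J" "b \<le> x" "x \<le> d" for b d x
  proof (cases "x \<le> t$i")
    case True
    then show ?thesis using lowJ[of b] lowJ[of x] that Pmono[of b x t a] subspace_0[OF subP[of t b a]] by auto
  next
    case False
    have "v = 0" if v: "v \<in> Q" "T t (upd t i x) v = 0" for v
      using mono0[of t x d v] v QE upJ[of d] False \<open>d \<in> J\<close> \<open>x \<le> d\<close> by auto
    then show ?thesis using upJ[of x] False by auto
  qed
  have QP: "Q \<subseteq> P t c a" if "c \<in> J" "c \<le> t$i" for c
  proof (cases "c0 \<le> c")
    case True
    then show ?thesis using Pmono that unfolding Q_def by simp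
  next
    case False
    then have sub: "P t c a \<subseteq> Q" using Pmono[of c c0] c0 unfolding Q_def by simp
    have "dim Q \<le> dim (P t c a)" using min[of t c a] lowJ that ta by (auto simp: good_def Q_def)
    then show ?thesis using dim_eqI[OF subP sub QE] by simp
  qed
  have notup: "T t (upd t i c) w = 0" if c: "c \<notin> J" "t$i \<le> c" and w: "w \<in> Q" for c w
  proof (cases "a \<le> c")
    case True
    then show ?thesis using mono0[OF ta True] Qa w QE by blast
  next
    case False
    obtain v where v: "v \<in> Q" "T t (upd t i c) v = 0" "v \<noteq> 0" using upJ c by blast
    have sub: "P t c0 c \<subseteq> Q" using mono0[OF c(2), of a] False by (auto simp: P_def Q_def R)
    have "v \<in> P t c0 c" using v by (auto simp: P_def Q_def R)
    then have "dim Q \<le> dim (P t c0 c)" using min[of t c0 c] v c c0 by (auto simp: good_def Q_def)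
    then have "P t c0 c = Q" using dim_eqI[OF subP sub QE] by simp
    then show ?thesis using w by (auto simp: P_def R)
  qed
  have Ja: "c < a" if "c \<in> J" for c
  proof (rule ccontr)
    assume "\<not> c < a"
    then have "a \<le> c" by simp
    then have "T t (upd t i c) g = 0" using mono0[OF ta] Qa[OF g(1)] g QE by blast
    then show False using upJ[of c] that g \<open>a \<le> c\<close> ta by auto
  qed
  define JJ where "JJ = (\<lambda>l. if l = i then J else UNIV)"
  have box: "u \<in> pbox JJ \<longleftrightarrow> u$i \<in> J" for u by (auto simp: pbox_def JJ_def)
  have "\<exists>h N. is_summand (pbox JJ) h N"
  proof (rule exists_summand[of t JJ g])
    show "t \<in> pbox JJ" using tJ by (simp add: box)
  next
    fix s assume "s \<in> pbox JJ" and st: "s \<le> t"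
    then have sJ: "s$i \<in> J" by (simp add: box)
    have sti: "s$i \<le> t$i" using st by (simp add: cvec_le_iff)
    have "g \<in> images i {s$i} t" using QP[OF sJ sti] g by (auto simp: P_def)
    then obtain x where x: "x \<in> E (upd t i (s$i))" "g = T (upd t i (s$i)) t x"
      using g(2) by (elim imagesE) auto
    have "T (upd t i (s$i)) (upd t i a) x = T t (upd t i a) g"
      unfolding x(2) using T_comp[OF upd_le[OF sti] le_upd[OF ta] x(1)] by simp
    then have xR: "x \<in> R (upd t i (s$i)) a" using x(1) Qa[OF g(1)] by (simp add: R)
    have le1: "s \<le> upd t i (s$i)" using st by (simp add: cvec_le_iff)
    obtain w where w: "w \<in> R s a" "T s (upd t i (s$i)) w = x"
      using onto[OF le1 _ _ xR] sti ta by auto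
    have wE: "w \<in> E s" using w by (simp add: R)
    have wg: "T s t w = g" using T_comp[OF le1 upd_le[OF sti] wE] w x by simp
    have "T s u w = 0" if u: "s \<le> u" "u \<notin> pbox JJ" for u
    proof -
      have su: "s$i \<le> u$i" using u(1) by (simp add: cvec_le_iff)
      have uJ: "u$i \<notin> J" using u(2) by (simp add: box)
      have tu: "t$i \<le> u$i" using cJ[OF sJ tJ su] uJ by linarith
      \<comment> \<open>Below level \<open>a\<close>, the death of \<open>g\<close> at level
        \<open>u$i\<close> is known only over \<open>t\<close>; it transfers to \<open>s\<close>
        because kernels embed along the other directions.\<close>
      have "T s (upd s i (u$i)) w = 0"
      proof (cases "a \<le> u$i")
        case True
        then show ?thesis using mono0[of s a "u$i" w] w(1) sti ta by (simp add: R)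
      next
        case False
        have le2: "s \<le> upd s i (u$i)" by (rule le_upd[OF su])
        have le3: "upd s i (u$i) \<le> upd t i (u$i)" using st by (simp add: upd_le_upd)
        have "T (upd s i (u$i)) (upd t i (u$i)) (T s (upd s i (u$i)) w) = T s (upd t i (u$i)) w"
          using T_comp[OF le2 le3 wE] .
        also have "\<dots> = T t (upd t i (u$i)) g"
          using T_comp[OF st le_upd[OF tu] wE] wg by simp
        also have "\<dots> = 0" using notup[OF uJ tu g(1)] .
        finally show ?thesis
          using inj[OF le3, of a] RT[OF le2 _ w(1)] False by simp
      qed
      moreover have "T s u w = T (upd s i (u$i)) u (T s (upd s i (u$i)) w)"
        using u(1) wE su by (intro T_comp[symmetric] le_upd) (auto simp: cvec_le_iff)
      ultimately show ?thesis by (simp add: T_0)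
    qed
    then show "\<exists>w\<in>E s. T s t w = g \<and> (\<forall>u. s \<le> u \<longrightarrow> u \<notin> pbox JJ \<longrightarrow> T s u w = 0)"
      using wE wg by blast
  next
    fix u assume "u \<in> pbox JJ" and tu: "t \<le> u"
    then have uJ: "u$i \<in> J" by (simp add: box)
    have tui: "t$i \<le> u$i" using tu by (simp add: cvec_le_iff)
    have gE: "g \<in> E t" using g QE by blast
    have nz: "T t u g \<noteq> 0"
    proof
      assume 0: "T t u g = 0"
      have le1: "upd t i (u$i) \<le> u" using tu by (simp add: cvec_le_iff)
      have "T (upd t i (u$i)) u (T t (upd t i (u$i)) g) = 0"
        using T_comp[OF le_upd[OF tui] le1 gE] 0 by simp
      then have "T t (upd t i (u$i)) g = 0"
        using inj[OF le1, of a] RT[OF le_upd[OF tui] _ gR] Ja[OF uJ] by simp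
      then show False using upJ[OF tui] uJ g by blast
    qed
    \<comment> \<open>A point outside the box and below \<open>u\<close> has its coordinate
      \<open>i\<close> below \<open>J\<close>, as \<open>J\<close> is convex; so only lower levels
      contribute.\<close>
    have gen: "T s u e \<in> images i {c. c \<notin> J \<and> c < t$i} u" if s: "s \<notin> pbox JJ" "s \<le> u" "e \<in> E s" for s e
    proof -
      have sJ: "s$i \<notin> J" using s(1) by (simp add: box)
      have su: "s$i \<le> u$i" using s(2) by (simp add: cvec_le_iff)
      have "s$i < t$i" using cJ[OF tJ uJ _ su] sJ by linarith
      have le: "s \<le> upd u i (s$i)" using s(2) by (simp add: cvec_le_iff)
      have "T s u e = T (upd u i (s$i)) u (T s (upd u i (s$i)) e)"
        using T_comp[OF le upd_le[OF su] s(3)] by simp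
      then show ?thesis
        using imagesI[of "s$i" _ u i, OF _ su T_in[OF le s(3)]] sJ \<open>s$i < t$i\<close> by simp
    qed
    have "outer (pbox JJ) u \<subseteq> images i {c. c \<notin> J \<and> c < t$i} u"
      unfolding outer_def by (rule span_minimal[OF _ subspace_images]) (use gen in blast)
    \<comment> \<open>If \<open>T t u g\<close> came from a level \<open>c\<close> below
      \<open>J\<close>, its preimage would lie in the kernel of level \<open>a\<close> and could be
      moved to the other coordinates of \<open>t\<close>. There its image falls into
      \<open>P t c a\<close>, which is 0 because \<open>c\<close> is not in
      \<open>J\<close>.\<close>
    moreover have "T t u g \<notin> images i {c. c \<notin> J \<and> c < t$i} u"
    proof
      assume "T t u g \<in> images i {c. c \<notin> J \<and> c < t$i} u"
      then obtain c x where c: "c \<notin> J" "c < t$i" and x: "x \<in> E (upd u i c)" "T t u g = T (upd u i c) u x"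
        using nz by (elim imagesE) auto
      define r where "r = upd u i (t$i)"
      have ru: "r \<le> u" unfolding r_def by (rule upd_le[OF tui])
      have tr: "t \<le> r" using tu by (simp add: r_def cvec_le_iff)
      have cr: "upd u i c \<le> r" using c by (simp add: r_def upd_le_upd)
      have ua: "u$i \<le> a" using Ja[OF uJ] by simp
      define z where "z = T (upd u i c) r x"
      have Tz: "T r u z = T t u g" unfolding z_def x(2) using T_comp[OF cr ru x(1)] .
      have "T (upd u i c) (upd u i a) x = T u (upd u i a) (T t u g)"
        unfolding x(2) using T_comp[OF order_trans[OF cr ru] le_upd[OF ua] x(1)] by simp
      also have "\<dots> = T (upd t i a) (upd u i a) (T t (upd t i a) g)"
        using T_comp[OF tu le_upd[OF ua] gE] T_comp[OF le_upd[OF ta] upd_le_upd[OF tu order_refl] gE] by simp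
      also have "\<dots> = 0" using Qa[OF g(1)] by (simp add: T_0)
      finally have xR: "x \<in> R (upd u i c) a" using x(1) by (simp add: R)
      have le1: "upd t i c \<le> upd u i c" using tu by (simp add: upd_le_upd)
      obtain x0 where x0: "x0 \<in> R (upd t i c) a" "T (upd t i c) (upd u i c) x0 = x"
        using onto[OF le1 _ _ xR] c ta by auto
      have x0E: "x0 \<in> E (upd t i c)" using x0 by (simp add: R)
      have ct: "upd t i c \<le> t" using c by (simp add: upd_le)
      have "T (upd t i c) t x0 \<in> P t c a"
        using RT[OF ct ta x0(1)] imagesI[of c "{c}" t i x0] c x0E by (simp add: P_def)
      then have "T (upd t i c) t x0 = 0" using lowJ[of c] c by auto
      then have "T (upd t i c) r x0 = 0" using T_comp[OF ct tr x0E] by (simp add: T_0)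
      then have "z = 0" unfolding z_def using T_comp[OF le1 cr x0E] x0 by simp
      then show False using Tz nz by (simp add: T_0)
    qed
    ultimately show "T t u g \<notin> outer (pbox JJ) u" by blast
  qed
  moreover have "pbox JJ \<in> blocks" unfolding JJ_def using cJ tJ by (rule pbox_layer)
  ultimately show ?thesis by blast
qed

section \<open>Splitting off a birth block\<close>

lemma dim_T_image:
  assumes "s \<le> t" "\<And>v. v \<in> E s \<Longrightarrow> T s t v = 0 \<Longrightarrow> v = 0"
  shows "dim (E s) \<le> dim (T s t ` E s)"
proof -
  interpret vector_space_pair scale scale ..
  have lin: "Vector_Spaces.linear scale scale (T s t)"
    by (simp add: T_add T_scale Vector_Spaces.linear_iff vector_space_axioms)
  have inj: "inj_on (T s t) (E s)"
  proof (rule inj_onI)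
    fix x y assume "x \<in> E s" "y \<in> E s" "T s t x = T s t y"
    then show "x = y" using assms(2)[of "x - y"] subspace_diff[OF sub_E] by (simp add: T_diff)
  qed
  obtain B where B: "B \<subseteq> E s" "independent B" "E s \<subseteq> span B" "card B = dim (E s)"
    using basis_exists by blast
  have "span B = E s" using span_minimal[OF B(1) sub_E] B(3) by (rule subset_antisym)
  then have "independent (T s t ` B)" using linear_independent_injective_image[OF lin B(2)] inj by simp
  then have "dim (T s t ` B) = card (T s t ` B)" by (rule dim_eq_card_independent)
  moreover have "card (T s t ` B) = card B" using inj_on_subset[OF inj B(1)] by (rule card_image)
  moreover obtain A where A: "finite A" "E t \<subseteq> span A" using fin_E by blast
  have "T s t ` E s \<subseteq> E t" using T_in[OF assms(1)] by blast
  then have "dim (T s t ` B) \<le> dim (T s t ` E s)"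
    using A B(1) by (intro dim_subset_finite[of _ _ A]) auto
  ultimately show ?thesis using B(4) by simp
qed

text \<open>All maps are injective here, so by minimality a nonzero space below \<alpha> is mapped
  isomorphically onto \<open>E \<alpha>\<close>. Along each axis through \<alpha>,
  \<open>U i\<close> records where the space is nonzero, and the block is the product of these
  up-sets.\<close>

lemma birth_summand:
  assumes inj1: "\<And>j t a v. v \<in> E t \<Longrightarrow> t$j \<le> a \<Longrightarrow> T t (upd t j a) v = 0 \<Longrightarrow> v = 0"
    and ex: "v0 \<in> E t0" "v0 \<noteq> 0"
  shows "\<exists>B\<in>blocks. \<exists>h N. is_summand B h N"
proof -
  have inj: "v = 0" if le: "s \<le> t" and v: "v \<in> E s" "T s t v = 0" for s t v
  proof -
    define r1 where "r1 = upd s 1 (t$1)"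
    define r2 where "r2 = upd r1 2 (t$2)"
    have le': "s$l \<le> t$l" for l using le by (simp add: cvec_le_iff)
    have t: "upd r2 3 (t$3) = t" by (simp add: r2_def r1_def cvec_eq_iff forall_3)
    have r: "s \<le> r1" "r1 \<le> r2" "r2 \<le> t" "r1 \<le> t"
      using le' by (simp_all add: r1_def r2_def cvec_le_iff)
    have v1: "T s r1 v \<in> E r1" using T_in r v by blast
    have v2: "T s r2 v \<in> E r2" using T_in r v order_trans by blast
    have "T r2 (upd r2 3 (t$3)) (T s r2 v) = 0"
      using t T_comp[OF order_trans[OF r(1,2)] r(3) v(1)] v(2) by simp
    then have "T s r2 v = 0" using inj1[OF v2, of 3 "t$3"] r(3) by (simp add: cvec_le_iff)
    then have "T r1 (upd r1 2 (t$2)) (T s r1 v) = 0"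
      using T_comp[OF r(1,2) v(1)] by (simp add: r2_def)
    then have "T s r1 v = 0" using inj1[OF v1, of 2 "t$2"] r(4) by (simp add: cvec_le_iff)
    then show ?thesis using inj1[OF v(1), of 1 "t$1"] le' by (simp add: r1_def)
  qed
  have "E t0 \<noteq> {0}" using ex by blast
  then obtain \<alpha> where \<alpha>: "E \<alpha> \<noteq> {0}" and min: "\<And>t. E t \<noteq> {0} \<Longrightarrow> dim (E \<alpha>) \<le> dim (E t)"
    using ex_has_least_nat[of "\<lambda>t. E t \<noteq> {0}" t0 "\<lambda>t. dim (E t)"] by blast
  obtain g where g: "g \<in> E \<alpha>" "g \<noteq> 0" using \<alpha> subspace_0[OF sub_E] by blast
  have surj: "T s \<alpha> ` E s = E \<alpha>" if s: "s \<le> \<alpha>" "E s \<noteq> {0}" for s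
  proof (rule dim_eqI)
    show "subspace (T s \<alpha> ` E s)" using sub_E by (rule subspace_T_image)
    show "T s \<alpha> ` E s \<subseteq> E \<alpha>" using T_in s(1) by blast
    show "dim (E \<alpha>) \<le> dim (T s \<alpha> ` E s)" using dim_T_image[OF s(1)] inj[OF s(1)] min[OF s(2)] by (meson order_trans)
  qed (rule order_refl)
  define U where "U i = {c. E (upd \<alpha> i c) \<noteq> {0}}" for i
  have up: "c' \<in> U i" if c: "c \<in> U i" "c \<le> c'" for i c c'
  proof -
    obtain v where v: "v \<in> E (upd \<alpha> i c)" "v \<noteq> 0"
      using c(1) subspace_0[OF sub_E] unfolding U_def by blast
    then have "T (upd \<alpha> i c) (upd \<alpha> i c') v \<noteq> 0" using inj[OF upd_le_upd[OF order_refl c(2)]] by blast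
    then show ?thesis using T_upd_in[OF c(2) v(1)] by (auto simp: U_def)
  qed
  have \<alpha>U: "\<alpha>$i \<in> U i" for i using \<alpha> by (simp add: U_def)
  have notU: "c < \<alpha>$i" "E (upd \<alpha> i c) = {0}" if "c \<notin> U i" for i c
    using up[OF \<alpha>U[of i], of c] that by (force simp: U_def)+
  have \<alpha>B: "\<alpha> \<in> pbox U" using \<alpha>U by (simp add: pbox_def)
  define H where "H i u = images i (- U i) u" for i u
  \<comment> \<open>\<open>S u\<close> bounds \<open>outer\<close> from above by images along the
    three axes through \<open>u\<close>, the only ones that squares and cubes speak about.\<close>
  define S where "S u = {\<Sum>l\<in>UNIV. x l | x. \<forall>l. x l \<in> H l u}" for u
  have SI: "(\<Sum>l\<in>UNIV. x l) \<in> S u" if "\<And>l. x l \<in> H l u" for x u using that unfolding S_def by blast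
  have subH: "subspace (H i u)" for i u unfolding H_def by (rule subspace_images)
  have H0: "0 \<in> H i u" for i u using subH by (rule subspace_0)
  have subS: "subspace (S u)" for u
  proof (rule subspaceI)
    show "0 \<in> S u" using SI[of "\<lambda>_. 0" u] H0 by simp
    show "v + w \<in> S u" if vw: "v \<in> S u" "w \<in> S u" for v w
    proof -
      from vw obtain x y where "\<And>l. x l \<in> H l u" "v = (\<Sum>l\<in>UNIV. x l)" "\<And>l. y l \<in> H l u" "w = (\<Sum>l\<in>UNIV. y l)"
        unfolding S_def by auto
      then show ?thesis using SI[of "\<lambda>l. x l + y l" u] subspace_add[OF subH] by (simp add: sum.distrib)
    qed
    show "c *s v \<in> S u" if v: "v \<in> S u" for c v
    proof -
      from v obtain x where "\<And>l. x l \<in> H l u" "v = (\<Sum>l\<in>UNIV. x l)" unfolding S_def by auto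
      then show ?thesis using SI[of "\<lambda>l. c *s x l" u] subspace_scale[OF subH] by (simp add: scale_sum_right)
    qed
  qed
  have HS: "v \<in> S u" if "v \<in> H i u" for v i u
    using SI[of "\<lambda>l. if l = i then v else 0" u] that H0 by simp
  have sum3: "(\<Sum>l\<in>UNIV. x l) = x i + x j + x k"
    if "i \<noteq> j" "i \<noteq> k" "j \<noteq> k" "\<And>l. l = i \<or> l = j \<or> l = k" for x :: "3 \<Rightarrow> 'a" and i j k :: 3
  proof -
    have "(UNIV :: 3 set) = {i, j, k}" using that(4) by auto
    then have "(\<Sum>l\<in>UNIV. x l) = (\<Sum>l\<in>{i, j, k}. x l)" by (simp only:)
    also have "\<dots> = x i + x j + x k" using that(1-3) by (simp add: add.assoc)
    finally show ?thesis .
  qed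
  \<comment> \<open>An image along direction \<open>i\<close> is pulled back along a different
    direction \<open>k\<close> by one square.\<close>
  have one: "w \<in> H i (upd u k (\<alpha>$k))"
    if ik: "i \<noteq> k" and uk: "\<alpha>$k \<le> u$k" and w: "w \<in> E (upd u k (\<alpha>$k))" and xH: "x \<in> H i u" and Tw: "T (upd u k (\<alpha>$k)) u w = x"
    for w i u k x
    using xH unfolding H_def
  proof (rule imagesE)
    assume "x = 0"
    then have "w = 0" using inj[OF upd_le[OF uk] w] Tw by simp
    then show "w \<in> images i (- U i) (upd u k (\<alpha>$k))" by (simp add: images_def)
  next
    fix a p assume a: "a \<in> - U i" "a \<le> u$i" and p: "p \<in> E (upd u i a)" "x = T (upd u i a) u p"
    let ?z = "upd (upd u k (\<alpha>$k)) i a"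
    have e: "upd ?z i (u$i) = upd u k (\<alpha>$k)" "upd ?z k (u$k) = upd u i a"
      "upd (upd ?z i (u$i)) k (u$k) = u" "?z$i \<le> u$i" "?z$k \<le> u$k"
      using ik a uk by (auto simp: cvec_eq_iff)
    obtain r where r: "r \<in> E ?z" "T ?z (upd u k (\<alpha>$k)) r = w"
      using square_lift[of i k ?z "u$i" "u$k" w p] ik w p Tw a(2) uk unfolding e by auto
    have "a \<le> upd u k (\<alpha>$k) $ i" using ik a by simp
    then show "w \<in> images i (- U i) (upd u k (\<alpha>$k))" using imagesI[OF a(1) _ r(1)] r(2) by simp
  qed
  \<comment> \<open>A vector that becomes a sum of images from outside the block was one before moving upwards.\<close>
  have move: "w \<in> S (upd u k (\<alpha>$k))"
    if uk: "\<alpha>$k \<le> u$k" and w: "w \<in> E (upd u k (\<alpha>$k))" and TS: "T (upd u k (\<alpha>$k)) u w \<in> S u" for u k w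
  proof -
    let ?u = "upd u k (\<alpha>$k)"
    obtain i j where ij: "i \<noteq> k" "j \<noteq> k" "i \<noteq> j" "\<And>l. l = k \<or> l = i \<or> l = j"
      using other_coordinates[of k] by blast
    obtain x where x: "\<And>l. x l \<in> H l u" "T ?u u w = (\<Sum>l\<in>UNIV. x l)" using TS unfolding S_def by auto
    have xs: "T ?u u w = x k + x i + x j" using x(2) sum3[of k i j x] ij by auto
    \<comment> \<open>The part along \<open>k\<close> already factors through \<open>?u\<close>,
      since its source level is not in \<open>U k\<close> and so lies below
      \<open>\<alpha>$k\<close>. It is subtracted, and two directions remain.\<close>
    obtain y where y: "y \<in> H k ?u" "T ?u u y = x k"
    proof -
      have "\<exists>y\<in>H k ?u. T ?u u y = x k" using x(1)[of k] unfolding H_def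
      proof (rule imagesE)
        assume "x k = 0"
        then show "\<exists>y\<in>images k (- U k) ?u. T ?u u y = x k"
          by (intro bexI[of _ 0]) (auto simp: T_0 images_def)
      next
        fix c m assume c: "c \<in> - U k" "c \<le> u$k" "m \<in> E (upd u k c)" "x k = T (upd u k c) u m"
        have c\<alpha>: "c \<le> \<alpha>$k" using notU(1)[of c k] c(1) by simp
        have "T (upd ?u k c) ?u m \<in> images k (- U k) ?u" using c c\<alpha> by (intro imagesI) auto
        moreover have "T ?u u (T (upd u k c) ?u m) = x k" using T_upd_upd[OF c\<alpha> uk c(3)] c(4) by simp
        ultimately show "\<exists>y\<in>images k (- U k) ?u. T ?u u y = x k" by auto
      qed
      then show ?thesis using that by blast
    qed
    have yE: "y \<in> E ?u" using y images_subset unfolding H_def by blast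
    define w' where "w' = w - y"
    have w'E: "w' \<in> E ?u" unfolding w'_def using w yE by (rule subspace_diff[OF sub_E])
    have Tw': "T ?u u w' = x i + x j" unfolding w'_def using xs y(2) by (simp add: T_diff)
    have "w' \<in> S ?u"
    proof (cases "x i = 0 \<or> x j = 0")
      case True
      then show ?thesis
      proof
        assume "x i = 0"
        then show ?thesis using one[OF ij(2) uk w'E x(1)] Tw' HS by simp
      next
        assume "x j = 0"
        then show ?thesis using one[OF ij(1) uk w'E x(1)] Tw' HS by simp
      qed
    next
      case False
      obtain a p where a: "a \<in> - U i" "a \<le> u$i" "p \<in> E (upd u i a)" "x i = T (upd u i a) u p"
        using x(1)[of i] False unfolding H_def by (auto elim: imagesE)
      obtain b q where b: "b \<in> - U j" "b \<le> u$j" "q \<in> E (upd u j b)" "x j = T (upd u j b) u q"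
        using x(1)[of j] False unfolding H_def by (auto elim: imagesE)
      \<comment> \<open>Injectivity from the colimit of the cube with top \<open>u\<close> splits
        \<open>w'\<close> itself, not only its image, into parts along \<open>i\<close> and
        \<open>j\<close>.\<close>
      obtain r r' where r: "r \<in> E (upd ?u i a)" "r' \<in> E (upd ?u j b)"
        "w' = T (upd ?u i a) ?u r + T (upd ?u j b) ?u r'"
        using cube_colift[of i j k a u b "\<alpha>$k" w' p q] ij a b uk w'E Tw' by auto
      have "T (upd ?u i a) ?u r \<in> H i ?u" unfolding H_def using a ij r(1) by (intro imagesI) auto
      moreover have "T (upd ?u j b) ?u r' \<in> H j ?u" unfolding H_def using b ij r(2) by (intro imagesI) auto
      ultimately show ?thesis using r(3) HS subspace_add[OF subS] by simp
    qed
    moreover have "w = w' + y" by (simp add: w'_def)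
    ultimately show ?thesis using HS[OF y(1)] subspace_add[OF subS] by simp
  qed
  \<comment> \<open>Over \<alpha> the levels outside \<open>U i\<close> carry the zero
    space.\<close>
  have S\<alpha>: "S \<alpha> = {0}"
  proof -
    have "H i \<alpha> = {0}" for i
      using notU(2) by (auto simp: H_def images_def T_0)
    then show ?thesis by (auto simp: S_def intro!: exI[of _ "\<lambda>_. 0"])
  qed
  have "\<exists>h N. is_summand (pbox U) h N"
  proof (rule exists_summand[OF \<alpha>B, of g])
    fix s assume s: "s \<in> pbox U" "s \<le> \<alpha>"
    have sU: "s$i \<in> U i" "s$i \<le> \<alpha>$i" for i using s by (auto simp: pbox_def cvec_le_iff)
    have G1: "\<exists>w\<in>E (upd \<alpha> i (s$i)). T (upd \<alpha> i (s$i)) \<alpha> w = g" for i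
    proof -
      have "E (upd \<alpha> i (s$i)) \<noteq> {0}" using sU(1)[of i] by (simp add: U_def)
      then have "g \<in> T (upd \<alpha> i (s$i)) \<alpha> ` E (upd \<alpha> i (s$i))"
        using surj[OF upd_le[OF sU(2)]] g(1) by simp
      then show ?thesis by auto
    qed
    have G2: "\<exists>w\<in>E (upd (upd \<alpha> i (s$i)) j (s$j)). T (upd (upd \<alpha> i (s$i)) j (s$j)) \<alpha> w = g"
      if ij: "i \<noteq> j" for i j
    proof -
      obtain p q where p: "p \<in> E (upd \<alpha> j (s$j))" "T (upd \<alpha> j (s$j)) \<alpha> p = g"
        and q: "q \<in> E (upd \<alpha> i (s$i))" "T (upd \<alpha> i (s$i)) \<alpha> q = g" using G1 by metis
      let ?z = "upd (upd \<alpha> i (s$i)) j (s$j)"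
      have e: "upd ?z i (\<alpha>$i) = upd \<alpha> j (s$j)" "upd ?z j (\<alpha>$j) = upd \<alpha> i (s$i)"
        "upd (upd ?z i (\<alpha>$i)) j (\<alpha>$j) = \<alpha>" "?z$i \<le> \<alpha>$i" "?z$j \<le> \<alpha>$j"
        using ij sU by (auto simp: cvec_eq_iff)
      obtain w where w: "w \<in> E ?z" "T ?z (upd \<alpha> i (s$i)) w = q"
        using square_lift[of i j ?z "\<alpha>$i" "\<alpha>$j" p q] ij p q sU unfolding e by auto
      have "T ?z \<alpha> w = g"
        using T_comp[OF upd_le upd_le w(1)] sU w(2) q(2) ij by simp
      then show ?thesis using w(1) by blast
    qed
    \<comment> \<open>The lifts of \<open>g\<close> to \<open>?a\<close> and \<open>?b\<close> are
      compared at \<open>?c\<close>, where they agree since the map to \<alpha> is injective; the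
      square with lowest corner \<open>s\<close> then joins them to a lift at
      \<open>s\<close>.\<close>
    let ?a = "upd (upd \<alpha> 1 (s$1)) 2 (s$2)" and ?b = "upd (upd \<alpha> 1 (s$1)) 3 (s$3)"
    obtain p where p: "p \<in> E ?a" "T ?a \<alpha> p = g" using G2[of 1 2] by auto
    obtain q where q: "q \<in> E ?b" "T ?b \<alpha> q = g" using G2[of 1 3] by auto
    let ?c = "upd \<alpha> 1 (s$1)"
    have le: "?a \<le> ?c" "?b \<le> ?c" "?c \<le> \<alpha>" using sU by (simp_all add: cvec_le_iff)
    have e: "upd s 3 (\<alpha>$3) = ?a" "upd s 2 (\<alpha>$2) = ?b" "upd ?a 2 (\<alpha>$2) = ?c"
      by (auto simp: cvec_eq_iff forall_3)
    have "T ?c \<alpha> (T ?a ?c p - T ?b ?c q) = 0"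
      using T_comp[OF le(1,3) p(1)] T_comp[OF le(2,3) q(1)] p q by (simp add: T_diff)
    then have "T ?a ?c p = T ?b ?c q"
      using inj[OF le(3)] subspace_diff[OF sub_E T_in[OF le(1) p(1)] T_in[OF le(2) q(1)]] by fastforce
    then obtain w where w: "w \<in> E s" "T s ?a w = p"
      using square_lift[of 3 2 s "\<alpha>$3" "\<alpha>$2" p q] p q sU unfolding e by auto
    have sa: "s \<le> ?a" using sU by (simp add: cvec_le_iff)
    have "T s \<alpha> w = g" using T_comp[OF sa order_trans[OF le(1,3)] w(1)] w(2) p(2) by simp
    moreover have "u \<in> pbox U" if "s \<le> u" for u
      using that s(1) up unfolding pbox_def cvec_le_iff by blast
    ultimately show "\<exists>w\<in>E s. T s \<alpha> w = g \<and> (\<forall>u. s \<le> u \<longrightarrow> u \<notin> pbox U \<longrightarrow> T s u w = 0)"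
      using w(1) by blast
  next
    fix u assume u: "u \<in> pbox U" "\<alpha> \<le> u"
    have gen: "T s u e \<in> S u" if s: "s \<notin> pbox U" "s \<le> u" "e \<in> E s" for s e
    proof -
      from s(1) obtain i where i: "s$i \<notin> U i" by (auto simp: pbox_def)
      have su: "s$i \<le> u$i" using s(2) by (simp add: cvec_le_iff)
      have le: "s \<le> upd u i (s$i)" using s(2) by (simp add: cvec_le_iff)
      have "T s u e = T (upd u i (s$i)) u (T s (upd u i (s$i)) e)"
        using T_comp[OF le upd_le[OF su] s(3)] by simp
      then have "T s u e \<in> H i u"
        unfolding H_def using imagesI[of "s$i" "- U i" u i, OF _ su T_in[OF le s(3)]] i by simp
      then show ?thesis by (rule HS)
    qed
    have "outer (pbox U) u \<subseteq> S u"
      unfolding outer_def by (rule span_minimal[OF _ subS]) (use gen in blast)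
    moreover have "T \<alpha> u g \<notin> S u"
    proof
      assume 0: "T \<alpha> u g \<in> S u"
      \<comment> \<open>Descending from \<open>u\<close> to \<alpha> coordinate by coordinate,
        \<open>move\<close> carries membership in \<open>S\<close> down to
        \<open>S \<alpha>\<close>, which is 0.\<close>
      define r1 where "r1 = upd u 1 (\<alpha>$1)"
      define r2 where "r2 = upd r1 2 (\<alpha>$2)"
      have le: "\<alpha>$l \<le> u$l" for l using u(2) by (simp add: cvec_le_iff)
      have r: "\<alpha> \<le> r1" "r1 \<le> u" "\<alpha> \<le> r2" "r2 \<le> r1" using le by (auto simp: r1_def r2_def cvec_le_iff)
      have e: "upd r2 3 (\<alpha>$3) = \<alpha>" by (auto simp: r1_def r2_def cvec_eq_iff forall_3)
      have "T r1 u (T \<alpha> r1 g) \<in> S u" using 0 T_comp[OF r(1,2) g(1)] by simp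
      then have 1: "T \<alpha> r1 g \<in> S r1" using move[of 1 u "T \<alpha> r1 g"] le T_in[OF r(1) g(1)] unfolding r1_def by simp
      have "T r2 r1 (T \<alpha> r2 g) \<in> S r1" using 1 T_comp[OF r(3,4) g(1)] by simp
      then have 2: "T \<alpha> r2 g \<in> S r2"
        using move[of 2 r1 "T \<alpha> r2 g"] r(1) T_in[OF r(3) g(1)] unfolding r2_def by (simp add: cvec_le_iff)
      have "g \<in> S \<alpha>" using move[of 3 r2 g] r(3) 2 g(1) e by (simp add: cvec_le_iff)
      then show False using S\<alpha> g by simp
    qed
    ultimately show "T \<alpha> u g \<notin> outer (pbox U) u" by blast
  qed
  moreover have "pbox U \<in> blocks" by (rule pbox_birth[OF _ \<alpha>B]) (rule up)
  ultimately show ?thesis by blast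
qed

theorem exists_block_summand:
  assumes "E t \<noteq> {0}"
  shows "\<exists>B\<in>blocks. \<exists>h N. is_summand B h N"
proof (cases "\<exists>j k t a b v. j \<noteq> k \<and> v \<in> E t \<and> v \<noteq> 0 \<and> t$j \<le> a \<and> t$k \<le> b \<and>
      T t (upd t j a) v = 0 \<and> T t (upd t k b) v = 0")
  case True
  then obtain j k t a b v where "j \<noteq> k" "v \<in> E t" "v \<noteq> 0" "t$j \<le> a" "t$k \<le> b"
    "T t (upd t j a) v = 0" "T t (upd t k b) v = 0" by blast
  then show ?thesis by (rule death_summand)
next
  case nodeath: False
  show ?thesis
  proof (cases "\<exists>j t a v. v \<in> E t \<and> v \<noteq> 0 \<and> t$j \<le> a \<and> T t (upd t j a) v = 0")
    case True
    then obtain j t a v where v: "v \<in> E t" "v \<noteq> 0" "t$j \<le> a" "T t (upd t j a) v = 0" by blast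
    show ?thesis by (rule layer_summand[OF _ v]) (use nodeath in blast)
  next
    case False
    obtain v where v: "v \<in> E t" "v \<noteq> 0" using assms subspace_0[OF sub_E] by blast
    show ?thesis by (rule birth_summand[OF _ v]) (use False in blast)
  qed
qed

section \<open>Block decompositions\<close>

text \<open>Exactness passes to \<open>N\<close> because solutions can be projected along the submodule \<open>C\<close>.\<close>

lemma exact_pmod_summand:
  assumes N: "\<And>t. subspace (N t)" "\<And>t. N t \<subseteq> E t" "\<And>s t v. s \<le> t \<Longrightarrow> v \<in> N s \<Longrightarrow> T s t v \<in> N t"
    and C: "\<And>t. subspace (C t)" "\<And>s t v. s \<le> t \<Longrightarrow> v \<in> C s \<Longrightarrow> T s t v \<in> C t"
    and disj: "\<And>t v. v \<in> C t \<Longrightarrow> v \<in> N t \<Longrightarrow> v = 0"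
    and cover: "\<And>t v. v \<in> E t \<Longrightarrow> \<exists>c\<in>C t. v - c \<in> N t"
  shows "exact_pmod scale N T"
proof -
  have proj: "\<exists>n\<in>N s. \<forall>t. s \<le> t \<longrightarrow> T s t w - T s t n \<in> C t" if "w \<in> E s" for s w
  proof -
    obtain c where c: "c \<in> C s" "w - c \<in> N s" using cover \<open>w \<in> E s\<close> by blast
    have "T s t w - T s t (w - c) \<in> C t" if "s \<le> t" for t
      using C(2)[OF that c(1)] by (simp add: T_diff)
    then show ?thesis using c(2) by blast
  qed
  \<comment> \<open>An equation for \<open>w\<close> with right side in \<open>N\<close> persists
    for its projection \<open>n\<close>: the error lies both in \<open>C\<close> and in
    \<open>N\<close>.\<close>
  have eq: "T s t n = u" if "n \<in> N s" "s \<le> t" "T s t w - T s t n \<in> C t" "T s t w = u" "u \<in> N t" for s t n w u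
    using disj[OF that(3)] subspace_diff[OF N(1) that(5) N(3)[OF that(2,1)]] that(4) by simp
  show ?thesis
  proof unfold_locales
    show "subspace (N t)" for t by (rule N(1))
    show "T s t (x + y) = T s t x + T s t y" for s t x y by (rule T_add)
    show "T s t (c *s x) = c *s T s t x" for s t c x by (rule T_scale)
    show "s \<le> t \<Longrightarrow> v \<in> N s \<Longrightarrow> T s t v \<in> N t" for s t v by (rule N(3))
    show "v \<in> N t \<Longrightarrow> T t t v = v" for t v using N(2) T_id by blast
    show "r \<le> s \<Longrightarrow> s \<le> t \<Longrightarrow> v \<in> N r \<Longrightarrow> T s t (T r s v) = T r t v" for r s t v
      using N(2) T_comp by blast
    show "\<exists>A. finite A \<and> N t \<subseteq> span A" for t using fin_E[of t] N(2)[of t] by (meson order_trans)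
  next
    fix i j :: 3 and x a b p q
    assume h: "i \<noteq> j" "x$i \<le> a" "x$j \<le> b" "p \<in> N (upd x i a)" "q \<in> N (upd x j b)"
      "T (upd x i a) (upd (upd x i a) j b) p = T (upd x j b) (upd (upd x i a) j b) q"
    obtain w where w: "w \<in> E x" "T x (upd x i a) w = p" "T x (upd x j b) w = q"
      using square_lift[OF h(1-3) subsetD[OF N(2) h(4)] subsetD[OF N(2) h(5)] h(6)] by blast
    obtain n where n: "n \<in> N x" "\<And>t. x \<le> t \<Longrightarrow> T x t w - T x t n \<in> C t" using proj[OF w(1)] by blast
    have le: "x \<le> upd x i a" "x \<le> upd x j b" using h by (simp_all add: le_upd)
    show "\<exists>w\<in>N x. T x (upd x i a) w = p \<and> T x (upd x j b) w = q"
      using eq[OF n(1) le(1) n(2)[OF le(1)] w(2) h(4)] eq[OF n(1) le(2) n(2)[OF le(2)] w(3) h(5)] n(1)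
      by blast
  next
    fix i j k :: 3 and x a b c g
    assume h: "i \<noteq> j" "i \<noteq> k" "j \<noteq> k" "x$i \<le> a" "x$j \<le> b" "x$k \<le> c" "g \<in> N (upd x k c)"
      "T (upd x k c) (upd (upd x k c) i a) g = 0" "T (upd x k c) (upd (upd x k c) j b) g = 0"
    obtain w where w: "w \<in> E x" "T x (upd x k c) w = g" "T x (upd x i a) w = 0" "T x (upd x j b) w = 0"
      using cube_lift[OF h(1-6) subsetD[OF N(2) h(7)] h(8,9)] by blast
    obtain n where n: "n \<in> N x" "\<And>t. x \<le> t \<Longrightarrow> T x t w - T x t n \<in> C t" using proj[OF w(1)] by blast
    have le: "x \<le> upd x k c" "x \<le> upd x i a" "x \<le> upd x j b" using h by (simp_all add: le_upd)
    show "\<exists>w\<in>N x. T x (upd x k c) w = g \<and> T x (upd x i a) w = 0 \<and> T x (upd x j b) w = 0"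
      using eq[OF n(1) le(1) n(2)[OF le(1)] w(2) h(7)]
        eq[OF n(1) le(2) n(2)[OF le(2)] w(3) subspace_0[OF N(1)]]
        eq[OF n(1) le(3) n(2)[OF le(3)] w(4) subspace_0[OF N(1)]] n(1) by blast
  next
    fix i j k :: 3 and y a b c w p q
    assume h: "i \<noteq> j" "i \<noteq> k" "j \<noteq> k" "a \<le> y$i" "b \<le> y$j" "c \<le> y$k"
      "w \<in> N (upd y k c)" "p \<in> N (upd y i a)" "q \<in> N (upd y j b)"
      "T (upd y k c) y w = T (upd y i a) y p + T (upd y j b) y q"
    let ?u = "upd y k c" and ?a = "upd (upd y k c) i a" and ?b = "upd (upd y k c) j b"
    obtain r r' where r: "r \<in> E ?a" "r' \<in> E ?b" "w = T ?a ?u r + T ?b ?u r'"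
      using cube_colift[OF h(1-6) subsetD[OF N(2) h(7)] subsetD[OF N(2) h(8)] subsetD[OF N(2) h(9)] h(10)]
      by blast
    have le: "?a \<le> ?u" "?b \<le> ?u" using h by (auto intro!: upd_le)
    obtain n where n: "n \<in> N ?a" "T ?a ?u r - T ?a ?u n \<in> C ?u" using proj[OF r(1)] le by blast
    obtain n' where n': "n' \<in> N ?b" "T ?b ?u r' - T ?b ?u n' \<in> C ?u" using proj[OF r(2)] le by blast
    let ?d = "w - (T ?a ?u n + T ?b ?u n')"
    have deq: "?d = (T ?a ?u r - T ?a ?u n) + (T ?b ?u r' - T ?b ?u n')"
      unfolding r(3) by (simp add: algebra_simps)
    have "?d \<in> C ?u" by (subst deq) (rule subspace_add[OF C(1) n(2) n'(2)])
    moreover have "?d \<in> N ?u"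
      using subspace_diff[OF N(1) h(7) subspace_add[OF N(1) N(3)[OF le(1) n(1)] N(3)[OF le(2) n'(1)]]] .
    ultimately have "?d = 0" by (rule disj)
    then show "\<exists>r\<in>N ?a. \<exists>r'\<in>N ?b. w = T ?a ?u r + T ?b ?u r'" using n(1) n'(1) by auto
  qed
qed

section \<open>Exhausting the module by block summands\<close>

definition living :: "((real^3) set \<times> (real^3 \<Rightarrow> 'a)) set \<Rightarrow> real^3 \<Rightarrow> ((real^3) set \<times> (real^3 \<Rightarrow> 'a)) set" where
  "living S t = {x \<in> S. t \<in> fst x}"

text \<open>A pair of a block and a generator at each of its points, so that summands with the same
  block stay distinct. That the generators do not vanish comes from the independence in
  \<open>complements\<close>.\<close>

definition block_family :: "(real^3) set \<times> (real^3 \<Rightarrow> 'a) \<Rightarrow> bool" where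
  "block_family x \<longleftrightarrow> fst x \<in> blocks \<and> (\<forall>s\<in>fst x. snd x s \<in> E s) \<and>
    (\<forall>s\<in>fst x. \<forall>t. s \<le> t \<longrightarrow> T s t (snd x s) = (if t \<in> fst x then snd x t else 0))"

text \<open>Pointwise, \<open>E t\<close> is the direct sum of \<open>N t\<close> and the lines
  through the generators living at \<open>t\<close>. Coefficients are indexed by the pairs, so
  independence also says that different pairs have different generators.\<close>

definition complements :: "((real^3) set \<times> (real^3 \<Rightarrow> 'a)) set \<Rightarrow> (real^3 \<Rightarrow> 'a set) \<Rightarrow> real^3 \<Rightarrow> bool" where
  "complements S N t \<longleftrightarrow> subspace (N t) \<and> N t \<subseteq> E t \<and>
    (\<forall>A a. finite A \<longrightarrow> A \<subseteq> living S t \<longrightarrow> (\<Sum>x\<in>A. a x *s snd x t) \<in> N t \<longrightarrow> (\<forall>x\<in>A. a x = 0)) \<and>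
    (\<forall>v\<in>E t. \<exists>A a. finite A \<and> A \<subseteq> living S t \<and> v - (\<Sum>x\<in>A. a x *s snd x t) \<in> N t)"

definition partial_decomposition :: "((real^3) set \<times> (real^3 \<Rightarrow> 'a)) set \<Rightarrow> (real^3 \<Rightarrow> 'a set) \<Rightarrow> bool" where
  "partial_decomposition S N \<longleftrightarrow> (\<forall>x\<in>S. block_family x) \<and>
    (\<forall>s t v. s \<le> t \<longrightarrow> v \<in> N s \<longrightarrow> T s t v \<in> N t) \<and> (\<forall>t. complements S N t)"

lemma complements_indep:
  assumes "complements S N t" and "finite A" "A \<subseteq> living S t" "(\<Sum>x\<in>A. a x *s snd x t) \<in> N t" "x \<in> A"
  shows "a x = 0"
proof -
  from assms(1) have "\<forall>A a. finite A \<longrightarrow> A \<subseteq> living S t \<longrightarrow> (\<Sum>x\<in>A. a x *s snd x t) \<in> N t \<longrightarrow> (\<forall>x\<in>A. a x = 0)"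
    unfolding complements_def by (elim conjE)
  from this[rule_format, OF assms(2-5)] show ?thesis .
qed

lemma complements_cover:
  assumes "complements S N t" "v \<in> E t"
  obtains A a where "finite A" "A \<subseteq> living S t" "v - (\<Sum>x\<in>A. a x *s snd x t) \<in> N t"
proof -
  from assms(1) have "\<forall>v\<in>E t. \<exists>A a. finite A \<and> A \<subseteq> living S t \<and> v - (\<Sum>x\<in>A. a x *s snd x t) \<in> N t"
    unfolding complements_def by (elim conjE)
  from this[rule_format, OF assms(2)] show ?thesis using that by (elim exE conjE)
qed

text \<open>The span of the living generators is a submodule complementary to \<open>N\<close>, so
  exactness descends to \<open>N\<close> and the search for a summand can go on there.\<close>

lemma partial_decomposition_exact:
  assumes "partial_decomposition S N"
  shows "exact_pmod scale N T"
proof -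
  have fam: "\<And>x. x \<in> S \<Longrightarrow> block_family x" and NT: "\<And>s t v. s \<le> t \<Longrightarrow> v \<in> N s \<Longrightarrow> T s t v \<in> N t"
    and comp: "\<And>t. complements S N t" using assms by (auto simp: partial_decomposition_def)
  define C where "C t = span ((\<lambda>x. snd x t) ` living S t)" for t
  show ?thesis
  proof (rule exact_pmod_summand[of N C])
    show "subspace (N t)" for t using comp by (simp add: complements_def)
    show "N t \<subseteq> E t" for t using comp by (simp add: complements_def)
    show "T s t v \<in> N t" if "s \<le> t" "v \<in> N s" for s t v using NT that .
    show subC: "subspace (C t)" for t by (simp add: C_def)
    show "T s t v \<in> C t" if st: "s \<le> t" and "v \<in> C s" for s t v
    proof (rule T_span_in[OF that(2)[unfolded C_def] subC])
      fix a assume "a \<in> (\<lambda>x. snd x s) ` living S s"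
      then obtain x where x: "x \<in> S" "s \<in> fst x" "a = snd x s" by (auto simp: living_def)
      show "T s t a \<in> C t"
      proof (cases "t \<in> fst x")
        case True
        then have "T s t a = snd x t" using fam[OF x(1)] x st by (simp add: block_family_def)
        then show ?thesis using True x(1) unfolding C_def by (intro span_base) (auto simp: living_def)
      next
        case False
        then have "T s t a = 0" using fam[OF x(1)] x st by (simp add: block_family_def)
        then show ?thesis using subspace_0[OF subC] by simp
      qed
    qed
    show "v = 0" if "v \<in> C t" "v \<in> N t" for t v
    proof -
      from that(1) obtain A a where A: "finite A" "A \<subseteq> living S t" "v = (\<Sum>x\<in>A. a x *s snd x t)"
        unfolding C_def by (rule span_imageE)
      then have "a x = 0" if "x \<in> A" for x
        using complements_indep[OF comp[of t] A(1,2) _ that, of a] \<open>v \<in> N t\<close> by simp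
      then show "v = 0" using A(3) by simp
    qed
    show "\<exists>c\<in>C t. v - c \<in> N t" if v: "v \<in> E t" for t v
    proof -
      obtain A a where A: "finite A" "A \<subseteq> living S t" "v - (\<Sum>x\<in>A. a x *s snd x t) \<in> N t"
        by (rule complements_cover[OF comp v])
      have "(\<Sum>x\<in>A. a x *s snd x t) \<in> C t" unfolding C_def
        using A(2) by (intro span_sum span_scale span_base) blast
      then show ?thesis using A(3) by blast
    qed
  qed
qed

lemma partial_decomposition_extend:
  assumes pd: "partial_decomposition S N" and ne: "N t0 \<noteq> {0}"
  obtains x N' where "partial_decomposition (insert x S) N'" "\<And>t. N' t \<subseteq> N t" "N' \<noteq> N"
proof -
  have fam: "\<And>x. x \<in> S \<Longrightarrow> block_family x" and NT: "\<And>s t v. s \<le> t \<Longrightarrow> v \<in> N s \<Longrightarrow> T s t v \<in> N t"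
    and comp: "\<And>t. complements S N t" using pd by (auto simp: partial_decomposition_def)
  have subN: "subspace (N t)" and NE: "N t \<subseteq> E t" for t using comp by (auto simp: complements_def)
  interpret N: exact_pmod scale N T using pd by (rule partial_decomposition_exact)
  from N.exists_block_summand[OF ne] obtain B h N' where B: "B \<in> blocks" and sm: "N.is_summand B h N'"
    by (elim bexE exE)
  have sN': "subspace (N' t)" and N'N: "N' t \<subseteq> N t" and N'out: "t \<notin> B \<Longrightarrow> N' t = N t" for t
    using sm by (auto simp: N.is_summand_def)
  have N'T: "T s t v \<in> N' t" if "s \<le> t" "v \<in> N' s" for s t v using sm that by (auto simp: N.is_summand_def)
  have hN: "h t \<in> N t" "h t \<notin> N' t" if "t \<in> B" for t using sm that by (auto simp: N.is_summand_def)
  have hsp: "\<exists>c. v - c *s h t \<in> N' t" if "t \<in> B" "v \<in> N t" for t v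
    using sm that by (auto simp: N.is_summand_def)
  have hT: "T s t (h s) = (if t \<in> B then h t else 0)" if "s \<in> B" "s \<le> t" for s t
    using sm that by (auto simp: N.is_summand_def)
  obtain t1 where t1: "t1 \<in> B"
    using B by (auto simp: blocks_def birth_block_def death_block_def layer_block_def cuboid_with_def)
  let ?x = "(B, h)"
  \<comment> \<open>The new generator lies in \<open>N\<close>, modulo which the old ones are
    independent.\<close>
  have new: "?x \<notin> S"
  proof
    assume "?x \<in> S"
    then have "finite {?x} \<and> {?x} \<subseteq> living S t1" using t1 by (simp add: living_def)
    moreover have "(\<Sum>x\<in>{?x}. (\<lambda>_. 1) x *s snd x t1) \<in> N t1" using hN(1)[OF t1] by simp
    ultimately have "(1::'k) = 0" using complements_indep[OF comp[of t1], of "{?x}" "\<lambda>_. 1" ?x] by simp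
    then show False by simp
  qed
  have liv: "living (insert ?x S) t = (if t \<in> B then insert ?x (living S t) else living S t)" for t
    by (auto simp: living_def)
  have "block_family ?x" unfolding block_family_def
    using B hN(1) NE hT by auto
  moreover have "complements (insert ?x S) N' t" for t unfolding complements_def
  proof (intro conjI allI impI ballI)
    show "subspace (N' t)" by (rule sN')
    show "N' t \<subseteq> E t" using N'N NE by (meson order_trans)
  next
    fix A a y
    assume A: "finite A" "A \<subseteq> living (insert ?x S) t" "(\<Sum>x\<in>A. a x *s snd x t) \<in> N' t" and y: "y \<in> A"
    have A0: "finite (A - {?x})" "A - {?x} \<subseteq> living S t" using A(1,2) liv by (auto split: if_splits)
    have spl: "(\<Sum>x\<in>A. a x *s snd x t) = (if ?x \<in> A then a ?x *s h t else 0) + (\<Sum>x\<in>A - {?x}. a x *s snd x t)"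
      using A(1) by (auto simp: sum.remove)
    have tB: "t \<in> B" if "?x \<in> A" using A(2) that new by (auto simp: living_def)
    have hin: "(if ?x \<in> A then a ?x *s h t else 0) \<in> N t"
      using tB hN(1) subspace_scale[OF subN] subspace_0[OF subN] by auto
    have "(\<Sum>x\<in>A - {?x}. a x *s snd x t) = (\<Sum>x\<in>A. a x *s snd x t) - (if ?x \<in> A then a ?x *s h t else 0)"
      using spl by simp
    then have "(\<Sum>x\<in>A - {?x}. a x *s snd x t) \<in> N t"
      using subspace_diff[OF subN subsetD[OF N'N A(3)] hin] by simp
    then have z: "\<forall>x\<in>A - {?x}. a x = 0" using complements_indep[OF comp A0] by simp
    then have z': "(\<Sum>x\<in>A - {?x}. a x *s snd x t) = 0" by (intro sum.neutral) simp
    show "a y = 0"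
    proof (cases "y = ?x")
      case True
      then have "a ?x *s h t \<in> N' t" using A(3) spl z' y by simp
      then have "a ?x = 0 \<or> h t \<in> N' t"
        using subspace_scale[OF sN', of "a ?x *s h t" t "inverse (a ?x)"] by (cases "a ?x = 0") auto
      then show ?thesis using hN(2) tB y True by auto
    next
      case False
      then show ?thesis using z y by simp
    qed
  next
    fix v assume "v \<in> E t"
    then obtain A a where A: "finite A" "A \<subseteq> living S t" "v - (\<Sum>x\<in>A. a x *s snd x t) \<in> N t"
      by (rule complements_cover[OF comp])
    show "\<exists>A a. finite A \<and> A \<subseteq> living (insert ?x S) t \<and> v - (\<Sum>x\<in>A. a x *s snd x t) \<in> N' t"
    proof (cases "t \<in> B")
      case True
      obtain c where c: "v - (\<Sum>x\<in>A. a x *s snd x t) - c *s h t \<in> N' t" using hsp[OF True A(3)] by blast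
      have nA: "?x \<notin> A" using A(2) new by (auto simp: living_def)
      have "(\<Sum>x\<in>insert ?x A. (a(?x := c)) x *s snd x t) = c *s h t + (\<Sum>x\<in>A. (a(?x := c)) x *s snd x t)"
        using A(1) nA by simp
      also have "(\<Sum>x\<in>A. (a(?x := c)) x *s snd x t) = (\<Sum>x\<in>A. a x *s snd x t)"
        using nA by (intro sum.cong) auto
      finally have "v - (\<Sum>x\<in>insert ?x A. (a(?x := c)) x *s snd x t) \<in> N' t"
        using c by (simp add: algebra_simps)
      moreover have "insert ?x A \<subseteq> living (insert ?x S) t" using A(2) True by (auto simp: liv)
      ultimately show ?thesis using A(1) by blast
    next
      case False
      then show ?thesis using A N'out by (auto simp: liv)
    qed
  qed
  ultimately have "partial_decomposition (insert ?x S) N'"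
    unfolding partial_decomposition_def using fam N'T by blast
  moreover have "N' \<noteq> N" using hN[OF t1] by auto
  ultimately show ?thesis using that N'N by blast
qed

theorem exists_block_decomposition:
  "\<exists>S. partial_decomposition S (\<lambda>_. {0})"
proof -
  \<comment> \<open>Pairs \<open>(S, N)\<close>, ordered by growing \<open>S\<close> and shrinking \<open>N\<close>, are encoded as sets ordered by inclusion.\<close>
  define dS where "dS X = {x. Inl x \<in> X}" for X :: "(((real^3) set \<times> (real^3 \<Rightarrow> 'a)) + ((real^3) \<times> 'a)) set"
  define dN where "dN X t = {v. Inr (t, v) \<notin> X}"
    for X :: "(((real^3) set \<times> (real^3 \<Rightarrow> 'a)) + ((real^3) \<times> 'a)) set" and t
  define ok where "ok X \<longleftrightarrow> partial_decomposition (dS X) (dN X)" for X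
  define enc where "enc S N = Inl ` S \<union> Inr ` {(t, v). v \<notin> N t}"
    for S :: "((real^3) set \<times> (real^3 \<Rightarrow> 'a)) set" and N :: "real^3 \<Rightarrow> 'a set"
  have dec: "dS (enc S N) = S" "dN (enc S N) = N" for S N
    by (auto simp: dS_def dN_def enc_def fun_eq_iff)
  have le: "dS X \<subseteq> dS Y" "dN Y t \<subseteq> dN X t" if "X \<subseteq> Y" for X Y t
    using that by (auto simp: dS_def dN_def)
  have "partial_decomposition {} E"
    using sub_E T_in by (auto simp: partial_decomposition_def complements_def living_def subspace_0)
  then have ok0: "ok (enc {} E)" by (simp add: ok_def dec)
  have chain: "ok (\<Union>C)" if C: "C \<noteq> {}" "subset.chain {X. ok X} C" for C
  proof -
    have okC: "\<And>X. X \<in> C \<Longrightarrow> ok X" and lin: "\<And>X Y. X \<in> C \<Longrightarrow> Y \<in> C \<Longrightarrow> X \<subseteq> Y \<or> Y \<subseteq> X"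
      using C(2) by (auto simp: subset.chain_def)
    have dSU: "dS (\<Union>C) = (\<Union>X\<in>C. dS X)" and dNU: "dN (\<Union>C) t = (\<Inter>X\<in>C. dN X t)" for t
      by (auto simp: dS_def dN_def)
    have comp: "complements (dS X) (dN X) t" if "X \<in> C" for X t
      using okC[OF that] by (simp add: ok_def partial_decomposition_def)
    have fam: "block_family x" if "X \<in> C" "x \<in> dS X" for X x
      using okC[OF that(1)] that(2) by (simp add: ok_def partial_decomposition_def)
    have NT: "T s t v \<in> dN X t" if "X \<in> C" "s \<le> t" "v \<in> dN X s" for X s t v
      using okC[OF that(1)] that(2,3) by (simp add: ok_def partial_decomposition_def)
    have "complements (dS (\<Union>C)) (dN (\<Union>C)) t" for t
    proof -
      \<comment> \<open>\<open>Z\<close> depends on the point \<open>t\<close>: beyond it in the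
        chain the complement at \<open>t\<close> no longer changes.\<close>
      obtain Z where Z: "Z \<in> C" "\<And>X. X \<in> C \<Longrightarrow> dim (dN Z t) \<le> dim (dN X t)"
        using ex_has_least_nat[of "\<lambda>X. X \<in> C" _ "\<lambda>X. dim (dN X t)"] C(1) by blast
      have sN: "subspace (dN X t)" "dN X t \<subseteq> E t" if "X \<in> C" for X
        using comp[OF that, of t] by (auto simp: complements_def)
      have eqN: "dN X t = dN Z t" if "X \<in> C" "Z \<subseteq> X" for X
        using dim_eqI[OF sN(1)[OF that(1)] le(2)[OF that(2)] sN(2)[OF Z(1)] Z(2)[OF that(1)]] .
      have N: "dN (\<Union>C) t = dN Z t"
      proof
        show "dN (\<Union>C) t \<subseteq> dN Z t" using Z(1) dNU by blast
        have "dN Z t \<subseteq> dN X t" if "X \<in> C" for X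
          using lin[OF Z(1) that] eqN[OF that] le(2)[of X Z t] by auto
        then show "dN Z t \<subseteq> dN (\<Union>C) t" unfolding dNU by blast
      qed
      \<comment> \<open>Once the complement is constant at \<open>t\<close>, so are the generators:
        a later one would be a combination of the earlier ones modulo the same complement, against
        independence.\<close>
      have "living (dS X) t \<subseteq> living (dS Z) t" if X: "X \<in> C" for X
      proof (cases "X \<subseteq> Z")
        case True
        then show ?thesis using le(1)[OF True] by (auto simp: living_def)
      next
        case False
        then have ZX: "Z \<subseteq> X" using lin[OF Z(1) X] by blast
        show ?thesis
        proof
          fix x assume x: "x \<in> living (dS X) t"
          then have "snd x t \<in> E t" using fam[OF X] by (simp add: living_def block_family_def)
          then obtain A a where A: "finite A" "A \<subseteq> living (dS Z) t" "snd x t - (\<Sum>y\<in>A. a y *s snd y t) \<in> dN Z t"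
            by (rule complements_cover[OF comp[OF Z(1)]])
          show "x \<in> living (dS Z) t"
          proof (rule ccontr)
            assume "x \<notin> living (dS Z) t"
            then have xA: "x \<notin> A" using A(2) by blast
            define b where "b = (\<lambda>y. if y = x then 1 else - a y)"
            have "(\<Sum>y\<in>insert x A. b y *s snd y t) = snd x t + (\<Sum>y\<in>A. b y *s snd y t)"
              using A(1) xA by (simp add: b_def)
            also have "(\<Sum>y\<in>A. b y *s snd y t) = (\<Sum>y\<in>A. - (a y *s snd y t))"
              using xA by (intro sum.cong) (auto simp: b_def)
            finally have "(\<Sum>y\<in>insert x A. b y *s snd y t) \<in> dN X t"
              using A(3) eqN[OF X ZX] by (simp add: sum_negf)
            moreover have "finite (insert x A)" "insert x A \<subseteq> living (dS X) t"
              using A(1,2) x le(1)[OF ZX] by (auto simp: living_def)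
            ultimately have "b x = 0" using complements_indep[OF comp[OF X], of "insert x A" t b x] by simp
            then show False by (simp add: b_def)
          qed
        qed
      qed
      then have "living (dS (\<Union>C)) t = living (dS Z) t"
        using Z(1) unfolding living_def dSU by blast
      then show ?thesis using comp[OF Z(1), of t] N by (simp add: complements_def)
    qed
    moreover have "block_family x" if "x \<in> dS (\<Union>C)" for x using that fam unfolding dSU by blast
    moreover have "T s t v \<in> dN (\<Union>C) t" if "s \<le> t" "v \<in> dN (\<Union>C) s" for s t v
      using that NT unfolding dNU by blast
    ultimately show ?thesis unfolding ok_def partial_decomposition_def by blast
  qed
  have "\<exists>M\<in>{X. ok X}. \<forall>X\<in>{X. ok X}. M \<subseteq> X \<longrightarrow> X = M"
    by (rule subset_Zorn_nonempty) (use ok0 chain in auto)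
  then obtain X where X: "ok X" and Xmax: "\<And>Y. ok Y \<Longrightarrow> X \<subseteq> Y \<Longrightarrow> Y = X" by blast
  have pd: "partial_decomposition (dS X) (dN X)" using X by (simp add: ok_def)
  have "dN X t = {0}" for t
  proof (rule ccontr)
    assume "dN X t \<noteq> {0}"
    then obtain x N' where x: "partial_decomposition (insert x (dS X)) N'" "\<And>t. N' t \<subseteq> dN X t" "N' \<noteq> dN X"
      using partial_decomposition_extend[OF pd] by metis
    have "y \<in> enc (insert x (dS X)) N'" if "y \<in> X" for y
      using that x(2) by (cases y) (auto simp: enc_def dS_def dN_def)
    then have "enc (insert x (dS X)) N' = X" using x(1) by (intro Xmax) (auto simp: ok_def dec)
    then have "dN X = N'" using dec(2) by metis
    then show False using x(3) by simp
  qed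
  then have "dN X = (\<lambda>_. {0})" by auto
  then show ?thesis using pd by auto
qed

end

section \<open>Coordinates on vector spaces\<close>

definition fscale :: "'k::field \<Rightarrow> ('b \<Rightarrow> 'k) \<Rightarrow> 'b \<Rightarrow> 'k" where
  "fscale c f = (\<lambda>x. c * f x)"

interpretation fs: vector_space fscale
  by unfold_locales (auto simp: fscale_def fun_eq_iff algebra_simps)

definition fin_functions :: "'b set \<Rightarrow> ('b \<Rightarrow> 'k::field) set" where
  "fin_functions A = {f. finite {x. f x \<noteq> 0} \<and> {x. f x \<noteq> 0} \<subseteq> A}"

text \<open>A linear bijection onto the finitely supported functions on \<open>A\<close>. It speaks
  only of the operations of the record, so the vector space axioms for \<open>V\<close> can be
  transported back from the functions.\<close>

definition coordinates :: "('k::field, 'v) module \<Rightarrow> ('v \<Rightarrow> 'b \<Rightarrow> 'k) \<Rightarrow> 'b set \<Rightarrow> bool" where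
  "coordinates V \<phi> A \<longleftrightarrow> bij_betw \<phi> (carrier V) (fin_functions A) \<and>
    (\<forall>v\<in>carrier V. \<forall>w\<in>carrier V. \<phi> (v \<oplus>\<^bsub>V\<^esub> w) = \<phi> v + \<phi> w) \<and>
    (\<forall>c. \<forall>v\<in>carrier V. \<phi> (c \<odot>\<^bsub>V\<^esub> v) = fscale c (\<phi> v))"

lemma fin_functions_subspace: "fs.subspace (fin_functions A)"
proof (rule fs.subspaceI)
  show "0 \<in> fin_functions A" by (simp add: fin_functions_def)
  show "f + g \<in> fin_functions A" if "f \<in> fin_functions A" "g \<in> fin_functions A" for f g
  proof -
    have "{x. (f + g) x \<noteq> 0} \<subseteq> {x. f x \<noteq> 0} \<union> {x. g x \<noteq> 0}" by auto
    then show ?thesis using that by (auto simp: fin_functions_def intro: finite_subset)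
  qed
  show "fscale c f \<in> fin_functions A" if "f \<in> fin_functions A" for c f
  proof -
    have "{x. fscale c f x \<noteq> 0} \<subseteq> {x. f x \<noteq> 0}" by (auto simp: fscale_def)
    then show ?thesis using that by (auto simp: fin_functions_def intro: finite_subset)
  qed
qed

lemma fin_functions_finite: "finite A \<Longrightarrow> fin_functions A = {f. \<forall>x. x \<notin> A \<longrightarrow> f x = 0}"
  by (auto simp: fin_functions_def intro: finite_subset)

lemma linear_mapI:
  assumes "vectorspace class_ring V" "vectorspace class_ring W" "\<And>v. v \<in> carrier V \<Longrightarrow> f v \<in> carrier W"
    "\<And>v w. v \<in> carrier V \<Longrightarrow> w \<in> carrier V \<Longrightarrow> f (v \<oplus>\<^bsub>V\<^esub> w) = f v \<oplus>\<^bsub>W\<^esub> f w"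
    "\<And>c v. v \<in> carrier V \<Longrightarrow> f (c \<odot>\<^bsub>V\<^esub> v) = c \<odot>\<^bsub>W\<^esub> f v"
  shows "linear_map (class_ring :: 'k::field ring) V W f"
  using assms unfolding linear_map_def mod_hom_def mod_hom_axioms_def module_hom_def vectorspace_def
  by auto

lemma linear_mapD:
  assumes "linear_map (class_ring :: 'k::field ring) V W f"
  shows "v \<in> carrier V \<Longrightarrow> f v \<in> carrier W"
    "v \<in> carrier V \<Longrightarrow> w \<in> carrier V \<Longrightarrow> f (v \<oplus>\<^bsub>V\<^esub> w) = f v \<oplus>\<^bsub>W\<^esub> f w"
    "v \<in> carrier V \<Longrightarrow> f (c \<odot>\<^bsub>V\<^esub> v) = c \<odot>\<^bsub>W\<^esub> f v"
    "vectorspace class_ring V" "vectorspace class_ring W" "mod_hom class_ring V W f"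
  using assms unfolding linear_map_def mod_hom_def mod_hom_axioms_def module_hom_def by auto

lemma vs_closed:
  assumes "vectorspace (class_ring :: 'k::field ring) V"
  shows "v \<in> carrier V \<Longrightarrow> w \<in> carrier V \<Longrightarrow> v \<oplus>\<^bsub>V\<^esub> w \<in> carrier V"
    "v \<in> carrier V \<Longrightarrow> c \<odot>\<^bsub>V\<^esub> v \<in> carrier V" "\<zero>\<^bsub>V\<^esub> \<in> carrier V"
    "abelian_group V" "Module.module class_ring V"
    "v \<in> carrier V \<Longrightarrow> w \<in> carrier V \<Longrightarrow> v \<ominus>\<^bsub>V\<^esub> w \<in> carrier V"
proof -
  interpret vectorspace "class_ring :: 'k ring" V by fact
  show "v \<in> carrier V \<Longrightarrow> w \<in> carrier V \<Longrightarrow> v \<oplus>\<^bsub>V\<^esub> w \<in> carrier V" by simp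
  show "v \<in> carrier V \<Longrightarrow> c \<odot>\<^bsub>V\<^esub> v \<in> carrier V" by simp
  show "\<zero>\<^bsub>V\<^esub> \<in> carrier V" by simp
  show "abelian_group V" by (rule M.abelian_group_axioms)
  show "Module.module class_ring V" by (rule module_axioms)
  show "v \<in> carrier V \<Longrightarrow> w \<in> carrier V \<Longrightarrow> v \<ominus>\<^bsub>V\<^esub> w \<in> carrier V" by simp
qed

lemma linear_map_zero:
  assumes "linear_map (class_ring :: 'k::field ring) V W f"
  shows "f \<zero>\<^bsub>V\<^esub> = \<zero>\<^bsub>W\<^esub>"
proof -
  interpret linear_map "class_ring :: 'k ring" V W f by fact
  show ?thesis by simp
qed

context
  fixes V :: "('k::field, 'v) module" and \<phi> :: "'v \<Rightarrow> 'b \<Rightarrow> 'k" and A :: "'b set"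
  assumes co: "coordinates V \<phi> A"
begin

lemma coordinates_add: "v \<in> carrier V \<Longrightarrow> w \<in> carrier V \<Longrightarrow> \<phi> (v \<oplus>\<^bsub>V\<^esub> w) = \<phi> v + \<phi> w"
  and coordinates_smult: "v \<in> carrier V \<Longrightarrow> \<phi> (c \<odot>\<^bsub>V\<^esub> v) = fscale c (\<phi> v)"
  and coordinates_bij: "bij_betw \<phi> (carrier V) (fin_functions A)"
  using co by (auto simp: coordinates_def)

lemma coordinates_in: "v \<in> carrier V \<Longrightarrow> \<phi> v \<in> fin_functions A"
  using coordinates_bij by (auto simp: bij_betw_def)

lemma coordinates_inj: "v \<in> carrier V \<Longrightarrow> w \<in> carrier V \<Longrightarrow> \<phi> v = \<phi> w \<Longrightarrow> v = w"
  using coordinates_bij by (auto simp: bij_betw_def dest: inj_onD)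

lemma coordinates_surj: "f \<in> fin_functions A \<Longrightarrow> \<exists>v\<in>carrier V. \<phi> v = f"
  using coordinates_bij unfolding bij_betw_def by (metis (no_types) imageE)

lemma vectorspace_via_coordinates:
  assumes add: "\<And>v w. v \<in> carrier V \<Longrightarrow> w \<in> carrier V \<Longrightarrow> v \<oplus>\<^bsub>V\<^esub> w \<in> carrier V"
    and smult: "\<And>c v. v \<in> carrier V \<Longrightarrow> c \<odot>\<^bsub>V\<^esub> v \<in> carrier V"
    and zero: "\<zero>\<^bsub>V\<^esub> \<in> carrier V" "\<phi> \<zero>\<^bsub>V\<^esub> = 0"
  shows "vectorspace (class_ring :: 'k ring) V"
proof (rule vs_criteria)
  show "field (class_ring :: 'k ring)" by (rule class_field.field_axioms)
  note s = coordinates_add coordinates_smult add smult zero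
  show "\<forall>v\<in>carrier V. \<exists>neg_v\<in>carrier V. v \<oplus>\<^bsub>V\<^esub> neg_v = \<zero>\<^bsub>V\<^esub>"
  proof
    fix v assume v: "v \<in> carrier V"
    have "v \<oplus>\<^bsub>V\<^esub> ((- 1) \<odot>\<^bsub>V\<^esub> v) = \<zero>\<^bsub>V\<^esub>"
      by (rule coordinates_inj) (use v in \<open>auto simp: s fscale_def fun_eq_iff\<close>)
    then show "\<exists>neg_v\<in>carrier V. v \<oplus>\<^bsub>V\<^esub> neg_v = \<zero>\<^bsub>V\<^esub>" using smult[OF v] by blast
  qed
  show "\<forall>v w. v \<in> carrier V \<and> w \<in> carrier V \<longrightarrow> v \<oplus>\<^bsub>V\<^esub> w = w \<oplus>\<^bsub>V\<^esub> v"
    by (intro allI impI, rule coordinates_inj) (auto simp: s algebra_simps)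
  show "\<forall>v w x. v \<in> carrier V \<and> w \<in> carrier V \<and> x \<in> carrier V \<longrightarrow>
      v \<oplus>\<^bsub>V\<^esub> w \<oplus>\<^bsub>V\<^esub> x = v \<oplus>\<^bsub>V\<^esub> (w \<oplus>\<^bsub>V\<^esub> x)"
    by (intro allI impI, rule coordinates_inj) (auto simp: s algebra_simps)
  show "\<forall>v\<in>carrier V. v \<oplus>\<^bsub>V\<^esub> \<zero>\<^bsub>V\<^esub> = v"
    by (intro ballI, rule coordinates_inj) (auto simp: s)
  show "\<forall>a b v. a \<in> carrier class_ring \<and> b \<in> carrier class_ring \<and> v \<in> carrier V \<longrightarrow>
      (a \<otimes>\<^bsub>class_ring\<^esub> b) \<odot>\<^bsub>V\<^esub> v = a \<odot>\<^bsub>V\<^esub> (b \<odot>\<^bsub>V\<^esub> v)"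
    by (intro allI impI, rule coordinates_inj) (auto simp: s)
  show "\<forall>v\<in>carrier V. \<one>\<^bsub>class_ring\<^esub> \<odot>\<^bsub>V\<^esub> v = v"
    by (intro ballI, rule coordinates_inj) (auto simp: s)
  show "\<forall>a b v. a \<in> carrier class_ring \<and> b \<in> carrier class_ring \<and> v \<in> carrier V \<longrightarrow>
      (a \<oplus>\<^bsub>class_ring\<^esub> b) \<odot>\<^bsub>V\<^esub> v = a \<odot>\<^bsub>V\<^esub> v \<oplus>\<^bsub>V\<^esub> b \<odot>\<^bsub>V\<^esub> v"
    by (intro allI impI, rule coordinates_inj) (auto simp: s fs.scale_left_distrib)
  show "\<forall>a v w. a \<in> carrier class_ring \<and> v \<in> carrier V \<and> w \<in> carrier V \<longrightarrow>
      a \<odot>\<^bsub>V\<^esub> (v \<oplus>\<^bsub>V\<^esub> w) = a \<odot>\<^bsub>V\<^esub> v \<oplus>\<^bsub>V\<^esub> a \<odot>\<^bsub>V\<^esub> w"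
    by (intro allI impI, rule coordinates_inj) (auto simp: s fs.scale_right_distrib)
qed (use add smult zero in auto)

context
  assumes vs: "vectorspace (class_ring :: 'k ring) V"
begin

interpretation V: vectorspace "class_ring :: 'k ring" V by (rule vs)

lemma coordinates_zero: "\<phi> \<zero>\<^bsub>V\<^esub> = 0"
  using coordinates_add[of "\<zero>\<^bsub>V\<^esub>" "\<zero>\<^bsub>V\<^esub>"] by simp

lemma coordinates_eq_zero: "v \<in> carrier V \<Longrightarrow> \<phi> v = 0 \<Longrightarrow> v = \<zero>\<^bsub>V\<^esub>"
  using coordinates_inj[of v "\<zero>\<^bsub>V\<^esub>"] coordinates_zero by simp

lemma coordinates_minus:
  assumes "v \<in> carrier V" "w \<in> carrier V" shows "\<phi> (v \<ominus>\<^bsub>V\<^esub> w) = \<phi> v - \<phi> w"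
proof -
  have "\<phi> w + \<phi> (\<ominus>\<^bsub>V\<^esub> w) = 0"
    using coordinates_add[of w "\<ominus>\<^bsub>V\<^esub> w"] assms V.r_neg coordinates_zero by simp
  then have "\<phi> (\<ominus>\<^bsub>V\<^esub> w) = - \<phi> w" by (simp add: eq_neg_iff_add_eq_0 add.commute)
  then show ?thesis using coordinates_add[of v "\<ominus>\<^bsub>V\<^esub> w"] assms by (simp add: a_minus_def)
qed

lemma coordinates_finsum:
  "finite I \<Longrightarrow> (\<And>i. i \<in> I \<Longrightarrow> g i \<in> carrier V) \<Longrightarrow> \<phi> (\<Oplus>\<^bsub>V\<^esub>i\<in>I. g i) = (\<Sum>i\<in>I. \<phi> (g i))"
proof (induction I rule: finite_induct)
  case empty
  then show ?case by (simp add: coordinates_zero)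
next
  case (insert i I)
  then show ?case by (simp add: coordinates_add Pi_def)
qed

text \<open>Vectors of \<open>V\<close>, not functionals: the basis that belongs to the
  coordinates.\<close>

definition dual_vector :: "'b \<Rightarrow> 'v" where
  "dual_vector x = (SOME v. v \<in> carrier V \<and> \<phi> v = (\<lambda>y. if y = x then 1 else 0))"

lemma dual_vector:
  assumes "x \<in> A"
  shows "dual_vector x \<in> carrier V" "\<phi> (dual_vector x) = (\<lambda>y. if y = x then 1 else 0)"
proof -
  have "(\<lambda>y. if y = x then 1 else 0 :: 'k) \<in> fin_functions A" using assms by (auto simp: fin_functions_def)
  then have "\<exists>v. v \<in> carrier V \<and> \<phi> v = (\<lambda>y. if y = x then 1 else 0)" using coordinates_surj by blast
  from someI_ex[OF this] show "dual_vector x \<in> carrier V" "\<phi> (dual_vector x) = (\<lambda>y. if y = x then 1 else 0)"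
    by (simp_all add: dual_vector_def)
qed

lemma dual_vector_inj: "inj_on dual_vector A"
proof (rule inj_onI)
  fix x y assume xy: "x \<in> A" "y \<in> A" "dual_vector x = dual_vector y"
  then have "(\<lambda>z. if z = x then 1 else 0 :: 'k) = (\<lambda>z. if z = y then 1 else 0)"
    using dual_vector(2) by metis
  from fun_cong[OF this, of x] show "x = y" by (auto split: if_splits)
qed

lemma coordinates_lincomb:
  assumes "finite I" "I \<subseteq> A"
  shows "\<phi> (V.lincomb a (dual_vector ` I)) = (\<lambda>x. if x \<in> I then a (dual_vector x) else 0)"
proof -
  have "\<phi> (V.lincomb a (dual_vector ` I)) = (\<Sum>v\<in>dual_vector ` I. \<phi> (a v \<odot>\<^bsub>V\<^esub> v))"
    unfolding V.lincomb_def using assms dual_vector(1) by (intro coordinates_finsum) auto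
  also have "\<dots> = (\<Sum>x\<in>I. \<phi> (a (dual_vector x) \<odot>\<^bsub>V\<^esub> dual_vector x))"
    using inj_on_subset[OF dual_vector_inj assms(2)] by (simp add: sum.reindex)
  also have "\<dots> = (\<Sum>x\<in>I. fscale (a (dual_vector x)) (\<lambda>y. if y = x then 1 else 0))"
    using assms dual_vector by (intro sum.cong) (auto simp: coordinates_smult subset_iff)
  also have "\<dots> = (\<lambda>x. if x \<in> I then a (dual_vector x) else 0)"
  proof
    fix y
    have "(\<Sum>x\<in>I. fscale (a (dual_vector x)) (\<lambda>y. if y = x then 1 else 0)) y
      = (\<Sum>x\<in>I. fscale (a (dual_vector x)) (\<lambda>y. if y = x then 1 else 0) y)"
      by (induction I rule: infinite_finite_induct) auto
    also have "\<dots> = (\<Sum>x\<in>I. if x = y then a (dual_vector x) else 0)"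
      by (intro sum.cong) (auto simp: fscale_def)
    also have "\<dots> = (if y \<in> I then a (dual_vector y) else 0)" using assms(1) by simp
    finally show "(\<Sum>x\<in>I. fscale (a (dual_vector x)) (\<lambda>y. if y = x then 1 else 0)) y
      = (if y \<in> I then a (dual_vector y) else 0)" .
  qed
  finally show ?thesis .
qed

text \<open>More than \<open>dim\<close> basis vectors would be independent. Applied to a
  decomposition, this makes the set of summands alive at a point finite.\<close>

lemma coordinates_finite:
  assumes fd: "V.fin_dim" shows "finite A"
proof (rule ccontr)
  assume "infinite A"
  then obtain I where I: "I \<subseteq> A" "finite I" "card I = Suc V.dim"
    using infinite_arbitrarily_large by blast
  have "V.lin_indpt (dual_vector ` I)"
  proof (rule V.finite_lin_indpt2)
    show "finite (dual_vector ` I)" using I by simp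
    show "dual_vector ` I \<subseteq> carrier V" using I dual_vector(1) by blast
    fix a :: "'v \<Rightarrow> 'k" assume "V.lincomb a (dual_vector ` I) = \<zero>\<^bsub>V\<^esub>"
    then have "(\<lambda>x. if x \<in> I then a (dual_vector x) else 0) = 0"
      using coordinates_lincomb[OF I(2,1), of a] coordinates_zero by simp
    then show "\<forall>v\<in>dual_vector ` I. a v = \<zero>\<^bsub>class_ring\<^esub>" by (auto simp: fun_eq_iff split: if_splits)
  qed
  then have "card (dual_vector ` I) \<le> V.dim"
    using V.li_le_dim(2)[OF fd] I dual_vector(1) by blast
  then show False using I card_image[OF inj_on_subset[OF dual_vector_inj I(1)]] by simp
qed

lemma coordinates_dim:
  assumes fin: "finite A"
  shows "V.fin_dim" "V.dim = card A"
proof -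
  have sub: "dual_vector ` A \<subseteq> carrier V" using dual_vector(1) by blast
  have fA: "finite (dual_vector ` A)" using fin by simp
  have "\<exists>!a. a \<in> dual_vector ` A \<rightarrow>\<^sub>E carrier class_ring \<and> V.lincomb a (dual_vector ` A) = v"
    if v: "v \<in> carrier V" for v
  proof -
    have iff: "V.lincomb a (dual_vector ` A) = v \<longleftrightarrow> (\<forall>x\<in>A. a (dual_vector x) = \<phi> v x)" for a
    proof -
      have "V.lincomb a (dual_vector ` A) = v \<longleftrightarrow> \<phi> (V.lincomb a (dual_vector ` A)) = \<phi> v"
        using coordinates_inj[OF V.lincomb_closed[OF sub] v] by auto
      also have "\<dots> \<longleftrightarrow> (\<forall>x\<in>A. a (dual_vector x) = \<phi> v x)"
        using coordinates_lincomb[OF fin order_refl, of a] coordinates_in[OF v]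
        by (auto simp: fun_eq_iff fin_functions_def)
      finally show ?thesis .
    qed
    define a0 where "a0 = (\<lambda>w\<in>dual_vector ` A. \<phi> v (inv_into A dual_vector w))"
    have a0: "a0 (dual_vector x) = \<phi> v x" if "x \<in> A" for x
      using that dual_vector_inj by (simp add: a0_def)
    show ?thesis
    proof (rule ex1I[of _ a0])
      show "a0 \<in> dual_vector ` A \<rightarrow>\<^sub>E carrier class_ring \<and> V.lincomb a0 (dual_vector ` A) = v"
        unfolding iff using a0 by (simp add: a0_def)
    next
      fix a assume a: "a \<in> dual_vector ` A \<rightarrow>\<^sub>E carrier class_ring \<and> V.lincomb a (dual_vector ` A) = v"
      then have "\<forall>x\<in>A. a (dual_vector x) = a0 (dual_vector x)" unfolding iff using a0 by simp
      then show "a = a0" using a by (intro ext) (auto simp: a0_def PiE_def extensional_def)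
    qed
  qed
  then have basis: "V.basis (dual_vector ` A)" using V.basis_criterion[OF fA sub] by simp
  show "V.dim = card A"
    using V.dim_basis[OF fA basis] card_image[OF dual_vector_inj] by simp
  show "V.fin_dim" using basis fA sub unfolding V.fin_dim_def V.basis_def by blast
qed

end

end

lemma exists_coordinates:
  fixes V :: "('k::field, 'v) module"
  assumes vs: "vectorspace (class_ring :: 'k ring) V" and fd: "vectorspace.fin_dim (class_ring :: 'k ring) V"
  obtains A :: "'v set" and \<phi> where "finite A" "coordinates V \<phi> A"
proof -
  interpret V: vectorspace "class_ring :: 'k ring" V by (rule vs)
  obtain A where A: "finite A" "V.basis A" using V.finite_basis_exists fd by blast
  then have AV: "A \<subseteq> carrier V" by (simp add: V.basis_def)
  have ex1: "\<And>v. v \<in> carrier V \<Longrightarrow> \<exists>!a. a \<in> A \<rightarrow>\<^sub>E UNIV \<and> V.lincomb a A = v"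
    using A V.basis_criterion[OF A(1) AV] by simp
  define \<psi> where "\<psi> f = V.lincomb f A" for f
  have \<psi>_in: "\<psi> f \<in> carrier V" for f unfolding \<psi>_def using AV by (intro V.lincomb_closed) auto
  have \<psi>_add: "\<psi> (f + g) = \<psi> f \<oplus>\<^bsub>V\<^esub> \<psi> g" for f g
    using V.lincomb_sum[OF A(1) AV, of f g] by (simp add: \<psi>_def plus_fun_def)
  have \<psi>_smult: "\<psi> (fscale c f) = c \<odot>\<^bsub>V\<^esub> \<psi> f" for c f
    using V.lincomb_smult[OF AV, of f c] by (simp add: \<psi>_def fscale_def)
  have \<psi>_cong: "\<psi> f = \<psi> g" if "\<And>x. x \<in> A \<Longrightarrow> f x = g x" for f g
    unfolding \<psi>_def using that AV by (intro V.lincomb_cong) auto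
  have fin: "fin_functions A = {f :: 'v \<Rightarrow> 'k. \<forall>x. x \<notin> A \<longrightarrow> f x = 0}" using A(1) by (rule fin_functions_finite)
  have inj: "inj_on \<psi> (fin_functions A)"
  proof (rule inj_onI)
    fix f g assume fg: "f \<in> fin_functions A" "g \<in> fin_functions A" "\<psi> f = \<psi> g"
    have rs: "restrict f A \<in> A \<rightarrow>\<^sub>E UNIV \<and> V.lincomb (restrict f A) A = \<psi> f"
      "restrict g A \<in> A \<rightarrow>\<^sub>E UNIV \<and> V.lincomb (restrict g A) A = \<psi> f"
      using \<psi>_cong[of "restrict f A" f] \<psi>_cong[of "restrict g A" g] fg(3) by (auto simp: \<psi>_def)
    have "restrict f A = restrict g A"
      by (rule trans[OF the1_equality[OF ex1[OF \<psi>_in[of f]], THEN sym] the1_equality[OF ex1[OF \<psi>_in[of f]]]])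
        (use rs in auto)
    then have "f x = g x" if "x \<in> A" for x using that by (metis restrict_apply')
    moreover have "f x = g x" if "x \<notin> A" for x using fg(1,2) that unfolding fin by simp
    ultimately show "f = g" by blast
  qed
  have surj: "\<psi> ` fin_functions A = carrier V"
  proof
    show "\<psi> ` fin_functions A \<subseteq> carrier V" using \<psi>_in by blast
    show "carrier V \<subseteq> \<psi> ` fin_functions A"
    proof
      fix v assume "v \<in> carrier V"
      then obtain a where a: "V.lincomb a A = v" using ex1 by blast
      have "\<psi> (\<lambda>x. if x \<in> A then a x else 0) = v"
        using a \<psi>_cong[of "\<lambda>x. if x \<in> A then a x else 0" a] by (simp add: \<psi>_def)
      moreover have "(\<lambda>x. if x \<in> A then a x else 0) \<in> fin_functions A" by (auto simp: fin)
      ultimately show "v \<in> \<psi> ` fin_functions A" by blast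
    qed
  qed
  define \<phi> where "\<phi> = inv_into (fin_functions A) \<psi>"
  have \<phi>: "\<psi> (\<phi> v) = v" "\<phi> v \<in> fin_functions A" if "v \<in> carrier V" for v
    using that surj f_inv_into_f[of v \<psi>] inv_into_into[of v \<psi>] by (auto simp: \<phi>_def)
  have \<phi>I: "\<phi> v = f" if "f \<in> fin_functions A" "\<psi> f = v" for v f
    using that inj by (auto simp: \<phi>_def)
  have "coordinates V \<phi> A" unfolding coordinates_def
  proof (intro conjI ballI allI)
    show "bij_betw \<phi> (carrier V) (fin_functions A)"
      unfolding \<phi>_def using inj surj by (intro bij_betw_inv_into) (simp add: bij_betw_def)
    show "\<phi> (v \<oplus>\<^bsub>V\<^esub> w) = \<phi> v + \<phi> w" if "v \<in> carrier V" "w \<in> carrier V" for v w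
      using \<phi> that by (intro \<phi>I fs.subspace_add[OF fin_functions_subspace]) (auto simp: \<psi>_add)
    show "\<phi> (c \<odot>\<^bsub>V\<^esub> v) = fscale c (\<phi> v)" if "v \<in> carrier V" for c v
      using \<phi> that by (intro \<phi>I fs.subspace_scale[OF fin_functions_subspace]) (auto simp: \<psi>_smult)
  qed
  then show ?thesis using that A(1) by blast
qed

lemma vectorspace_vs_dsum:
  assumes vs: "\<And>i. i \<in> I \<Longrightarrow> vectorspace (class_ring :: 'k::field ring) (V i)"
  shows "vectorspace (class_ring :: 'k ring) (vs_dsum I V)"
proof (rule vs_criteria)
  have m: "Module.module (class_ring :: 'k ring) (V i)" and ag: "abelian_group (V i)" if "i \<in> I" for i
    using vs_closed(4,5)[OF vs[OF that]] by auto
  note cl = vs_closed(1-3)[OF vs]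
  show "field (class_ring :: 'k ring)" by (rule class_field.field_axioms)
  show "\<zero>\<^bsub>vs_dsum I V\<^esub> \<in> carrier (vs_dsum I V)" using cl by (auto simp: vs_dsum_def)
  show "\<forall>v w. v \<in> carrier (vs_dsum I V) \<and> w \<in> carrier (vs_dsum I V) \<longrightarrow>
      v \<oplus>\<^bsub>vs_dsum I V\<^esub> w \<in> carrier (vs_dsum I V)"
  proof (intro allI impI)
    fix v w assume vw: "v \<in> carrier (vs_dsum I V) \<and> w \<in> carrier (vs_dsum I V)"
    have "{i \<in> I. (v i \<oplus>\<^bsub>V i\<^esub> w i) \<noteq> \<zero>\<^bsub>V i\<^esub>} \<subseteq> {i \<in> I. v i \<noteq> \<zero>\<^bsub>V i\<^esub>} \<union> {i \<in> I. w i \<noteq> \<zero>\<^bsub>V i\<^esub>}"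
      using abelian_monoid.l_zero[OF abelian_group.axioms(1)[OF ag]] cl(3) by auto
    moreover have "finite ({i \<in> I. v i \<noteq> \<zero>\<^bsub>V i\<^esub>} \<union> {i \<in> I. w i \<noteq> \<zero>\<^bsub>V i\<^esub>})"
      using vw by (simp add: vs_dsum_def)
    ultimately have "finite {i \<in> I. (v i \<oplus>\<^bsub>V i\<^esub> w i) \<noteq> \<zero>\<^bsub>V i\<^esub>}" by (rule finite_subset)
    then show "v \<oplus>\<^bsub>vs_dsum I V\<^esub> w \<in> carrier (vs_dsum I V)"
      using vw cl by (auto simp: vs_dsum_def PiE_def Pi_def cong: conj_cong)
  qed
  have sm: "c \<odot>\<^bsub>vs_dsum I V\<^esub> v \<in> carrier (vs_dsum I V)" if v: "v \<in> carrier (vs_dsum I V)" for c v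
  proof -
    have "{i \<in> I. (c \<odot>\<^bsub>V i\<^esub> v i) \<noteq> \<zero>\<^bsub>V i\<^esub>} \<subseteq> {i \<in> I. v i \<noteq> \<zero>\<^bsub>V i\<^esub>}"
      using Module.module.smult_r_null[OF m] by auto
    moreover have "finite {i \<in> I. v i \<noteq> \<zero>\<^bsub>V i\<^esub>}" using v by (simp add: vs_dsum_def)
    ultimately have "finite {i \<in> I. (c \<odot>\<^bsub>V i\<^esub> v i) \<noteq> \<zero>\<^bsub>V i\<^esub>}" by (rule finite_subset)
    then show ?thesis using v cl by (auto simp: vs_dsum_def PiE_def Pi_def cong: conj_cong)
  qed
  then show "\<forall>c v. c \<in> carrier class_ring \<and> v \<in> carrier (vs_dsum I V) \<longrightarrow>
      c \<odot>\<^bsub>vs_dsum I V\<^esub> v \<in> carrier (vs_dsum I V)" by blast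
  show "\<forall>v\<in>carrier (vs_dsum I V). \<exists>neg_v\<in>carrier (vs_dsum I V). v \<oplus>\<^bsub>vs_dsum I V\<^esub> neg_v = \<zero>\<^bsub>vs_dsum I V\<^esub>"
  proof
    fix v assume v: "v \<in> carrier (vs_dsum I V)"
    have "v i \<oplus>\<^bsub>V i\<^esub> (- 1) \<odot>\<^bsub>V i\<^esub> v i = \<zero>\<^bsub>V i\<^esub>" if "i \<in> I" for i
    proof -
      interpret Vi: vectorspace "class_ring :: 'k ring" "V i" by (rule vs[OF that])
      have vi: "v i \<in> carrier (V i)" using v that by (auto simp: vs_dsum_def)
      have "v i \<oplus>\<^bsub>V i\<^esub> (- 1) \<odot>\<^bsub>V i\<^esub> v i = (1 + (- 1)) \<odot>\<^bsub>V i\<^esub> v i"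
        using Vi.smult_l_distr[of 1 "- 1" "v i"] Vi.smult_one[OF vi] vi by simp
      then show ?thesis using Vi.lmult_0[OF vi] by simp
    qed
    then have "v \<oplus>\<^bsub>vs_dsum I V\<^esub> ((- 1) \<odot>\<^bsub>vs_dsum I V\<^esub> v) = \<zero>\<^bsub>vs_dsum I V\<^esub>"
      by (auto simp: vs_dsum_def fun_eq_iff)
    then show "\<exists>neg_v\<in>carrier (vs_dsum I V). v \<oplus>\<^bsub>vs_dsum I V\<^esub> neg_v = \<zero>\<^bsub>vs_dsum I V\<^esub>"
      using sm[OF v] by blast
  qed
  have el: "v i \<in> carrier (V i)" if "v \<in> carrier (vs_dsum I V)" "i \<in> I" for v i
    using that by (auto simp: vs_dsum_def)
  have undef: "v i = undefined" if "v \<in> carrier (vs_dsum I V)" "i \<notin> I" for v i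
    using that by (auto simp: vs_dsum_def PiE_def extensional_def)
  have am: "abelian_monoid (V i)" if "i \<in> I" for i using ag[OF that] by (rule abelian_group.axioms(1))
  show "\<forall>v w. v \<in> carrier (vs_dsum I V) \<and> w \<in> carrier (vs_dsum I V) \<longrightarrow>
      v \<oplus>\<^bsub>vs_dsum I V\<^esub> w = w \<oplus>\<^bsub>vs_dsum I V\<^esub> v"
    using abelian_monoid.a_comm[OF am] el by (simp add: vs_dsum_def fun_eq_iff)
  show "\<forall>v w x. v \<in> carrier (vs_dsum I V) \<and> w \<in> carrier (vs_dsum I V) \<and> x \<in> carrier (vs_dsum I V) \<longrightarrow>
      v \<oplus>\<^bsub>vs_dsum I V\<^esub> w \<oplus>\<^bsub>vs_dsum I V\<^esub> x = v \<oplus>\<^bsub>vs_dsum I V\<^esub> (w \<oplus>\<^bsub>vs_dsum I V\<^esub> x)"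
    using abelian_monoid.a_assoc[OF am] el by (simp add: vs_dsum_def fun_eq_iff)
  show "\<forall>v\<in>carrier (vs_dsum I V). v \<oplus>\<^bsub>vs_dsum I V\<^esub> \<zero>\<^bsub>vs_dsum I V\<^esub> = v"
  proof (intro ballI ext)
    fix v i assume v: "v \<in> carrier (vs_dsum I V)"
    show "(v \<oplus>\<^bsub>vs_dsum I V\<^esub> \<zero>\<^bsub>vs_dsum I V\<^esub>) i = v i"
      using abelian_monoid.r_zero[OF am el[OF v]] undef[OF v, of i] by (cases "i \<in> I") (simp_all add: vs_dsum_def)
  qed
  show "\<forall>a b v. a \<in> carrier class_ring \<and> b \<in> carrier class_ring \<and> v \<in> carrier (vs_dsum I V) \<longrightarrow>
      (a \<otimes>\<^bsub>class_ring\<^esub> b) \<odot>\<^bsub>vs_dsum I V\<^esub> v = a \<odot>\<^bsub>vs_dsum I V\<^esub> (b \<odot>\<^bsub>vs_dsum I V\<^esub> v)"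
    using Module.module.smult_assoc1[OF m] el by (simp add: vs_dsum_def fun_eq_iff)
  show "\<forall>v\<in>carrier (vs_dsum I V). \<one>\<^bsub>class_ring\<^esub> \<odot>\<^bsub>vs_dsum I V\<^esub> v = v"
  proof (intro ballI ext)
    fix v i assume v: "v \<in> carrier (vs_dsum I V)"
    show "(\<one>\<^bsub>class_ring\<^esub> \<odot>\<^bsub>vs_dsum I V\<^esub> v) i = v i"
      using Module.module.smult_one[OF m el[OF v]] undef[OF v, of i] by (cases "i \<in> I") (simp_all add: vs_dsum_def)
  qed
  show "\<forall>a b v. a \<in> carrier class_ring \<and> b \<in> carrier class_ring \<and> v \<in> carrier (vs_dsum I V) \<longrightarrow>
      (a \<oplus>\<^bsub>class_ring\<^esub> b) \<odot>\<^bsub>vs_dsum I V\<^esub> v = a \<odot>\<^bsub>vs_dsum I V\<^esub> v \<oplus>\<^bsub>vs_dsum I V\<^esub> b \<odot>\<^bsub>vs_dsum I V\<^esub> v"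
    using Module.module.smult_l_distr[OF m] el by (simp add: vs_dsum_def fun_eq_iff)
  show "\<forall>a v w. a \<in> carrier class_ring \<and> v \<in> carrier (vs_dsum I V) \<and> w \<in> carrier (vs_dsum I V) \<longrightarrow>
      a \<odot>\<^bsub>vs_dsum I V\<^esub> (v \<oplus>\<^bsub>vs_dsum I V\<^esub> w) =
      a \<odot>\<^bsub>vs_dsum I V\<^esub> v \<oplus>\<^bsub>vs_dsum I V\<^esub> a \<odot>\<^bsub>vs_dsum I V\<^esub> w"
    using Module.module.smult_r_distr[OF m] el by (simp add: vs_dsum_def fun_eq_iff)
qed

section \<open>Strong exactness in coordinates\<close>

lemma persistence_moduleD:
  assumes "persistence_module M"
  shows "vectorspace class_ring (obj M t)"
    "s \<le> t \<Longrightarrow> linear_map class_ring (obj M s) (obj M t) (tr M s t)"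
    "v \<in> carrier (obj M t) \<Longrightarrow> tr M t t v = v"
    "r \<le> s \<Longrightarrow> s \<le> t \<Longrightarrow> v \<in> carrier (obj M r) \<Longrightarrow> tr M s t (tr M r s v) = tr M r t v"
  using assms by (auto simp: persistence_module_def)

lemma span_induct_carrier:
  fixes V :: "('k::field, 'v) module"
  assumes vs: "vectorspace (class_ring :: 'k ring) V" and S: "S \<subseteq> W" and W: "W \<subseteq> carrier V" "\<zero>\<^bsub>V\<^esub> \<in> W"
    "\<And>v w. v \<in> W \<Longrightarrow> w \<in> W \<Longrightarrow> v \<oplus>\<^bsub>V\<^esub> w \<in> W" "\<And>c v. v \<in> W \<Longrightarrow> c \<odot>\<^bsub>V\<^esub> v \<in> W"
  shows "vs_span V S \<subseteq> W"
proof (rule module.span_is_subset[OF vs_closed(5)[OF vs] S])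
  show "submodule class_ring W V"
    using vs_closed(5)[OF vs] W by (auto simp: submodule_def)
qed

text \<open>Each \<open>obj M t\<close> has its own operations on the same type. Coordinates turn
  all of them into subspaces of one function space, as \<open>pmod\<close> requires.\<close>

locale charted =
  fixes M :: "('p::order, 'k::field, 'v) pers_mod" and \<phi> :: "'p \<Rightarrow> 'v \<Rightarrow> 'v \<Rightarrow> 'k" and b :: "'p \<Rightarrow> 'v set"
  assumes pm: "persistence_module M" and fin_b: "finite (b t)" and co: "coordinates (obj M t) (\<phi> t) (b t)"
begin

definition space :: "'p \<Rightarrow> ('v \<Rightarrow> 'k) set" where
  "space t = fin_functions (b t)"

text \<open>Cutting off outside \<open>b t\<close> makes this linear and total on all functions: a
  projection onto \<open>space t\<close> followed by the inverse of \<phi>.\<close>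

definition vec_of :: "'p \<Rightarrow> ('v \<Rightarrow> 'k) \<Rightarrow> 'v" where
  "vec_of t f = inv_into (carrier (obj M t)) (\<phi> t) (\<lambda>x. if x \<in> b t then f x else 0)"

text \<open>The value 0 off the order relation keeps \<open>tmap s t\<close> linear for all
  \<open>s\<close> and \<open>t\<close>.\<close>

definition tmap :: "'p \<Rightarrow> 'p \<Rightarrow> ('v \<Rightarrow> 'k) \<Rightarrow> 'v \<Rightarrow> 'k" where
  "tmap s t f = (if s \<le> t then \<phi> t (tr M s t (vec_of s f)) else 0)"

lemmas vs = persistence_moduleD(1)[OF pm]
lemmas lin = persistence_moduleD(2)[OF pm]
lemmas \<phi>_add = coordinates_add[OF co]
lemmas \<phi>_smult = coordinates_smult[OF co]
lemmas \<phi>_inj = coordinates_inj[OF co]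

lemma \<phi>_in: "v \<in> carrier (obj M t) \<Longrightarrow> \<phi> t v \<in> space t"
  using coordinates_in[OF co] by (simp add: space_def)

lemma spaceE:
  assumes "f \<in> space t" obtains v where "v \<in> carrier (obj M t)" "\<phi> t v = f"
  using coordinates_surj[OF co] assms unfolding space_def by blast

lemma trunc_in: "(\<lambda>x. if x \<in> b t then f x else 0) \<in> space t"
  unfolding space_def fin_functions_finite[OF fin_b] by simp

lemma vec_of: "vec_of t f \<in> carrier (obj M t)" "\<phi> t (vec_of t f) = (\<lambda>x. if x \<in> b t then f x else 0)"
proof -
  have "(\<lambda>x. if x \<in> b t then f x else 0) \<in> \<phi> t ` carrier (obj M t)"
    using coordinates_bij[OF co[of t]] trunc_in[of t f] by (simp add: bij_betw_def space_def)
  then show "vec_of t f \<in> carrier (obj M t)" "\<phi> t (vec_of t f) = (\<lambda>x. if x \<in> b t then f x else 0)"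
    unfolding vec_of_def by (auto intro: inv_into_into f_inv_into_f)
qed

lemma vec_of_\<phi>: "v \<in> carrier (obj M t) \<Longrightarrow> vec_of t (\<phi> t v) = v"
proof (rule \<phi>_inj[OF vec_of(1)])
  assume v: "v \<in> carrier (obj M t)"
  have "(\<lambda>x. if x \<in> b t then \<phi> t v x else 0) = \<phi> t v"
    using \<phi>_in[OF v] unfolding space_def fin_functions_finite[OF fin_b] by auto
  then show "\<phi> t (vec_of t (\<phi> t v)) = \<phi> t v" using vec_of(2) by simp
qed

lemma tmap_\<phi>: "s \<le> t \<Longrightarrow> v \<in> carrier (obj M s) \<Longrightarrow> tmap s t (\<phi> s v) = \<phi> t (tr M s t v)"
  by (simp add: tmap_def vec_of_\<phi>)

lemma tr_in: "s \<le> t \<Longrightarrow> v \<in> carrier (obj M s) \<Longrightarrow> tr M s t v \<in> carrier (obj M t)"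
  using linear_mapD(1)[OF lin] .

lemma vec_of_add: "vec_of t (f + g) = vec_of t f \<oplus>\<^bsub>obj M t\<^esub> vec_of t g"
  by (rule \<phi>_inj[where t = t]) (auto simp: vec_of vs_closed(1)[OF vs] \<phi>_add fun_eq_iff)

lemma vec_of_scale: "vec_of t (fscale c f) = c \<odot>\<^bsub>obj M t\<^esub> vec_of t f"
  by (rule \<phi>_inj[where t = t]) (auto simp: vec_of vs_closed(2)[OF vs] \<phi>_smult fun_eq_iff fscale_def)

lemma space_span: "\<exists>A. finite A \<and> space t \<subseteq> fs.span A"
proof -
  let ?\<delta> = "\<lambda>x y. if y = x then 1 else 0 :: 'k"
  have "f \<in> fs.span (?\<delta> ` b t)" if "f \<in> space t" for f
  proof -
    have f0: "f y = 0" if "y \<notin> b t" for y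
      using \<open>f \<in> space t\<close> that unfolding space_def fin_functions_finite[OF fin_b] by simp
    have ap: "(\<Sum>x\<in>I. g x) y = (\<Sum>x\<in>I. g x y)" for I :: "'v set" and g :: "'v \<Rightarrow> 'v \<Rightarrow> 'k" and y
      by (induction I rule: infinite_finite_induct) auto
    have "f = (\<Sum>x\<in>b t. fscale (f x) (?\<delta> x))"
    proof
      fix y
      have "(\<Sum>x\<in>b t. fscale (f x) (?\<delta> x)) y = (\<Sum>x\<in>b t. if x = y then f x else 0)"
        unfolding ap by (intro sum.cong) (auto simp: fscale_def)
      then show "f y = (\<Sum>x\<in>b t. fscale (f x) (?\<delta> x)) y" using fin_b f0 by simp
    qed
    also have "\<dots> \<in> fs.span (?\<delta> ` b t)"
      by (intro fs.span_sum fs.span_scale fs.span_base) auto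
    finally show ?thesis .
  qed
  then show ?thesis using fin_b by (intro exI[of _ "?\<delta> ` b t"]) auto
qed

lemma pmod: "pmod fscale space tmap"
proof unfold_locales
  show "fs.subspace (space t)" for t unfolding space_def by (rule fin_functions_subspace)
  show "tmap s t (x + y) = tmap s t x + tmap s t y" for s t x y
    using linear_mapD(2)[OF lin, of s t] vec_of(1)
    by (simp add: tmap_def vec_of_add \<phi>_add tr_in)
  show "tmap s t (fscale c x) = fscale c (tmap s t x)" for s t c x
    using linear_mapD(3)[OF lin, of s t] vec_of(1)
    by (simp add: tmap_def vec_of_scale \<phi>_smult tr_in)
  show "tmap s t v \<in> space t" if "s \<le> t" "v \<in> space s" for s t v
    using that by (simp add: tmap_def \<phi>_in tr_in vec_of(1))
  show "tmap t t v = v" if v: "v \<in> space t" for t v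
    using v by (elim spaceE) (auto simp: tmap_\<phi> persistence_moduleD(3)[OF pm])
  show "tmap s t (tmap r s v) = tmap r t v" if "r \<le> s" "s \<le> t" and v: "v \<in> space r" for r s t v
    using v that by (elim spaceE) (auto simp: tmap_\<phi> persistence_moduleD(4)[OF pm] tr_in intro: order_trans)
  show "\<exists>A. finite A \<and> space t \<subseteq> fs.span A" for t by (rule space_span)
qed

sublocale pmod fscale space tmap by (rule pmod)

end

lemma pfd_charted:
  fixes M :: "('p::order, 'k::field, 'v) pers_mod"
  assumes "pfd_persistence_module M"
  obtains \<phi> b where "charted M \<phi> b"
proof -
  have pm: "persistence_module M" and fd: "\<And>t. vectorspace.fin_dim class_ring (obj M t)"
    using assms by (auto simp: pfd_persistence_module_def)
  have "\<exists>\<phi> b. finite b \<and> coordinates (obj M t) \<phi> (b :: 'v set)" for t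
    using exists_coordinates[OF persistence_moduleD(1)[OF pm] fd] by metis
  then obtain \<phi> and b :: "'p \<Rightarrow> 'v set" where "\<And>t. finite (b t)" "\<And>t. coordinates (obj M t) (\<phi> t) (b t)"
    by metis
  then have "charted M \<phi> b" using pm by (simp add: charted_def)
  then show ?thesis by (rule that)
qed

section \<open>Exact squares as lifting properties\<close>

lemma strongly_exact_2_lift:
  fixes N :: "(real^2, 'k::field, 'v) pers_mod"
  assumes ex: "strongly_exact_2 N" and xy: "x \<le> y"
    and p: "p = vector [x$1, y$2]" and q: "q = vector [y$1, x$2]"
    and lin: "linear_map class_ring (obj N x) (obj N p) (tr N x p)"
      "linear_map class_ring (obj N x) (obj N q) (tr N x q)"
      "linear_map class_ring (obj N p) (obj N y) (tr N p y)"
      "linear_map class_ring (obj N q) (obj N y) (tr N q y)"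
    and v: "v \<in> carrier (obj N p)" "w \<in> carrier (obj N q)" "tr N p y v = tr N q y w"
  shows "\<exists>u\<in>carrier (obj N x). tr N x p u = v \<and> tr N x q u = w"
proof -
  let ?d = "direct_sum (obj N p) (obj N q)"
  let ?f = "\<lambda>v. (tr N x p v, tr N x q v)"
  let ?g = "\<lambda>w. tr N p y (fst w) \<ominus>\<^bsub>obj N y\<^esub> tr N q y (snd w)"
  have vd: "vectorspace class_ring ?d" using linear_mapD(5)[OF lin(1)] linear_mapD(5)[OF lin(2)] by (rule direct_sum_is_vs)
  interpret Y: vectorspace "class_ring :: 'k ring" "obj N y" by (rule linear_mapD(5)[OF lin(3)])
  \<comment> \<open>The equations for \<open>mod_hom.im\<close> and \<open>mod_hom.ker\<close> are
    conditional on the maps being homomorphisms, so both maps of the sequence are shown to be linear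
    first.\<close>
  have f: "mod_hom class_ring (obj N x) ?d ?f"
    by (rule linear_mapD(6), rule linear_mapI)
      (use linear_mapD[OF lin(1)] linear_mapD[OF lin(2)] vd in \<open>auto simp: direct_sum_def\<close>)
  have g: "mod_hom class_ring ?d (obj N y) ?g"
  proof (rule linear_mapD(6), rule linear_mapI)
    show "vectorspace class_ring ?d" by (rule vd)
    show "vectorspace class_ring (obj N y)" by (rule linear_mapD(5)[OF lin(3)])
    show "?g v \<in> carrier (obj N y)" if "v \<in> carrier ?d" for v
      using that linear_mapD(1)[OF lin(3)] linear_mapD(1)[OF lin(4)] by (auto simp: direct_sum_def)
    show "?g (v \<oplus>\<^bsub>?d\<^esub> w) = ?g v \<oplus>\<^bsub>obj N y\<^esub> ?g w" if "v \<in> carrier ?d" "w \<in> carrier ?d" for v w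
      using that linear_mapD(1,2)[OF lin(3)] linear_mapD(1,2)[OF lin(4)]
      by (auto simp: direct_sum_def a_minus_def Y.minus_add Y.a_ac)
    show "?g (c \<odot>\<^bsub>?d\<^esub> v) = c \<odot>\<^bsub>obj N y\<^esub> ?g v" if "v \<in> carrier ?d" for c v
      using that linear_mapD(1,3)[OF lin(3)] linear_mapD(1,3)[OF lin(4)]
      by (auto simp: direct_sum_def a_minus_def Y.smult_r_distr Y.smult_r_minus)
  qed
  have "mod_hom.im (obj N x) ?f = mod_hom.ker ?d (obj N y) ?g"
    using ex[unfolded strongly_exact_2_def, rule_format, OF xy] by (simp only: Let_def p q)
  then have im: "?f ` carrier (obj N x) = {w \<in> carrier ?d. ?g w = \<zero>\<^bsub>obj N y\<^esub>}"
    unfolding mod_hom.im_def[OF f] mod_hom.ker_def[OF g] .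
  have "(v, w) \<in> {w \<in> carrier ?d. ?g w = \<zero>\<^bsub>obj N y\<^esub>}"
    using v linear_mapD(1)[OF lin(4)] by (auto simp: direct_sum_def a_minus_def Y.r_neg)
  then show ?thesis unfolding im[symmetric] by auto
qed

lemma upd_vector3 [simp]:
  "upd (x::real^3) 1 a = vector [a, x$2, x$3]" "upd x 2 a = vector [x$1, a, x$3]" "upd x 3 a = vector [x$1, x$2, a]"
  by (auto simp: cvec_eq_iff forall_3)

lemma strongly_exact_3_square:
  fixes M :: "(real^3, 'k::field, 'v) pers_mod"
  assumes pm: "persistence_module M" and ex: "strongly_exact_3 M"
    and ij: "i \<noteq> j" and xa: "x$i \<le> a" and xb: "x$j \<le> b'"
    and p: "p \<in> carrier (obj M (upd x i a))" and q: "q \<in> carrier (obj M (upd x j b'))"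
    and eq: "tr M (upd x i a) (upd (upd x i a) j b') p = tr M (upd x j b') (upd (upd x i a) j b') q"
  shows "\<exists>w\<in>carrier (obj M x). tr M x (upd x i a) w = p \<and> tr M x (upd x j b') w = q"
proof -
  have lin: "s \<le> t \<Longrightarrow> linear_map class_ring (obj M s) (obj M t) (tr M s t)" for s t
    using persistence_moduleD(2)[OF pm] .
  have main: "\<exists>w\<in>carrier (obj M x). tr M x (upd x k c) w = v \<and> tr M x (upd x l d) w = u"
    if kl: "(k, l) \<in> {(1, 2), (1, 3), (2, 3)}" and le: "x$k \<le> c" "x$l \<le> d"
      and vu: "v \<in> carrier (obj M (upd x k c))" "u \<in> carrier (obj M (upd x l d))"
        "tr M (upd x k c) (upd (upd x k c) l d) v = tr M (upd x l d) (upd (upd x k c) l d) u"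
    for k l :: 3 and c d v u
  proof -
    define z where "z = (\<lambda>a::real^2. upd (upd x k (a$1)) l (a$2))"
    have kl': "k \<noteq> l" using kl by auto
    have "strongly_exact_2 (reindex z M)"
    proof -
      \<comment> \<open>For these index pairs \<open>z\<close> is literally one of the three plane
        embeddings in the definition; the opposite orders follow by symmetry.\<close>
      have "z = (\<lambda>a. vector [a$1, a$2, x$3]) \<or> z = (\<lambda>a. vector [a$1, x$2, a$2]) \<or> z = (\<lambda>a. vector [x$1, a$1, a$2])"
        using kl unfolding z_def by auto
      moreover have "strongly_exact_2 (reindex (\<lambda>a. vector [r, a$1, a$2]) M)"
        "strongly_exact_2 (reindex (\<lambda>a. vector [a$1, r, a$2]) M)"
        "strongly_exact_2 (reindex (\<lambda>a. vector [a$1, a$2, r]) M)" for r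
        using ex by (simp_all add: strongly_exact_3_def)
      ultimately show ?thesis by (elim disjE) simp_all
    qed
    moreover have "(vector [x$k, x$l] :: real^2) \<le> vector [c, d]"
      using le by (auto simp: cvec_le_iff forall_2)
    moreover have z: "z (vector [x$k, x$l]) = x" "z (vector [c, x$l]) = upd x k c"
      "z (vector [x$k, d]) = upd x l d" "z (vector [c, d]) = upd (upd x k c) l d"
      using kl' unfolding z_def by (simp_all add: cvec_eq_iff del: upd_vector3)
    have le': "x \<le> upd x k c" "x \<le> upd x l d" "upd x k c \<le> upd (upd x k c) l d" "upd x l d \<le> upd (upd x k c) l d"
      using le kl' by (simp_all add: cvec_le_iff del: upd_vector3)
    ultimately have "\<exists>w\<in>carrier (obj M x). tr M x (upd x l d) w = u \<and> tr M x (upd x k c) w = v"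
      using strongly_exact_2_lift[of "reindex z M" "vector [x$k, x$l]" "vector [c, d]"
          "vector [x$k, d]" "vector [c, x$l]" u v] lin vu
      unfolding reindex_def pers_mod.simps vector_2 z by (simp del: upd_vector3)
    then show ?thesis by blast
  qed
  have "(i, j) \<in> {(1, 2), (1, 3), (2, 3)} \<or> (j, i) \<in> {(1, 2), (1, 3), (2, 3)}"
    using ij exhaust_3[of i] exhaust_3[of j] by auto
  then show ?thesis
  proof
    assume "(i, j) \<in> {(1, 2), (1, 3), (2, 3)}"
    then show ?thesis using main[OF _ xa xb p q eq] by blast
  next
    assume "(j, i) \<in> {(1, 2), (1, 3), (2, 3)}"
    moreover have "upd (upd x j b') i a = upd (upd x i a) j b'" using ij by (simp add: upd_commute del: upd_vector3)
    ultimately show ?thesis using main[OF _ xb xa q p] eq by (metis (no_types, lifting))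
  qed
qed

section \<open>The limit of the punctured cube\<close>

lemma cube_vertex_mono: "x \<le> y \<Longrightarrow> S \<subseteq> T \<Longrightarrow> cube_vertex x y S \<le> cube_vertex x y T"
  by (auto simp: cube_vertex_def cvec_le_iff)

lemma cube_simps [simp]:
  "obj (cube x y M) T = obj M (cube_vertex x y T)"
  "tr (cube x y M) S T = tr M (cube_vertex x y S) (cube_vertex x y T)"
  by (simp_all add: cube_def reindex_def)

lemma strongly_exact_3_cube:
  fixes M :: "(real^3, 'k::field, 'v) pers_mod"
  assumes pm: "persistence_module M" and ex: "strongly_exact_3 M"
    and ijk: "i \<noteq> j" "i \<noteq> k" "j \<noteq> k" and le: "x$i \<le> a" "x$j \<le> b" "x$k \<le> c"
    and g: "g \<in> carrier (obj M (upd x k c))"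
    and gi: "tr M (upd x k c) (upd (upd x k c) i a) g = \<zero>\<^bsub>obj M (upd (upd x k c) i a)\<^esub>"
    and gj: "tr M (upd x k c) (upd (upd x k c) j b) g = \<zero>\<^bsub>obj M (upd (upd x k c) j b)\<^esub>"
  shows "\<exists>w\<in>carrier (obj M x). tr M x (upd x k c) w = g \<and>
    tr M x (upd x i a) w = \<zero>\<^bsub>obj M (upd x i a)\<^esub> \<and> tr M x (upd x j b) w = \<zero>\<^bsub>obj M (upd x j b)\<^esub>"
proof -
  define y where "y = upd (upd (upd x i a) j b) k c"
  define z where "z = cube_vertex x y"
  have xy: "x \<le> y" using le ijk by (simp add: y_def cvec_le_iff del: upd_vector3)
  have z: "z {} = x" "z {k} = upd x k c" "z {i} = upd x i a" "z {j} = upd x j b"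
    "z {k, i} = upd (upd x k c) i a" "z {k, j} = upd (upd x k c) j b"
    using ijk unfolding z_def y_def by (auto simp: cube_vertex_def cvec_eq_iff simp del: upd_vector3)
  have mono: "S \<subseteq> T \<Longrightarrow> z S \<le> z T" for S T unfolding z_def using cube_vertex_mono[OF xy] .
  have zero: "tr M (z S) (z T) \<zero>\<^bsub>obj M (z S)\<^esub> = \<zero>\<^bsub>obj M (z T)\<^esub>" if "S \<subseteq> T" for S T
    using linear_map_zero[OF persistence_moduleD(2)[OF pm mono[OF that]]] .
  \<comment> \<open>Compatible because every vertex strictly above \<open>{k}\<close> contains
    \<open>i\<close> or \<open>j\<close>, and \<open>g\<close> dies in both of these
    directions.\<close>
  define F where "F = (\<lambda>T\<in>{T. T \<noteq> {}}. if T = {k} then g else \<zero>\<^bsub>obj M (z T)\<^esub>)"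
  have kill: "tr M (z {k}) (z T) g = \<zero>\<^bsub>obj M (z T)\<^esub>" if "l \<in> {i, j}" "l \<in> T" "k \<in> T" for l T
  proof -
    have "tr M (z {k}) (z {k, l}) g = \<zero>\<^bsub>obj M (z {k, l})\<^esub>" using that(1) gi gj z by auto
    moreover have "tr M (z {k}) (z T) g = tr M (z {k, l}) (z T) (tr M (z {k}) (z {k, l}) g)"
      using persistence_moduleD(4)[OF pm mono mono, of "{k}" "{k, l}" T g] that g z(2) by simp
    ultimately show ?thesis using zero[of "{k, l}" T] that by simp
  qed
  have "F \<in> carrier (pm_limit {T. T \<noteq> {}} (cube x y M))"
    unfolding pm_limit_def
  proof (simp, intro conjI allI impI)
    show "F \<in> (\<Pi>\<^sub>E t\<in>{T. T \<noteq> {}}. carrier (obj M (cube_vertex x y t)))"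
      using vs_closed(3)[OF persistence_moduleD(1)[OF pm]] g z(2) by (auto simp: F_def z_def)
    fix S T :: "3 set" assume S: "S \<noteq> {}" and T: "T \<noteq> {}" and ST: "S \<subseteq> T"
    show "tr M (cube_vertex x y S) (cube_vertex x y T) (F S) = F T"
    proof (cases "S = {k}")
      case False
      then have "T \<noteq> {k}" using S ST by blast
      then show ?thesis using False S T zero[OF ST] by (simp add: F_def z_def)
    next
      case S_k: True
      show ?thesis
      proof (cases "T = {k}")
        case True
        then show ?thesis using S_k g z(2) persistence_moduleD(3)[OF pm] by (simp add: F_def z_def)
      next
        case False
        then obtain l where l: "l \<in> T" "l \<noteq> k" using S_k ST by blast
        have "l \<in> {i, j}" using l(2) ijk exhaust_3[of l] exhaust_3[of i] exhaust_3[of j] exhaust_3[of k] by auto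
        then show ?thesis using kill[OF _ l(1)] S_k ST False T by (simp add: F_def z_def)
      qed
    qed
  qed
  moreover have "to_limit {} {T. T \<noteq> {}} (cube x y M) ` carrier (obj (cube x y M) {}) =
        carrier (pm_limit {T. T \<noteq> {}} (cube x y M))"
    using ex xy unfolding strongly_exact_3_def by blast
  ultimately have "F \<in> to_limit {} {T. T \<noteq> {}} (cube x y M) ` carrier (obj (cube x y M) {})" by simp
  then obtain w where w: "w \<in> carrier (obj M x)" "F = to_limit {} {T. T \<noteq> {}} (cube x y M) w"
    using z(1) by (auto simp: z_def)
  have ev: "tr M x (z T) w = (if T = {k} then g else \<zero>\<^bsub>obj M (z T)\<^esub>)" if "T \<noteq> {}" for T
    using fun_cong[OF w(2), of T] that z(1) by (simp add: F_def to_limit_def z_def)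
  show ?thesis using ev[of "{k}"] ev[of "{i}"] ev[of "{j}"] z ijk w(1) by (intro bexI[of _ w]) auto
qed

section \<open>The colimit of the cube without its top\<close>

locale charted3 = charted M \<phi> b
  for M :: "(real^3, 'k::field, 'v) pers_mod" and \<phi> b +
  fixes x y :: "real^3" assumes xy: "x \<le> y"
begin

abbreviation z :: "3 set \<Rightarrow> real^3" where "z \<equiv> cube_vertex x y"
abbreviation D :: "3 set set" where "D \<equiv> {T. T \<noteq> UNIV}"
abbreviation V :: "('k, 3 set \<Rightarrow> 'v) module" where "V \<equiv> vs_dsum D (obj (cube x y M))"
abbreviation rel :: "(3 set \<Rightarrow> 'v) set" where "rel \<equiv> colimit_rel D (cube x y M)"

lemmas z_mono = cube_vertex_mono[OF xy]

lemma vs_V: "vectorspace class_ring V"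
  by (rule vectorspace_vs_dsum) (simp add: vs)

text \<open>Pushing all components below \<open>U\<close> to the vertex \<open>U\<close>. For \<open>U = UNIV\<close> this is the map out of
  the colimit; for \<open>U = {i, j}\<close> it kills the relations of the colimit up to the images of the
  vertices \<open>{i}\<close> and \<open>{j}\<close>, which isolates the component at \<open>{i, j}\<close>.\<close>

definition collapse :: "3 set \<Rightarrow> (3 set \<Rightarrow> 'v) \<Rightarrow> 'v \<Rightarrow> 'k" where
  "collapse U f = (\<Sum>T\<in>{T \<in> D. T \<subseteq> U}. tmap (z T) (z U) (\<phi> (z T) (f T)))"

lemma V_elem: "f \<in> carrier V \<Longrightarrow> T \<in> D \<Longrightarrow> f T \<in> carrier (obj M (z T))"
  by (auto simp: vs_dsum_def)

lemma collapse_add: "f \<in> carrier V \<Longrightarrow> g \<in> carrier V \<Longrightarrow> collapse U (f \<oplus>\<^bsub>V\<^esub> g) = collapse U f + collapse U g"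
  unfolding collapse_def sum.distrib[symmetric]
  by (intro sum.cong) (auto simp: V_elem \<phi>_add T_add[symmetric] vs_dsum_def intro!: arg_cong[where f = "tmap _ _"])

lemma collapse_smult: "f \<in> carrier V \<Longrightarrow> collapse U (c \<odot>\<^bsub>V\<^esub> f) = fscale c (collapse U f)"
  unfolding collapse_def fs.scale_sum_right
  by (intro sum.cong) (auto simp: V_elem \<phi>_smult T_scale[symmetric] vs_dsum_def intro!: arg_cong[where f = "tmap _ _"])

lemma \<phi>_zero: "\<phi> t \<zero>\<^bsub>obj M t\<^esub> = 0"
  by (rule coordinates_zero[OF co vs])

lemma collapse_zero: "collapse U \<zero>\<^bsub>V\<^esub> = 0"
  unfolding collapse_def by (intro sum.neutral) (auto simp: vs_dsum_def \<phi>_zero T_0)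

lemma collapse_minus:
  assumes "f \<in> carrier V" "g \<in> carrier V" shows "collapse U (f \<ominus>\<^bsub>V\<^esub> g) = collapse U f - collapse U g"
proof -
  interpret V: vectorspace "class_ring :: 'k ring" V by (rule vs_V)
  have "(f \<ominus>\<^bsub>V\<^esub> g) \<oplus>\<^bsub>V\<^esub> g = f" using assms by (simp add: a_minus_def V.a_assoc V.l_neg)
  then have "collapse U (f \<ominus>\<^bsub>V\<^esub> g) + collapse U g = collapse U f"
    using collapse_add[of "f \<ominus>\<^bsub>V\<^esub> g" g U] assms by simp
  then show ?thesis by (simp add: algebra_simps)
qed

abbreviation dinj :: "3 set \<Rightarrow> 'v \<Rightarrow> 3 set \<Rightarrow> 'v" where "dinj \<equiv> dsum_inj D (obj (cube x y M))"

lemma dinj_in: "v \<in> carrier (obj M (z S)) \<Longrightarrow> dinj S v \<in> carrier V"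
  using vs_closed(3)[OF vs] by (auto simp: vs_dsum_def dsum_inj_def)

lemma collapse_dinj:
  assumes "S \<in> D" "v \<in> carrier (obj M (z S))"
  shows "collapse U (dinj S v) = (if S \<subseteq> U then tmap (z S) (z U) (\<phi> (z S) v) else 0)"
proof -
  have "collapse U (dinj S v) = (\<Sum>T\<in>{T \<in> D. T \<subseteq> U}. if T = S then tmap (z S) (z U) (\<phi> (z S) v) else 0)"
    unfolding collapse_def by (intro sum.cong) (auto simp: dsum_inj_def \<phi>_zero T_0)
  also have "\<dots> = (if S \<subseteq> U then tmap (z S) (z U) (\<phi> (z S) v) else 0)"
    using assms(1) by (subst sum.delta) auto
  finally show ?thesis .
qed

text \<open>A relation from \<open>S\<close> to \<open>T\<close> cancels if \<open>T\<close> lies in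
  \<open>U\<close> and contributes nothing if \<open>S\<close> does not. Only relations that leave
  \<open>U\<close> remain, and \<open>gen\<close> places them in \<open>W\<close>.\<close>

lemma collapse_rel:
  assumes W: "fs.subspace W" and f: "f \<in> rel"
    and gen: "\<And>S T v. S \<subseteq> U \<Longrightarrow> S \<subseteq> T \<Longrightarrow> T \<noteq> UNIV \<Longrightarrow> \<not> T \<subseteq> U \<Longrightarrow> v \<in> carrier (obj M (z S)) \<Longrightarrow>
      tmap (z S) (z U) (\<phi> (z S) v) \<in> W"
  shows "f \<in> carrier V \<and> collapse U f \<in> W"
proof -
  let ?W = "{f \<in> carrier V. collapse U f \<in> W}"
  have "rel \<subseteq> ?W" unfolding colimit_rel_def
  proof (rule span_induct_carrier[OF vs_V])
    show "{dinj S v \<ominus>\<^bsub>V\<^esub> dinj T (tr (cube x y M) S T v) |S T v.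
        S \<in> D \<and> T \<in> D \<and> S \<le> T \<and> v \<in> carrier (obj (cube x y M) S)} \<subseteq> ?W"
    proof clarify
      fix S T :: "3 set" and v
      assume ST: "S \<noteq> UNIV" "T \<noteq> UNIV" "S \<subseteq> T" and "v \<in> carrier (obj (cube x y M) S)"
      then have v: "v \<in> carrier (obj M (z S))" by simp
      have tv: "tr M (z S) (z T) v \<in> carrier (obj M (z T))" using tr_in[OF z_mono[OF ST(3)] v] .
      have "collapse U (dinj S v \<ominus>\<^bsub>V\<^esub> dinj T (tr M (z S) (z T) v)) =
        (if S \<subseteq> U then tmap (z S) (z U) (\<phi> (z S) v) else 0) -
        (if T \<subseteq> U then tmap (z T) (z U) (\<phi> (z T) (tr M (z S) (z T) v)) else 0)"
        using collapse_minus[OF dinj_in[OF v] dinj_in[OF tv]] collapse_dinj v tv ST by simp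
      also have "\<dots> \<in> W"
      proof (cases "T \<subseteq> U")
        case True
        then have "tmap (z T) (z U) (\<phi> (z T) (tr M (z S) (z T) v)) = tmap (z S) (z U) (\<phi> (z S) v)"
          using T_comp[OF z_mono[OF ST(3)] z_mono[OF True] \<phi>_in[OF v]] tmap_\<phi>[OF z_mono[OF ST(3)] v] by simp
        then show ?thesis using True ST(3) fs.subspace_0[OF W] by auto
      next
        case False
        then show ?thesis using gen[of S T v] ST v fs.subspace_0[OF W] by simp
      qed
      finally show "dinj S v \<ominus>\<^bsub>V\<^esub> dinj T (tr (cube x y M) S T v) \<in> carrier V \<and>
          collapse U (dinj S v \<ominus>\<^bsub>V\<^esub> dinj T (tr (cube x y M) S T v)) \<in> W"
        using vs_closed(6)[OF vs_V dinj_in[OF v] dinj_in[OF tv]] by simp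
    qed
    show "\<zero>\<^bsub>V\<^esub> \<in> ?W" using vs_closed(3)[OF vs_V] fs.subspace_0[OF W] by (simp add: collapse_zero)
    show "f \<oplus>\<^bsub>V\<^esub> g \<in> ?W" if "f \<in> ?W" "g \<in> ?W" for f g
      using that vs_closed(1)[OF vs_V] fs.subspace_add[OF W] by (simp add: collapse_add)
    show "c \<odot>\<^bsub>V\<^esub> f \<in> ?W" if "f \<in> ?W" for c f
      using that vs_closed(2)[OF vs_V] fs.subspace_scale[OF W] by (simp add: collapse_smult)
  qed blast
  then show ?thesis using f by blast
qed

lemma z_UNIV: "z UNIV = y"
  by (simp add: cube_vertex_def cvec_eq_iff)

lemma \<phi>_push:
  assumes f: "f \<in> carrier V"
  defines "P \<equiv> \<Oplus>\<^bsub>obj (cube x y M) UNIV\<^esub> T\<in>{T \<in> D. f T \<noteq> \<zero>\<^bsub>obj (cube x y M) T\<^esub>}. tr (cube x y M) T UNIV (f T)"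
  shows "P \<in> carrier (obj M y) \<and> \<phi> y P = collapse UNIV f"
proof -
  let ?X = "{T \<in> D. f T \<noteq> \<zero>\<^bsub>obj M (z T)\<^esub>}"
  have el: "tr M (z T) y (f T) \<in> carrier (obj M y)" if "T \<in> D" for T
    using tr_in[OF z_mono[of T UNIV] V_elem[OF f that]] z_UNIV by simp
  interpret Y: vectorspace "class_ring :: 'k ring" "obj M y" by (rule vs)
  have P: "P = (\<Oplus>\<^bsub>obj M y\<^esub> T\<in>?X. tr M (z T) y (f T))" by (simp add: P_def z_UNIV)
  have "P \<in> carrier (obj M y)" unfolding P by (rule Y.finsum_closed) (use el in auto)
  moreover have "\<phi> y P = (\<Sum>T\<in>?X. \<phi> y (tr M (z T) y (f T)))"
    unfolding P by (rule coordinates_finsum[OF co vs]) (use el in auto)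
  moreover have "\<dots> = (\<Sum>T\<in>{T \<in> D. T \<subseteq> UNIV}. tmap (z T) y (\<phi> (z T) (f T)))"
  proof (rule sum.mono_neutral_cong_left)
    show "\<forall>T\<in>{T \<in> D. T \<subseteq> UNIV} - ?X. tmap (z T) y (\<phi> (z T) (f T)) = 0"
      by (auto simp: \<phi>_zero T_0)
    show "\<phi> y (tr M (z T) y (f T)) = tmap (z T) y (\<phi> (z T) (f T))" if "T \<in> ?X" for T
      using tmap_\<phi>[of "z T" y "f T"] V_elem[OF f] that z_mono[of T UNIV] z_UNIV by simp
  qed auto
  ultimately show ?thesis by (simp add: collapse_def z_UNIV)
qed

lemma rel_subgroup: "rel \<subseteq> carrier V" "\<zero>\<^bsub>V\<^esub> \<in> rel"
proof -
  show "rel \<subseteq> carrier V" using collapse_rel[of UNIV] fs.subspace_UNIV by blast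
  let ?G = "{dinj S v \<ominus>\<^bsub>V\<^esub> dinj T (tr (cube x y M) S T v) |S T v.
        S \<in> D \<and> T \<in> D \<and> S \<le> T \<and> v \<in> carrier (obj (cube x y M) S)}"
  interpret V: vectorspace "class_ring :: 'k ring" V by (rule vs_V)
  have "V.lincomb (\<lambda>_. 0) {} \<in> V.span ?G" unfolding V.span_def by blast
  then show "\<zero>\<^bsub>V\<^esub> \<in> rel" unfolding colimit_rel_def by (simp add: V.lincomb_def)
qed

text \<open>The relations collapse to 0 at the top vertex, so the sum is the same for every
  representative and \<open>the_elem\<close> picks that common value.\<close>

lemma from_colimit_coset:
  assumes f: "f \<in> carrier V"
  shows "\<phi> y (from_colimit D UNIV (cube x y M) (rel +>\<^bsub>V\<^esub> f)) = collapse UNIV f"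
    "from_colimit D UNIV (cube x y M) (rel +>\<^bsub>V\<^esub> f) \<in> carrier (obj M y)"
proof -
  let ?P = "\<lambda>f. \<Oplus>\<^bsub>obj (cube x y M) UNIV\<^esub> T\<in>{T \<in> D. f T \<noteq> \<zero>\<^bsub>obj (cube x y M) T\<^esub>}. tr (cube x y M) T UNIV (f T)"
  have "?P f' = ?P f" if f': "f' \<in> rel +>\<^bsub>V\<^esub> f" for f'
  proof -
    obtain r where r: "r \<in> rel" "f' = r \<oplus>\<^bsub>V\<^esub> f" using f' by (auto simp: a_r_coset_def')
    have "r \<in> carrier V \<and> collapse UNIV r \<in> {0}"
      by (rule collapse_rel[OF fs.subspace_single_0 r(1)]) auto
    then have "f' \<in> carrier V \<and> collapse UNIV f' = collapse UNIV f"
      using r(2) f vs_closed(1)[OF vs_V] by (simp add: collapse_add)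
    then show ?thesis using \<phi>_push[of f'] \<phi>_push[OF f] by (intro \<phi>_inj[where t = y]) auto
  qed
  moreover have "f \<in> rel +>\<^bsub>V\<^esub> f"
  proof -
    interpret V: vectorspace "class_ring :: 'k ring" V by (rule vs_V)
    have "f = \<zero>\<^bsub>V\<^esub> \<oplus>\<^bsub>V\<^esub> f" using f by simp
    then show ?thesis using rel_subgroup(2) by (auto simp: a_r_coset_def')
  qed
  ultimately have "?P ` (rel +>\<^bsub>V\<^esub> f) = {?P f}" by blast
  then have "from_colimit D UNIV (cube x y M) (rel +>\<^bsub>V\<^esub> f) = ?P f" by (simp add: from_colimit_def)
  then show "\<phi> y (from_colimit D UNIV (cube x y M) (rel +>\<^bsub>V\<^esub> f)) = collapse UNIV f"
    "from_colimit D UNIV (cube x y M) (rel +>\<^bsub>V\<^esub> f) \<in> carrier (obj M y)"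
    using \<phi>_push[OF f] by simp_all
qed

text \<open>Injectivity in terms of representatives: the classes of \<open>f\<close> and of 0 have
  the same image, hence coincide.\<close>

lemma collapse_zero_rel:
  assumes ex: "inj_on (from_colimit D UNIV (cube x y M)) (carrier (pm_colimit D (cube x y M)))"
    and f: "f \<in> carrier V" and 0: "collapse UNIV f = 0"
  shows "f \<in> rel"
proof -
  interpret V: vectorspace "class_ring :: 'k ring" V by (rule vs_V)
  have car: "rel +>\<^bsub>V\<^esub> h \<in> carrier (pm_colimit D (cube x y M))" if "h \<in> carrier V" for h
    using that by (auto simp: pm_colimit_def vs_quot_def A_RCOSETS_def RCOSETS_def a_r_coset_def)
  have "from_colimit D UNIV (cube x y M) (rel +>\<^bsub>V\<^esub> f) = from_colimit D UNIV (cube x y M) (rel +>\<^bsub>V\<^esub> \<zero>\<^bsub>V\<^esub>)"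
    using from_colimit_coset[OF f] from_colimit_coset[of "\<zero>\<^bsub>V\<^esub>"] 0 collapse_zero
    by (intro \<phi>_inj[where t = y]) auto
  then have "rel +>\<^bsub>V\<^esub> f = rel +>\<^bsub>V\<^esub> \<zero>\<^bsub>V\<^esub>" using inj_onD[OF ex] car f by simp
  moreover have "f \<in> rel +>\<^bsub>V\<^esub> f" using rel_subgroup(2) f by (force simp: a_r_coset_def')
  moreover have "rel +>\<^bsub>V\<^esub> \<zero>\<^bsub>V\<^esub> = rel" using rel_subgroup(1) by (force simp: a_r_coset_def')
  ultimately show ?thesis by simp
qed

text \<open>The family with entries \<open>w\<close>, \<open>- p\<close>, \<open>- q\<close> at the
  vertices \<open>{i, j}\<close>, \<open>{j, k}\<close>, \<open>{i, k}\<close> goes to 0 at the top,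
  so it lies in the span of the relations. Collapsing it to \<open>{i, j}\<close> leaves
  \<open>w\<close> on one side and images from \<open>{i}\<close> and \<open>{j}\<close> on the
  other.\<close>

lemma colift:
  assumes ex: "inj_on (from_colimit D UNIV (cube x y M)) (carrier (pm_colimit D (cube x y M)))"
    and ijk: "i \<noteq> j" "i \<noteq> k" "j \<noteq> k"
    and w: "w \<in> space (z {i, j})" and p: "p \<in> space (z {j, k})" and q: "q \<in> space (z {i, k})"
    and eq: "tmap (z {i, j}) y w = tmap (z {j, k}) y p + tmap (z {i, k}) y q"
  shows "\<exists>r\<in>space (z {j}). \<exists>r'\<in>space (z {i}). w = tmap (z {j}) (z {i, j}) r + tmap (z {i}) (z {i, j}) r'"
proof -
  have three: "l = i \<or> l = j \<or> l = k" for l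
    using ijk exhaust_3[of l] exhaust_3[of i] exhaust_3[of j] exhaust_3[of k] by auto
  have "k \<notin> {i, j}" "i \<notin> {j, k}" "j \<notin> {i, k}" using ijk by auto
  then have inD: "{i, j} \<in> D" "{j, k} \<in> D" "{i, k} \<in> D" by (metis UNIV_I mem_Collect_eq)+
  obtain w' where w': "w' \<in> carrier (obj M (z {i, j}))" "\<phi> (z {i, j}) w' = w" using w by (rule spaceE)
  obtain p' where p': "p' \<in> carrier (obj M (z {j, k}))" "\<phi> (z {j, k}) p' = - p"
    using fs.subspace_neg[OF sub_E p] by (rule spaceE)
  obtain q' where q': "q' \<in> carrier (obj M (z {i, k}))" "\<phi> (z {i, k}) q' = - q"
    using fs.subspace_neg[OF sub_E q] by (rule spaceE)
  define f where "f = dinj {i, j} w' \<oplus>\<^bsub>V\<^esub> (dinj {j, k} p' \<oplus>\<^bsub>V\<^esub> dinj {i, k} q')"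
  note el = dinj_in[OF w'(1)] dinj_in[OF p'(1)] dinj_in[OF q'(1)]
  have f: "f \<in> carrier V" unfolding f_def using el vs_closed(1)[OF vs_V] by simp
  have col: "collapse U f = (if {i, j} \<subseteq> U then tmap (z {i, j}) (z U) w else 0) +
    ((if {j, k} \<subseteq> U then tmap (z {j, k}) (z U) (- p) else 0) + (if {i, k} \<subseteq> U then tmap (z {i, k}) (z U) (- q) else 0))" for U
    unfolding f_def using el vs_closed(1)[OF vs_V] collapse_dinj[OF inD(1) w'(1)] collapse_dinj[OF inD(2) p'(1)]
      collapse_dinj[OF inD(3) q'(1)] w'(2) p'(2) q'(2) by (simp add: collapse_add)
  have "collapse UNIV f = 0" unfolding col using eq by (simp add: z_UNIV T_neg)
  then have fr: "f \<in> rel" by (rule collapse_zero_rel[OF ex f])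
  let ?W = "{r + r' | r r'. r \<in> tmap (z {j}) (z {i, j}) ` space (z {j}) \<and> r' \<in> tmap (z {i}) (z {i, j}) ` space (z {i})}"
  have W: "fs.subspace ?W" by (intro fs.subspace_sums subspace_T_image sub_E)
  have "collapse {i, j} f \<in> ?W"
  proof (rule collapse_rel[OF W fr, THEN conjunct2])
    fix S T v
    assume S: "S \<subseteq> {i, j}" "S \<subseteq> T" and T: "T \<noteq> UNIV" "\<not> T \<subseteq> {i, j}" and v: "v \<in> carrier (obj M (z S))"
    \<comment> \<open>If \<open>S\<close> contained both \<open>i\<close> and \<open>j\<close>, then
      \<open>T\<close>, which is not inside \<open>{i, j}\<close>, would contain all three
      directions; but the top vertex is excluded.\<close>
    have "S \<subseteq> {i} \<or> S \<subseteq> {j}"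
    proof (rule ccontr)
      assume "\<not> (S \<subseteq> {i} \<or> S \<subseteq> {j})"
      then have "i \<in> T" "j \<in> T" using S by auto
      moreover have "k \<in> T" using T(2) three by blast
      ultimately have "l \<in> T" for l using three[of l] by auto
      then show False using T(1) by blast
    qed
    then show "tmap (z S) (z {i, j}) (\<phi> (z S) v) \<in> ?W"
    proof
      assume s: "S \<subseteq> {i}"
      have "tmap (z S) (z {i, j}) (\<phi> (z S) v) = 0 + tmap (z {i}) (z {i, j}) (tmap (z S) (z {i}) (\<phi> (z S) v))"
        using T_comp[OF z_mono[OF s] z_mono \<phi>_in[OF v], of "{i, j}"] by simp
      moreover have "tmap (z S) (z {i}) (\<phi> (z S) v) \<in> space (z {i})" using T_in[OF z_mono[OF s] \<phi>_in[OF v]] .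
      moreover have "0 \<in> tmap (z {j}) (z {i, j}) ` space (z {j})"
        using fs.subspace_0[OF subspace_T_image[OF sub_E]] .
      ultimately show ?thesis by blast
    next
      assume s: "S \<subseteq> {j}"
      have "tmap (z S) (z {i, j}) (\<phi> (z S) v) = tmap (z {j}) (z {i, j}) (tmap (z S) (z {j}) (\<phi> (z S) v)) + 0"
        using T_comp[OF z_mono[OF s] z_mono \<phi>_in[OF v], of "{i, j}"] by simp
      moreover have "tmap (z S) (z {j}) (\<phi> (z S) v) \<in> space (z {j})" using T_in[OF z_mono[OF s] \<phi>_in[OF v]] .
      moreover have "0 \<in> tmap (z {i}) (z {i, j}) ` space (z {i})"
        using fs.subspace_0[OF subspace_T_image[OF sub_E]] .
      ultimately show ?thesis by blast
    qed
  qed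
  moreover have "\<not> {j, k} \<subseteq> {i, j}" "\<not> {i, k} \<subseteq> {i, j}" using ijk by auto
  then have "collapse {i, j} f = w" unfolding col using T_id[OF w] by simp
  ultimately show ?thesis by blast
qed

end

theorem charted_exact:
  fixes M :: "(real^3, 'k::field, 'v) pers_mod"
  assumes ch: "charted M \<phi> b" and ex: "strongly_exact_3 M"
  shows "exact_pmod fscale (charted.space b) (charted.tmap M \<phi> b)"
proof -
  interpret charted M \<phi> b by (rule ch)
  note [simp del] = upd_vector3
  show ?thesis
  proof unfold_locales
    fix i j :: 3 and x a c p q
    assume h: "i \<noteq> j" "x$i \<le> a" "x$j \<le> c" "p \<in> space (upd x i a)" "q \<in> space (upd x j c)"
      "tmap (upd x i a) (upd (upd x i a) j c) p = tmap (upd x j c) (upd (upd x i a) j c) q"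
    have le: "x \<le> upd x i a" "x \<le> upd x j c" "upd x i a \<le> upd (upd x i a) j c" "upd x j c \<le> upd (upd x i a) j c"
      using h by (simp_all add: cvec_le_iff)
    obtain p' where p': "p' \<in> carrier (obj M (upd x i a))" "\<phi> (upd x i a) p' = p" using h(4) by (rule spaceE)
    obtain q' where q': "q' \<in> carrier (obj M (upd x j c))" "\<phi> (upd x j c) q' = q" using h(5) by (rule spaceE)
    have "tr M (upd x i a) (upd (upd x i a) j c) p' = tr M (upd x j c) (upd (upd x i a) j c) q'"
      using h(6) p' q' le by (intro \<phi>_inj[OF tr_in tr_in]) (auto simp: tmap_\<phi>[symmetric])
    then obtain w where w: "w \<in> carrier (obj M x)" "tr M x (upd x i a) w = p'" "tr M x (upd x j c) w = q'"
      using strongly_exact_3_square[OF pm ex h(1-3) p'(1) q'(1)] by blast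
    show "\<exists>w\<in>space x. tmap x (upd x i a) w = p \<and> tmap x (upd x j c) w = q"
      using \<phi>_in[OF w(1)] tmap_\<phi>[OF le(1) w(1)] tmap_\<phi>[OF le(2) w(1)] w p' q' by auto
  next
    fix i j k :: 3 and x a d c g
    assume h: "i \<noteq> j" "i \<noteq> k" "j \<noteq> k" "x$i \<le> a" "x$j \<le> d" "x$k \<le> c" "g \<in> space (upd x k c)"
      "tmap (upd x k c) (upd (upd x k c) i a) g = 0" "tmap (upd x k c) (upd (upd x k c) j d) g = 0"
    have le: "x \<le> upd x i a" "x \<le> upd x j d" "x \<le> upd x k c" "upd x k c \<le> upd (upd x k c) i a"
      "upd x k c \<le> upd (upd x k c) j d" using h by (simp_all add: cvec_le_iff)
    obtain g' where g': "g' \<in> carrier (obj M (upd x k c))" "\<phi> (upd x k c) g' = g" using h(7) by (rule spaceE)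
    have "tr M (upd x k c) (upd (upd x k c) i a) g' = \<zero>\<^bsub>obj M (upd (upd x k c) i a)\<^esub>"
      "tr M (upd x k c) (upd (upd x k c) j d) g' = \<zero>\<^bsub>obj M (upd (upd x k c) j d)\<^esub>"
      using h(8,9) g' le tmap_\<phi> by (auto intro!: coordinates_eq_zero[OF co vs] tr_in)
    then obtain w where w: "w \<in> carrier (obj M x)" "tr M x (upd x k c) w = g'"
      "tr M x (upd x i a) w = \<zero>\<^bsub>obj M (upd x i a)\<^esub>" "tr M x (upd x j d) w = \<zero>\<^bsub>obj M (upd x j d)\<^esub>"
      using strongly_exact_3_cube[OF pm ex h(1-6) g'(1)] by blast
    show "\<exists>w\<in>space x. tmap x (upd x k c) w = g \<and> tmap x (upd x i a) w = 0 \<and> tmap x (upd x j d) w = 0"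
      using \<phi>_in[OF w(1)] tmap_\<phi>[OF le(1) w(1)] tmap_\<phi>[OF le(2) w(1)] tmap_\<phi>[OF le(3) w(1)] w g'
        coordinates_zero[OF co vs] by auto
  next
    fix i j k :: 3 and y a d c w p q
    assume h: "i \<noteq> j" "i \<noteq> k" "j \<noteq> k" "a \<le> y$i" "d \<le> y$j" "c \<le> y$k"
      "w \<in> space (upd y k c)" "p \<in> space (upd y i a)" "q \<in> space (upd y j d)"
      "tmap (upd y k c) y w = tmap (upd y i a) y p + tmap (upd y j d) y q"
    \<comment> \<open>The lower corner takes the levels \<open>a\<close>, \<open>d\<close>,
      \<open>c\<close>. The vertex of a set takes the coordinates of \<open>y\<close> in that set,
      so \<open>{j, k}\<close> is \<open>y\<close> lowered in direction \<open>i\<close>, and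
      likewise for the others.\<close>
    define x where "x = upd (upd (upd y i a) j d) k c"
    have xy: "x \<le> y" using h by (simp add: x_def cvec_le_iff)
    interpret charted3 M \<phi> b x y by unfold_locales (rule xy)
    have three: "l = i \<or> l = j \<or> l = k" for l
      using h(1-3) exhaust_3[of l] exhaust_3[of i] exhaust_3[of j] exhaust_3[of k] by auto
    have z: "z {i, j} = upd y k c" "z {j, k} = upd y i a" "z {i, k} = upd y j d"
      "z {j} = upd (upd y k c) i a" "z {i} = upd (upd y k c) j d"
      using h(1-3) three unfolding x_def by (auto simp: cube_vertex_def cvec_eq_iff)
    have "inj_on (from_colimit D UNIV (cube x y M)) (carrier (pm_colimit D (cube x y M)))"
      using ex xy unfolding strongly_exact_3_def by blast
    from colift[OF this h(1-3), unfolded z, OF h(7-10)]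
    show "\<exists>r\<in>space (upd (upd y k c) i a). \<exists>r'\<in>space (upd (upd y k c) j d).
        w = tmap (upd (upd y k c) i a) (upd y k c) r + tmap (upd (upd y k c) j d) (upd y k c) r'" .
  qed
qed

section \<open>Decompositions and coordinates\<close>

lemma fin_functions_supp: "f \<in> fin_functions A \<Longrightarrow> f x \<noteq> 0 \<Longrightarrow> x \<in> A"
  by (auto simp: fin_functions_def)

lemma fin_functionsI: "finite {x. f x \<noteq> 0} \<Longrightarrow> (\<And>x. f x \<noteq> 0 \<Longrightarrow> x \<in> A) \<Longrightarrow> f \<in> fin_functions A"
  by (auto simp: fin_functions_def)

text \<open>For a space given by an explicit bijection from functions, such as the counting functor,
  coordinates and vector space axioms are obtained together.\<close>

lemma coordinates_of_inverse:
  fixes V :: "('k::field, 'v) module"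
  assumes bij: "bij_betw \<Theta> (fin_functions A) (carrier V)"
    and add: "\<And>f g. f \<in> fin_functions A \<Longrightarrow> g \<in> fin_functions A \<Longrightarrow> \<Theta> f \<oplus>\<^bsub>V\<^esub> \<Theta> g = \<Theta> (f + g)"
    and smult: "\<And>c f. f \<in> fin_functions A \<Longrightarrow> c \<odot>\<^bsub>V\<^esub> \<Theta> f = \<Theta> (fscale c f)"
    and zero: "\<zero>\<^bsub>V\<^esub> = \<Theta> 0"
  shows "coordinates V (inv_into (fin_functions A) \<Theta>) A \<and> vectorspace (class_ring :: 'k ring) V"
proof -
  let ?\<phi> = "inv_into (fin_functions A) \<Theta>"
  have inv: "?\<phi> (\<Theta> f) = f" if "f \<in> fin_functions A" for f
    using bij that by (simp add: bij_betw_def)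
  have ex: "\<exists>f\<in>fin_functions A. v = \<Theta> f" if "v \<in> carrier V" for v
    using bij that by (auto simp: bij_betw_def)
  have im: "\<Theta> f \<in> carrier V" if "f \<in> fin_functions A" for f using bij that by (auto simp: bij_betw_def)
  note sub = fs.subspace_add[OF fin_functions_subspace] fs.subspace_scale[OF fin_functions_subspace]
    fs.subspace_0[OF fin_functions_subspace]
  have co: "coordinates V ?\<phi> A" unfolding coordinates_def
  proof (intro conjI ballI allI)
    show "bij_betw ?\<phi> (carrier V) (fin_functions A)" using bij by (rule bij_betw_inv_into)
    fix v assume "v \<in> carrier V"
    then obtain f where f: "f \<in> fin_functions A" "v = \<Theta> f" using ex by blast
    show "?\<phi> (c \<odot>\<^bsub>V\<^esub> v) = fscale c (?\<phi> v)" for c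
      unfolding f(2) smult[OF f(1)] inv[OF f(1)] by (rule inv) (rule sub(2)[OF f(1)])
    fix w assume "w \<in> carrier V"
    then obtain g where g: "g \<in> fin_functions A" "w = \<Theta> g" using ex by blast
    show "?\<phi> (v \<oplus>\<^bsub>V\<^esub> w) = ?\<phi> v + ?\<phi> w"
      unfolding f(2) g(2) add[OF f(1) g(1)] inv[OF f(1)] inv[OF g(1)] by (rule inv) (rule sub(1)[OF f(1) g(1)])
  qed
  moreover have "vectorspace (class_ring :: 'k ring) V"
  proof (rule vectorspace_via_coordinates[OF co])
    show "v \<oplus>\<^bsub>V\<^esub> w \<in> carrier V" if "v \<in> carrier V" "w \<in> carrier V" for v w
    proof -
      obtain f g where f: "f \<in> fin_functions A" "v = \<Theta> f" and g: "g \<in> fin_functions A" "w = \<Theta> g"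
        using ex \<open>v \<in> _\<close> \<open>w \<in> _\<close> by metis
      show ?thesis unfolding f(2) g(2) add[OF f(1) g(1)] by (rule im) (rule sub(1)[OF f(1) g(1)])
    qed
    show "c \<odot>\<^bsub>V\<^esub> v \<in> carrier V" if "v \<in> carrier V" for c v
    proof -
      obtain f where f: "f \<in> fin_functions A" "v = \<Theta> f" using ex \<open>v \<in> _\<close> by metis
      show ?thesis unfolding f(2) smult[OF f(1)] by (rule im) (rule sub(2)[OF f(1)])
    qed
    show "\<zero>\<^bsub>V\<^esub> \<in> carrier V" unfolding zero by (rule im) (rule sub(3))
    show "?\<phi> \<zero>\<^bsub>V\<^esub> = 0" unfolding zero by (rule inv) (rule sub(3))
  qed
  ultimately show ?thesis by blast
qed

text \<open>In these coordinates \<open>M\<close> is the direct sum of the block modules of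
  \<open>\<beta> j\<close>: a structure map forgets the coordinates whose block has been left. The
  index set is arbitrary, so that a constructed and a given decomposition take the same
  form.\<close>

definition block_coordinates ::
    "(real^3, 'k::field, 'v) pers_mod \<Rightarrow> 'j set \<Rightarrow> ('j \<Rightarrow> (real^3) set) \<Rightarrow> (real^3 \<Rightarrow> 'v \<Rightarrow> 'j \<Rightarrow> 'k) \<Rightarrow> bool" where
  "block_coordinates M J \<beta> c \<longleftrightarrow> (\<forall>j\<in>J. \<beta> j \<in> blocks) \<and>
    (\<forall>t. coordinates (obj M t) (c t) {j \<in> J. t \<in> \<beta> j}) \<and>
    (\<forall>s t. s \<le> t \<longrightarrow> (\<forall>v\<in>carrier (obj M s). c t (tr M s t v) = (\<lambda>j. if t \<in> \<beta> j then c s v j else 0)))"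

theorem exists_block_coordinates:
  fixes M :: "(real^3, 'k::field, 'v) pers_mod"
  assumes pfd: "pfd_persistence_module M" and ex: "strongly_exact_3 M"
  shows "\<exists>(S :: ((real^3) set \<times> (real^3 \<Rightarrow> 'v \<Rightarrow> 'k)) set) c. block_coordinates M S fst c"
proof -
  obtain \<phi> b where ch: "charted M \<phi> b" using pfd_charted[OF pfd] .
  interpret charted M \<phi> b by (rule ch)
  interpret exact_pmod fscale space tmap using charted_exact[OF ch ex] .
  obtain S where pd: "partial_decomposition S (\<lambda>_. {0})" using exists_block_decomposition by blast
  have fam: "\<And>x. x \<in> S \<Longrightarrow> block_family x" and comp: "\<And>t. complements S (\<lambda>_. {0}) t"
    using pd by (auto simp: partial_decomposition_def)
  \<comment> \<open>Linear combinations of the generators at \<open>t\<close>. By the decomposition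
    this is a bijection onto \<open>space t\<close>, and its inverse after \<phi> gives the block
    coordinates.\<close>
  define realize where "realize t a = (\<Sum>x\<in>{x. a x \<noteq> 0}. fscale (a x) (snd x t))"
    for t and a :: "(real^3) set \<times> (real^3 \<Rightarrow> 'v \<Rightarrow> 'k) \<Rightarrow> 'k"
  have realize_sup: "realize t a = (\<Sum>x\<in>A. fscale (a x) (snd x t))" if "finite A" "{x. a x \<noteq> 0} \<subseteq> A" for t a A
    unfolding realize_def using that by (intro sum.mono_neutral_left) auto
  have fin: "finite {x. a x \<noteq> 0}" "{x. a x \<noteq> 0} \<subseteq> living S t" if "a \<in> fin_functions (living S t)" for a t
    using that by (auto simp: fin_functions_def)
  have realize_in: "realize t a \<in> space t" if "a \<in> fin_functions (living S t)" for t a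
    unfolding realize_def
  proof (intro fs.subspace_sum[OF sub_E] fs.subspace_scale[OF sub_E])
    fix x assume "x \<in> {x. a x \<noteq> 0}"
    then have "x \<in> living S t" using fin(2)[OF that] by blast
    then show "snd x t \<in> space t" using fam by (auto simp: living_def block_family_def)
  qed
  have realize_add: "realize t (a + a') = realize t a + realize t a'"
    if "a \<in> fin_functions (living S t)" "a' \<in> fin_functions (living S t)" for t a a'
  proof -
    let ?A = "{x. a x \<noteq> 0} \<union> {x. a' x \<noteq> 0}"
    have "finite ?A" using fin(1)[OF that(1)] fin(1)[OF that(2)] by simp
    moreover have "{x. (a + a') x \<noteq> 0} \<subseteq> ?A" by auto
    ultimately show ?thesis using realize_sup[of ?A]
      by (simp add: fs.scale_left_distrib sum.distrib)
  qed
  have realize_scale: "realize t (fscale c a) = fscale c (realize t a)" if "a \<in> fin_functions (living S t)" for t a c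
  proof -
    have "{x. fscale c a x \<noteq> 0} \<subseteq> {x. a x \<noteq> 0}" by (auto simp: fscale_def)
    then have "realize t (fscale c a) = (\<Sum>x\<in>{x. a x \<noteq> 0}. fscale (fscale c a x) (snd x t))"
      using fin(1)[OF that] by (intro realize_sup)
    also have "\<dots> = fscale c (realize t a)"
      by (simp add: realize_def fs.scale_sum_right) (simp add: fscale_def)
    finally show ?thesis .
  qed
  have realize_0: "a = 0" if a: "a \<in> fin_functions (living S t)" "realize t a = 0" for t a
  proof -
    have "a x = 0" if "x \<in> {x. a x \<noteq> 0}" for x
      by (rule complements_indep[OF comp[of t] fin[OF a(1)] _ that]) (use a(2) in \<open>simp add: realize_def\<close>)
    then show ?thesis by (auto simp: fun_eq_iff)
  qed
  have bij: "bij_betw (realize t) (fin_functions (living S t)) (space t)" for t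
    unfolding bij_betw_def
  proof
    show "inj_on (realize t) (fin_functions (living S t))"
    proof (rule inj_onI)
      fix a a' assume a: "a \<in> fin_functions (living S t)" "a' \<in> fin_functions (living S t)" "realize t a = realize t a'"
      have n: "fscale (- 1) a' \<in> fin_functions (living S t)"
        using fs.subspace_scale[OF fin_functions_subspace a(2)] .
      have "realize t (a + fscale (- 1) a') = realize t a + fscale (- 1) (realize t a')"
        unfolding realize_add[OF a(1) n] realize_scale[OF a(2)] ..
      also have "\<dots> = 0" using a(3) by simp
      finally have "a + fscale (- 1) a' = 0"
        by (rule realize_0[OF fs.subspace_add[OF fin_functions_subspace a(1) n]])
      then show "a = a'" by simp
    qed
    show "realize t ` fin_functions (living S t) = space t"
    proof
      show "realize t ` fin_functions (living S t) \<subseteq> space t" using realize_in by blast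
      show "space t \<subseteq> realize t ` fin_functions (living S t)"
      proof
        fix v assume "v \<in> space t"
        then obtain A a where A: "finite A" "A \<subseteq> living S t" "v - (\<Sum>x\<in>A. fscale (a x) (snd x t)) \<in> {0}"
          by (rule complements_cover[OF comp])
        let ?a = "\<lambda>x. if x \<in> A then a x else 0"
        have "?a \<in> fin_functions (living S t)"
          using A(1,2) by (intro fin_functionsI) (auto split: if_splits intro: finite_subset[OF _ A(1)])
        moreover have "realize t ?a = v" using realize_sup[of A ?a t] A(1,3) by (simp add: subset_iff)
        ultimately show "v \<in> realize t ` fin_functions (living S t)" by blast
      qed
    qed
  qed
  define c where "c t v = inv_into (fin_functions (living S t)) (realize t) (\<phi> t v)" for t v
  have c: "c t v \<in> fin_functions (living S t)" "realize t (c t v) = \<phi> t v" if "v \<in> carrier (obj M t)" for t v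
    using bij[of t] \<phi>_in[OF that] f_inv_into_f[of "\<phi> t v" "realize t"] inv_into_into[of "\<phi> t v" "realize t"]
    unfolding c_def bij_betw_def by auto
  have cI: "c t v = a" if "a \<in> fin_functions (living S t)" "realize t a = \<phi> t v" for t v a
    using bij[of t] inv_into_f_f[of "realize t" _ a] that unfolding c_def bij_betw_def by metis
  have "coordinates (obj M t) (c t) (living S t)" for t unfolding coordinates_def
  proof (intro conjI ballI allI)
    have "c t = inv_into (fin_functions (living S t)) (realize t) \<circ> \<phi> t" by (auto simp: c_def)
    moreover have "bij_betw (\<phi> t) (carrier (obj M t)) (space t)"
      using coordinates_bij[OF co] by (simp add: space_def)
    ultimately show "bij_betw (c t) (carrier (obj M t)) (fin_functions (living S t))"
      using bij_betw_trans[OF _ bij_betw_inv_into[OF bij]] by metis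
    fix v assume v: "v \<in> carrier (obj M t)"
    show "c t (a \<odot>\<^bsub>obj M t\<^esub> v) = fscale a (c t v)" for a
      using c[OF v] v by (intro cI fs.subspace_scale[OF fin_functions_subspace]) (auto simp: realize_scale \<phi>_smult)
    fix w assume w: "w \<in> carrier (obj M t)"
    show "c t (v \<oplus>\<^bsub>obj M t\<^esub> w) = c t v + c t w"
      using c[OF v] c[OF w] v w
      by (intro cI fs.subspace_add[OF fin_functions_subspace]) (auto simp: realize_add \<phi>_add)
  qed
  moreover have "c t (tr M s t v) = (\<lambda>x. if t \<in> fst x then c s v x else 0)"
    if st: "s \<le> t" and v: "v \<in> carrier (obj M s)" for s t v
  proof (rule cI)
    let ?a = "\<lambda>x. if t \<in> fst x then c s v x else 0"
    let ?A = "{x. c s v x \<noteq> 0}"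
    note cs = fin[OF c(1)[OF v]]
    show "?a \<in> fin_functions (living S t)"
      using cs by (intro fin_functionsI) (auto simp: living_def split: if_splits intro: finite_subset[OF _ cs(1)])
    have "\<phi> t (tr M s t v) = tmap s t (realize s (c s v))" using tmap_\<phi>[OF st v] c(2)[OF v] by simp
    also have "\<dots> = (\<Sum>x\<in>?A. fscale (c s v x) (tmap s t (snd x s)))"
      by (simp add: realize_def T_sum T_scale)
    also have "\<dots> = (\<Sum>x\<in>?A. fscale (?a x) (snd x t))"
    proof (rule sum.cong)
      fix x assume "x \<in> ?A"
      then have "x \<in> living S s" using cs(2) by blast
      then have "tmap s t (snd x s) = (if t \<in> fst x then snd x t else 0)"
        using fam[of x] st by (simp add: living_def block_family_def)
      then show "fscale (c s v x) (tmap s t (snd x s)) = fscale (?a x) (snd x t)" by simp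
    qed simp
    also have "\<dots> = realize t ?a" using cs(1) by (intro realize_sup[symmetric]) auto
    finally show "realize t ?a = \<phi> t (tr M s t v)" by simp
  qed
  ultimately have "block_coordinates M S fst c"
    unfolding block_coordinates_def using fam by (auto simp: block_family_def living_def)
  then show ?thesis by blast
qed

section \<open>Block modules and direct sums as persistence modules\<close>

lemma coordinates_block_module:
  "coordinates (obj (block_module B) t) (\<lambda>v (_::unit). v :: 'k::field) (if t \<in> B then UNIV else {})"
  unfolding coordinates_def
proof (intro conjI ballI allI)
  show "bij_betw (\<lambda>v (_::unit). v) (carrier (obj (block_module B) t)) (fin_functions (if t \<in> B then UNIV else {}))"
    by (rule bij_betw_byWitness[where f' = "\<lambda>f. f ()"])
      (auto simp: block_module_def fin_functions_def fun_eq_iff split: if_splits)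
qed (auto simp: block_module_def fscale_def fun_eq_iff)

lemma vectorspace_block_module: "vectorspace (class_ring :: 'k::field ring) (obj (block_module B) t)"
  by (rule vectorspace_via_coordinates[OF coordinates_block_module])
    (auto simp: block_module_def fun_eq_iff split: if_splits)

text \<open>Convexity of \<open>B\<close> enters in composition: passing through a point outside
  \<open>B\<close> between two points of \<open>B\<close> would turn the identity into 0.\<close>

lemma persistence_module_block_module:
  assumes "\<And>s w u. s \<in> B \<Longrightarrow> u \<in> B \<Longrightarrow> s \<le> w \<Longrightarrow> w \<le> u \<Longrightarrow> w \<in> B"
  shows "persistence_module (block_module B :: ('p::order, 'k::field, 'k) pers_mod)"
  unfolding persistence_module_def
proof (intro conjI allI impI ballI)
  show "linear_map class_ring (obj (block_module B) s) (obj (block_module B) t) (tr (block_module B) s t)"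
    if "s \<le> t" for s t :: 'p
    by (rule linear_mapI[OF vectorspace_block_module vectorspace_block_module]) (auto simp: block_module_def)
  show "tr (block_module B) s t (tr (block_module B) r s v) = tr (block_module B) r t v"
    if "r \<le> s" "s \<le> t" for r s t :: 'p and v :: 'k
    using assms[of r t s] that by (auto simp: block_module_def)
  show "tr (block_module B) t t v = v" if "v \<in> carrier (obj (block_module B) t)" for t and v :: 'k
    using that by (auto simp: block_module_def split: if_splits)
qed (rule vectorspace_block_module)

lemma persistence_module_pm_dsum:
  assumes pm: "\<And>i. i \<in> I \<Longrightarrow> persistence_module (N i)"
  shows "persistence_module (pm_dsum I N)"
  unfolding persistence_module_def
proof (intro conjI allI impI ballI)
  have vsd: "vectorspace class_ring (vs_dsum I (\<lambda>i. obj (N i) t))" for t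
    using persistence_moduleD(1)[OF pm] by (rule vectorspace_vs_dsum)
  then show "vectorspace class_ring (obj (pm_dsum I N) t)" for t by (simp add: pm_dsum_def)
  have el: "f i \<in> carrier (obj (N i) t)" if "f \<in> carrier (obj (pm_dsum I N) t)" "i \<in> I" for f i t
    using that by (auto simp: pm_dsum_def vs_dsum_def)
  show "linear_map class_ring (obj (pm_dsum I N) s) (obj (pm_dsum I N) t) (tr (pm_dsum I N) s t)" if "s \<le> t" for s t
  proof (rule linear_mapI)
    note l = persistence_moduleD(2)[OF pm that]
    show "vectorspace class_ring (obj (pm_dsum I N) s)" "vectorspace class_ring (obj (pm_dsum I N) t)"
      using vsd by (simp_all add: pm_dsum_def)
    fix f assume f: "f \<in> carrier (obj (pm_dsum I N) s)"
    have "{i \<in> I. tr (N i) s t (f i) \<noteq> \<zero>\<^bsub>obj (N i) t\<^esub>} \<subseteq> {i \<in> I. f i \<noteq> \<zero>\<^bsub>obj (N i) s\<^esub>}"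
      using linear_map_zero[OF l] by auto
    moreover have "finite {i \<in> I. f i \<noteq> \<zero>\<^bsub>obj (N i) s\<^esub>}" using f by (simp add: pm_dsum_def vs_dsum_def)
    ultimately have fin: "finite {i \<in> I. tr (N i) s t (f i) \<noteq> \<zero>\<^bsub>obj (N i) t\<^esub>}" by (rule finite_subset)
    show "tr (pm_dsum I N) s t f \<in> carrier (obj (pm_dsum I N) t)"
      using fin linear_mapD(1)[OF l] el[OF f] by (auto simp: pm_dsum_def vs_dsum_def cong: conj_cong)
    show "tr (pm_dsum I N) s t (a \<odot>\<^bsub>obj (pm_dsum I N) s\<^esub> f) = a \<odot>\<^bsub>obj (pm_dsum I N) t\<^esub> tr (pm_dsum I N) s t f" for a
      using linear_mapD(3)[OF l] el[OF f] by (auto simp: pm_dsum_def vs_dsum_def)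
    fix g assume g: "g \<in> carrier (obj (pm_dsum I N) s)"
    show "tr (pm_dsum I N) s t (f \<oplus>\<^bsub>obj (pm_dsum I N) s\<^esub> g) =
        tr (pm_dsum I N) s t f \<oplus>\<^bsub>obj (pm_dsum I N) t\<^esub> tr (pm_dsum I N) s t g"
      using linear_mapD(2)[OF l] el[OF f] el[OF g] by (auto simp: pm_dsum_def vs_dsum_def)
  qed
  show "tr (pm_dsum I N) t t f = f" if f: "f \<in> carrier (obj (pm_dsum I N) t)" for t f
  proof
    fix i
    show "tr (pm_dsum I N) t t f i = f i"
    proof (cases "i \<in> I")
      case True
      then show ?thesis using persistence_moduleD(3)[OF pm el[OF f]] by (simp add: pm_dsum_def)
    next
      case False
      then show ?thesis using f by (simp add: pm_dsum_def vs_dsum_def PiE_def extensional_def)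
    qed
  qed
  show "tr (pm_dsum I N) s t (tr (pm_dsum I N) r s f) = tr (pm_dsum I N) r t f"
    if "r \<le> s" "s \<le> t" "f \<in> carrier (obj (pm_dsum I N) r)" for r s t f
    using persistence_moduleD(4)[OF pm that(1,2)] el[OF that(3)] by (auto simp: pm_dsum_def)
qed

section \<open>The counting functor\<close>

definition convexes :: "('n::finite \<Rightarrow> real set) \<Rightarrow> bool" where
  "convexes J \<longleftrightarrow> (\<forall>i a b x. a \<in> J i \<longrightarrow> b \<in> J i \<longrightarrow> a \<le> x \<longrightarrow> x \<le> b \<longrightarrow> x \<in> J i)"

lemma block_pbox:
  assumes "B \<in> blocks"
  obtains X where "convexes X" "B = pbox X" "B \<noteq> {}"
proof -
  obtain c d where cd: "cuboid_with c d B"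
    using assms by (auto simp: blocks_def birth_block_def death_block_def layer_block_def)
  define X where "X i = snd (c i) \<inter> fst (d i)" for i
  have cut: "is_cut (c i)" "is_cut (d i)" for i using cd by (simp_all add: cuboid_with_def)
  have low: "x \<in> snd (c i)" if "a \<in> snd (c i)" "a \<le> x" for a x i
    using cut(1)[of i] that unfolding is_cut_def by (metis UNIV_I Un_iff leD)
  have up: "x \<in> fst (d i)" if "a \<in> fst (d i)" "x \<le> a" for a x i
    using cut(2)[of i] that unfolding is_cut_def by (metis UNIV_I Un_iff leD)
  have "convexes X" unfolding convexes_def X_def using low up by blast
  moreover have "B = pbox X" "B \<noteq> {}"
    using cd by (auto simp: cuboid_with_def cuboid_of_def pbox_def X_def)
  ultimately show ?thesis by (rule that)
qed

definition vmin :: "real^3 \<Rightarrow> real^3 \<Rightarrow> real^3" where "vmin s t = (\<chi> i. min (s$i) (t$i))"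
definition vmax :: "real^3 \<Rightarrow> real^3 \<Rightarrow> real^3" where "vmax s t = (\<chi> i. max (s$i) (t$i))"

lemma vmin_le: "vmin s t \<le> s" "vmin s t \<le> t" and vmax_ge: "s \<le> vmax s t" "t \<le> vmax s t"
  by (auto simp: vmin_def vmax_def cvec_le_iff)

lemma block_convex:
  assumes "B \<in> blocks" "s \<in> B" "u \<in> B" "s \<le> w" "w \<le> u"
  shows "w \<in> B"
proof -
  obtain X where X: "convexes X" "B = pbox X" using block_pbox[OF assms(1)] by blast
  have "w$i \<in> X i" for i
    using X(1)[unfolded convexes_def, rule_format, of "s$i" i "u$i" "w$i"] assms(2-5) X(2)
    by (simp add: pbox_def cvec_le_iff)
  then show ?thesis using X(2) by (simp add: pbox_def)
qed

text \<open>In each coordinate the minimum and the maximum with \<open>t\<close> are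
  \<open>w$i\<close> and \<open>t$i\<close> in some order. Hence a block through \<open>t\<close> is
  determined by its points below \<open>t\<close> and above \<open>t\<close>.\<close>

lemma block_min_max:
  assumes "B \<in> blocks" "t \<in> B"
  shows "w \<in> B \<longleftrightarrow> vmin w t \<in> B \<and> vmax w t \<in> B"
proof -
  obtain X where X: "B = pbox X" using block_pbox[OF assms(1)] by blast
  have "w$i \<in> X i \<longleftrightarrow> min (w$i) (t$i) \<in> X i \<and> max (w$i) (t$i) \<in> X i" for i
    using assms(2) X by (auto simp: pbox_def min_def max_def)
  then show ?thesis unfolding X by (auto simp: pbox_def vmin_def vmax_def)
qed

section \<open>Images, kernels and their sums as coordinate subspaces\<close>

locale block_coords =
  fixes M :: "(real^3, 'k::field, 'v) pers_mod" and J :: "'j set" and \<beta> :: "'j \<Rightarrow> (real^3) set"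
    and c :: "real^3 \<Rightarrow> 'v \<Rightarrow> 'j \<Rightarrow> 'k"
  assumes pfd: "pfd_persistence_module M" and bc: "block_coordinates M J \<beta> c"
begin

lemma pm: "persistence_module M" and fd: "vectorspace.fin_dim class_ring (obj M t)"
  using pfd by (auto simp: pfd_persistence_module_def)

lemmas vs = persistence_moduleD(1)[OF pm]
lemmas lin = persistence_moduleD(2)[OF pm]

lemma co: "coordinates (obj M t) (c t) {j \<in> J. t \<in> \<beta> j}" and \<beta>_block: "j \<in> J \<Longrightarrow> \<beta> j \<in> blocks"
  and c_tr: "s \<le> t \<Longrightarrow> v \<in> carrier (obj M s) \<Longrightarrow> c t (tr M s t v) = (\<lambda>j. if t \<in> \<beta> j then c s v j else 0)"
  using bc by (auto simp: block_coordinates_def)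

lemma finite_alive: "finite {j \<in> J. t \<in> \<beta> j}"
  using coordinates_finite[OF co vs fd] .

lemmas c_add = coordinates_add[OF co]
lemmas c_smult = coordinates_smult[OF co]
lemmas c_inj = coordinates_inj[OF co]
lemmas c_zero = coordinates_zero[OF co vs]
lemmas cl = vs_closed(1-3)[OF vs]

lemma c_supp: "v \<in> carrier (obj M t) \<Longrightarrow> c t v j \<noteq> 0 \<Longrightarrow> j \<in> J \<and> t \<in> \<beta> j"
  using fin_functions_supp[OF coordinates_in[OF co]] by blast

lemma c_surj:
  assumes "\<And>j. a j \<noteq> 0 \<Longrightarrow> j \<in> J \<and> t \<in> \<beta> j"
  obtains v where "v \<in> carrier (obj M t)" "c t v = a"
proof -
  have "a \<in> fin_functions {j \<in> J. t \<in> \<beta> j}"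
    unfolding fin_functions_finite[OF finite_alive] using assms by blast
  then show ?thesis using coordinates_surj[OF co] that by blast
qed

definition supported :: "real^3 \<Rightarrow> 'j set \<Rightarrow> 'v set" where
  "supported t A = {v \<in> carrier (obj M t). \<forall>j. c t v j \<noteq> 0 \<longrightarrow> j \<in> A}"

lemma supported_subset: "supported t A \<subseteq> carrier (obj M t)"
  by (auto simp: supported_def)

lemma supported_Int: "supported t A \<inter> supported t B = supported t (A \<inter> B)"
  by (auto simp: supported_def)

lemma supported_mono: "A \<subseteq> B \<Longrightarrow> supported t A \<subseteq> supported t B"
  by (auto simp: supported_def)

text \<open>A vector at \<open>t\<close> supported on blocks that contain \<open>s\<close> has the
  same coordinates as some vector at \<open>s\<close>, and that vector is a lift of it.\<close>

lemma im_supported: assumes st: "s \<le> t" shows "mod_hom.im (obj M s) (tr M s t) = supported t {j. s \<in> \<beta> j}"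
  unfolding mod_hom.im_def[OF linear_mapD(6)[OF lin[OF st]]]
proof
  show "tr M s t ` carrier (obj M s) \<subseteq> supported t {j. s \<in> \<beta> j}"
    using linear_mapD(1)[OF lin[OF st]] c_supp by (auto simp: supported_def c_tr[OF st] split: if_splits)
  show "supported t {j. s \<in> \<beta> j} \<subseteq> tr M s t ` carrier (obj M s)"
  proof
    fix v assume v: "v \<in> supported t {j. s \<in> \<beta> j}"
    then have vt: "v \<in> carrier (obj M t)" and vs: "\<And>j. c t v j \<noteq> 0 \<Longrightarrow> s \<in> \<beta> j" by (auto simp: supported_def)
    obtain u where u: "u \<in> carrier (obj M s)" "c s u = c t v"
      using c_surj[of "c t v" s] c_supp[OF vt] vs by metis
    have "tr M s t u = v"
      using linear_mapD(1)[OF lin[OF st] u(1)] vt c_supp[OF vt]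
      by (intro c_inj[where t = t]) (auto simp: c_tr[OF st u(1)] u(2) fun_eq_iff)
    then show "v \<in> tr M s t ` carrier (obj M s)" using u(1) by blast
  qed
qed

lemma ker_supported: assumes tu: "t \<le> u" shows "mod_hom.ker (obj M t) (obj M u) (tr M t u) = supported t {j. u \<notin> \<beta> j}"
proof -
  have "tr M t u v = \<zero>\<^bsub>obj M u\<^esub> \<longleftrightarrow> (\<forall>j. c t v j \<noteq> 0 \<longrightarrow> u \<notin> \<beta> j)" if v: "v \<in> carrier (obj M t)" for v
  proof -
    have "tr M t u v = \<zero>\<^bsub>obj M u\<^esub> \<longleftrightarrow> c u (tr M t u v) = 0"
      using coordinates_eq_zero[OF co vs linear_mapD(1)[OF lin[OF tu] v]] c_zero by auto
    then show ?thesis by (auto simp: c_tr[OF tu v] fun_eq_iff)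
  qed
  then show ?thesis unfolding mod_hom.ker_def[OF linear_mapD(6)[OF lin[OF tu]]] supported_def by blast
qed

lemma supported_closed:
  "\<zero>\<^bsub>obj M t\<^esub> \<in> supported t A"
  "v \<in> supported t A \<Longrightarrow> w \<in> supported t A \<Longrightarrow> v \<oplus>\<^bsub>obj M t\<^esub> w \<in> supported t A"
  "v \<in> supported t A \<Longrightarrow> a \<odot>\<^bsub>obj M t\<^esub> v \<in> supported t A"
proof -
  show "\<zero>\<^bsub>obj M t\<^esub> \<in> supported t A" using cl(3) by (simp add: supported_def c_zero)
  show "v \<oplus>\<^bsub>obj M t\<^esub> w \<in> supported t A" if vw: "v \<in> supported t A" "w \<in> supported t A"
  proof -
    have "c t v j \<noteq> 0 \<or> c t w j \<noteq> 0" if "c t (v \<oplus>\<^bsub>obj M t\<^esub> w) j \<noteq> 0" for j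
      using that vw by (auto simp: supported_def c_add)
    then have "j \<in> A" if "c t (v \<oplus>\<^bsub>obj M t\<^esub> w) j \<noteq> 0" for j
      using that vw unfolding supported_def by blast
    then show ?thesis using vw cl(1) by (simp add: supported_def)
  qed
  show "a \<odot>\<^bsub>obj M t\<^esub> v \<in> supported t A" if "v \<in> supported t A"
    using that cl(2) by (auto simp: supported_def c_smult fscale_def)
qed

text \<open>A vector with the right support is a combination of basis vectors, each of which already
  lies in one of the summands.\<close>

lemma subspace_Sum_supported: "subspace_Sum (obj M t) {supported t (X i) | i. P i} = supported t (\<Union>i\<in>{i. P i}. X i)"
proof -
  interpret V: vectorspace "class_ring :: 'k ring" "obj M t" by (rule vs)
  let ?U = "\<Union>{supported t (X i) | i. P i}"
  have "V.span ?U \<subseteq> supported t (\<Union>i\<in>{i. P i}. X i)"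
  proof (rule span_induct_carrier[OF vs])
    show "?U \<subseteq> supported t (\<Union>i\<in>{i. P i}. X i)" by (fastforce simp: supported_def)
  qed (use supported_subset supported_closed in auto)
  moreover have "supported t (\<Union>i\<in>{i. P i}. X i) \<subseteq> V.span ?U"
  proof
    fix v assume v: "v \<in> supported t (\<Union>i\<in>{i. P i}. X i)"
    let ?I = "{j. c t v j \<noteq> 0}" and ?d = "dual_vector (obj M t) (c t)"
    have vc: "v \<in> carrier (obj M t)" using v supported_subset by blast
    have IA: "?I \<subseteq> {j \<in> J. t \<in> \<beta> j}" using c_supp[OF vc] by blast
    then have fI: "finite ?I" using finite_alive finite_subset by blast
    have inj: "inj_on ?d ?I" using inj_on_subset[OF dual_vector_inj[OF co vs] IA] .
    have dU: "?d ` ?I \<subseteq> ?U"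
    proof (rule image_subsetI)
      fix j assume j: "j \<in> ?I"
      then obtain i where "P i" "j \<in> X i" using v by (auto simp: supported_def)
      moreover have "j \<in> {j \<in> J. t \<in> \<beta> j}" using j IA by blast
      ultimately have "?d j \<in> supported t (X i)"
        using dual_vector[OF co vs, of j] by (auto simp: supported_def split: if_splits)
      then show "?d j \<in> ?U" using \<open>P i\<close> by blast
    qed
    define a where "a w = c t v (inv_into ?I ?d w)" for w
    have "c t (V.lincomb a (?d ` ?I)) = (\<lambda>j. if j \<in> ?I then a (?d j) else 0)"
      by (rule coordinates_lincomb[OF co vs fI IA])
    also have "\<dots> = c t v" using inj by (auto simp: a_def)
    finally have eq: "c t (V.lincomb a (?d ` ?I)) = c t v" .
    have "?d ` ?I \<subseteq> carrier (obj M t)" using dual_vector(1)[OF co vs] IA by blast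
    then have "V.lincomb a (?d ` ?I) \<in> carrier (obj M t)" by (rule V.lincomb_closed) simp
    then have "V.lincomb a (?d ` ?I) = v" using vc eq by (rule c_inj)
    moreover have "V.lincomb a (?d ` ?I) \<in> V.span ?U"
      unfolding V.span_def using dU fI by (intro CollectI exI[of _ a] exI[of _ "?d ` ?I"]) simp
    ultimately show "v \<in> V.span ?U" by simp
  qed
  ultimately show ?thesis by (simp add: subspace_Sum_def)
qed

lemma supported_sum: "supported t A <+>\<^bsub>obj M t\<^esub> supported t B = supported t (A \<union> B)"
proof
  have sub: "supported t A \<subseteq> supported t (A \<union> B)" "supported t B \<subseteq> supported t (A \<union> B)" by (rule supported_mono; blast)+
  have "x \<oplus>\<^bsub>obj M t\<^esub> y \<in> supported t (A \<union> B)" if "x \<in> supported t A" "y \<in> supported t B" for x y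
    using supported_closed(2)[OF subsetD[OF sub(1) that(1)] subsetD[OF sub(2) that(2)]] .
  then show "supported t A <+>\<^bsub>obj M t\<^esub> supported t B \<subseteq> supported t (A \<union> B)"
    by (auto simp: set_add_defs)
  show "supported t (A \<union> B) \<subseteq> supported t A <+>\<^bsub>obj M t\<^esub> supported t B"
  proof
    fix v assume v: "v \<in> supported t (A \<union> B)"
    then have vc: "v \<in> carrier (obj M t)" and vAB: "\<And>j. c t v j \<noteq> 0 \<Longrightarrow> j \<in> A \<or> j \<in> B" by (auto simp: supported_def)
    obtain x where x: "x \<in> carrier (obj M t)" "c t x = (\<lambda>j. if j \<in> A then c t v j else 0)"
      by (rule c_surj[of "\<lambda>j. if j \<in> A then c t v j else 0" t]) (use c_supp[OF vc] in \<open>auto split: if_splits\<close>)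
    obtain y where y: "y \<in> carrier (obj M t)" "c t y = (\<lambda>j. if j \<in> A then 0 else c t v j)"
      by (rule c_surj[of "\<lambda>j. if j \<in> A then 0 else c t v j" t]) (use c_supp[OF vc] in \<open>auto split: if_splits\<close>)
    have "v = x \<oplus>\<^bsub>obj M t\<^esub> y"
      using vc x y cl(1) by (intro c_inj[where t = t]) (auto simp: c_add fun_eq_iff)
    moreover have "x \<in> supported t A" using x by (auto simp: supported_def)
    moreover have "y \<in> supported t B" using y vAB by (auto simp: supported_def split: if_splits)
    ultimately show "v \<in> supported t A <+>\<^bsub>obj M t\<^esub> supported t B" by (auto simp: set_add_defs)
  qed
qed

section \<open>The counting functor of one block\<close>

context
  fixes C :: "(real^3) set"
  assumes C: "C \<in> blocks"
begin

definition I_plus_index where "I_plus_index t = {j. \<forall>s\<in>C. s \<le> t \<longrightarrow> s \<in> \<beta> j}"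
definition I_minus_index where "I_minus_index t = {j. \<exists>s. s \<notin> C \<and> s \<le> t \<and> s \<in> \<beta> j}"
definition K_plus_index where "K_plus_index t = {j. \<forall>u. u \<notin> C \<longrightarrow> t \<le> u \<longrightarrow> u \<notin> \<beta> j}"
definition K_minus_index where "K_minus_index t = {j. \<exists>u\<in>C. t \<le> u \<and> u \<notin> \<beta> j}"
definition V_plus_index where "V_plus_index t = I_plus_index t \<inter> (K_plus_index t \<union> K_minus_index t)"
definition V_minus_index where "V_minus_index t = (I_plus_index t \<inter> K_minus_index t) \<union> ((I_minus_index t \<inter> I_plus_index t) \<inter> (K_plus_index t \<union> K_minus_index t))"

lemma I_plus_supported: "I_plus M C t = supported t (I_plus_index t)"
proof -
  have "I_plus M C t = carrier (obj M t) \<inter> (\<Inter>s\<in>{s \<in> C. s \<le> t}. supported t {j. s \<in> \<beta> j})"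
    unfolding I_plus_def by (intro arg_cong2[where f = "(\<inter>)"] INF_cong) (auto simp: im_supported)
  then show ?thesis by (auto simp: supported_def I_plus_index_def)
qed

lemma K_plus_supported: "K_plus M C t = supported t (K_plus_index t)"
proof -
  have "K_plus M C t = carrier (obj M t) \<inter> (\<Inter>u\<in>{u. u \<notin> C \<and> t \<le> u}. supported t {j. u \<notin> \<beta> j})"
    unfolding K_plus_def by (intro arg_cong2[where f = "(\<inter>)"] INF_cong) (auto simp: ker_supported)
  then show ?thesis by (auto simp: supported_def K_plus_index_def)
qed

lemma I_minus_supported: "I_minus M C t = supported t (I_minus_index t)"
proof -
  have "{mod_hom.im (obj M s) (tr M s t) | s. s \<notin> C \<and> s \<le> t} = {supported t {j. s \<in> \<beta> j} | s. s \<notin> C \<and> s \<le> t}"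
    using im_supported by (intro Collect_cong) metis
  then have "I_minus M C t = supported t (\<Union>s\<in>{s. s \<notin> C \<and> s \<le> t}. {j. s \<in> \<beta> j})"
    unfolding I_minus_def by (simp add: subspace_Sum_supported)
  moreover have "(\<Union>s\<in>{s. s \<notin> C \<and> s \<le> t}. {j. s \<in> \<beta> j}) = I_minus_index t" by (auto simp: I_minus_index_def)
  ultimately show ?thesis by simp
qed

lemma K_minus_supported: "K_minus M C t = supported t (K_minus_index t)"
proof -
  have "{mod_hom.ker (obj M t) (obj M u) (tr M t u) | u. u \<in> C \<and> t \<le> u} = {supported t {j. u \<notin> \<beta> j} | u. u \<in> C \<and> t \<le> u}"
    using ker_supported by (intro Collect_cong) metis
  then have "K_minus M C t = supported t (\<Union>u\<in>{u. u \<in> C \<and> t \<le> u}. {j. u \<notin> \<beta> j})"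
    unfolding K_minus_def by (simp add: subspace_Sum_supported)
  moreover have "(\<Union>u\<in>{u. u \<in> C \<and> t \<le> u}. {j. u \<notin> \<beta> j}) = K_minus_index t" by (auto simp: K_minus_index_def)
  ultimately show ?thesis by simp
qed

lemma V_plus_supported: "V_plus M C t = supported t (V_plus_index t)" and V_minus_supported: "V_minus M C t = supported t (V_minus_index t)"
  unfolding V_plus_def V_minus_def Im_plus_def Im_minus_def Ker_plus_def Ker_minus_def
    I_plus_supported K_plus_supported I_minus_supported K_minus_supported supported_Int supported_sum V_plus_index_def V_minus_index_def by simp_all

text \<open>An index of V+ that escapes V- lies in I+ and K+ but neither in I- nor in K-. Then its
  block agrees with \<open>C\<close> below \<open>t\<close> and above \<open>t\<close>, which fixes
  it completely.\<close>

lemma V_minus_index_iff: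
  assumes t: "t \<in> C" and j: "j \<in> J" "t \<in> \<beta> j"
  shows "j \<in> V_minus_index t \<longleftrightarrow> j \<in> V_plus_index t \<and> \<beta> j \<noteq> C"
proof
  assume "j \<in> V_plus_index t \<and> \<beta> j \<noteq> C"
  show "j \<in> V_minus_index t"
  proof (rule ccontr)
    assume "j \<notin> V_minus_index t"
    then have h: "j \<in> I_plus_index t" "j \<notin> K_minus_index t" "j \<in> K_plus_index t" "j \<notin> I_minus_index t"
      using \<open>j \<in> V_plus_index t \<and> \<beta> j \<noteq> C\<close> by (auto simp: V_plus_index_def V_minus_index_def)
    have low: "s \<in> C \<longleftrightarrow> s \<in> \<beta> j" if "s \<le> t" for s using h(1,4) that by (auto simp: I_plus_index_def I_minus_index_def)
    have high: "u \<in> C \<longleftrightarrow> u \<in> \<beta> j" if "t \<le> u" for u using h(2,3) that by (auto simp: K_plus_index_def K_minus_index_def)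
    have "w \<in> C \<longleftrightarrow> w \<in> \<beta> j" for w
      using block_min_max[OF C t, of w] block_min_max[OF \<beta>_block[OF j(1)] j(2), of w]
        low[OF vmin_le(2)] high[OF vmax_ge(2)] by simp
    then show False using \<open>j \<in> V_plus_index t \<and> \<beta> j \<noteq> C\<close> by blast
  qed
next
  assume "j \<in> V_minus_index t"
  then show "j \<in> V_plus_index t \<and> \<beta> j \<noteq> C" by (auto simp: V_plus_index_def V_minus_index_def I_plus_index_def I_minus_index_def K_plus_index_def K_minus_index_def)
qed

lemma V_plus_index_self: "\<beta> j = C \<Longrightarrow> j \<in> V_plus_index t"
  by (auto simp: V_plus_index_def I_plus_index_def K_plus_index_def)

text \<open>Makes the structure maps carry V+ into V+. Test points are moved between
  \<open>s\<close> and \<open>t\<close> by minima and maxima, which stay in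
  \<open>C\<close>.\<close>

lemma V_plus_index_mono:
  assumes st: "s \<in> C" "t \<in> C" "s \<le> t" and j: "j \<in> J" "s \<in> \<beta> j" "t \<in> \<beta> j" "j \<in> V_plus_index s"
  shows "j \<in> V_plus_index t"
proof -
  have "r \<in> \<beta> j" if r: "r \<in> C" "r \<le> t" for r
  proof -
    have "vmin r s \<in> C" using block_min_max[OF C st(1)] r(1) by blast
    then have "vmin r s \<in> \<beta> j" using j(4) vmin_le(2) by (auto simp: V_plus_index_def I_plus_index_def)
    then show ?thesis using block_convex[OF \<beta>_block[OF j(1)] _ j(3) vmin_le(1) r(2)] by blast
  qed
  moreover have "j \<in> K_plus_index t \<union> K_minus_index t"
  proof (cases "j \<in> K_plus_index s")
    case True
    then show ?thesis using st(3) by (auto simp: K_plus_index_def intro: order_trans)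
  next
    case False
    then obtain u where u: "u \<in> C" "s \<le> u" "u \<notin> \<beta> j" using j(4) by (auto simp: V_plus_index_def K_minus_index_def)
    have "vmax u t \<in> C" using block_min_max[OF C st(2)] u(1) by blast
    moreover have "vmax u t \<notin> \<beta> j"
      using block_convex[OF \<beta>_block[OF j(1)] j(2) _ u(2) vmax_ge(1)] u(3) by blast
    ultimately show ?thesis using vmax_ge(2) by (auto simp: K_minus_index_def)
  qed
  ultimately show ?thesis by (auto simp: V_plus_index_def I_plus_index_def)
qed

definition block_index where "block_index = {j \<in> J. \<beta> j = C}"

text \<open>The explicit form of a coset of V- in V+: by \<open>V_minus_index_iff\<close> the two
  differ, among living indices, just by \<open>block_index\<close>, so the coordinates there name
  the coset.\<close>

definition quot_class :: "real^3 \<Rightarrow> ('j \<Rightarrow> 'k) \<Rightarrow> 'v set" where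
  "quot_class t a = {w \<in> supported t (V_plus_index t). \<forall>j\<in>block_index. c t w j = a j}"

lemma block_index_alive: "t \<in> C \<Longrightarrow> block_index \<subseteq> {j \<in> J. t \<in> \<beta> j}"
  by (auto simp: block_index_def)

lemma finite_block_index: "finite block_index"
proof -
  obtain t where "t \<in> C" using block_pbox[OF C] by blast
  then show ?thesis using block_index_alive finite_alive finite_subset by blast
qed

lemma V_minus_index_subset: "V_minus_index t \<subseteq> V_plus_index t"
  by (auto simp: V_minus_index_def V_plus_index_def)

lemma coset_quot_class:
  assumes t: "t \<in> C" and v: "v \<in> supported t (V_plus_index t)"
  shows "supported t (V_minus_index t) +>\<^bsub>obj M t\<^esub> v = quot_class t (c t v)"
proof
  have vc: "v \<in> carrier (obj M t)" using v supported_subset by blast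
  show "supported t (V_minus_index t) +>\<^bsub>obj M t\<^esub> v \<subseteq> quot_class t (c t v)"
  proof
    fix w assume "w \<in> supported t (V_minus_index t) +>\<^bsub>obj M t\<^esub> v"
    then obtain n where n: "n \<in> supported t (V_minus_index t)" "w = n \<oplus>\<^bsub>obj M t\<^esub> v" by (auto simp: a_r_coset_def')
    have nc: "n \<in> carrier (obj M t)" using n supported_subset by blast
    have "c t n j = 0" if "j \<in> block_index" for j
    proof (rule ccontr)
      assume "c t n j \<noteq> 0"
      then have "j \<in> V_minus_index t" "j \<in> J" "t \<in> \<beta> j" using n(1) c_supp[OF nc] by (auto simp: supported_def)
      then show False using V_minus_index_iff[OF t] that by (auto simp: block_index_def)
    qed
    moreover have "w \<in> supported t (V_plus_index t)"
      unfolding n(2) using supported_closed(2)[OF _ v] n(1) supported_mono[OF V_minus_index_subset] by blast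
    ultimately show "w \<in> quot_class t (c t v)" using c_add[OF nc vc] n(2) by (simp add: quot_class_def)
  qed
  show "quot_class t (c t v) \<subseteq> supported t (V_minus_index t) +>\<^bsub>obj M t\<^esub> v"
  proof
    fix w assume w: "w \<in> quot_class t (c t v)"
    then have wc: "w \<in> carrier (obj M t)" using supported_subset by (auto simp: quot_class_def)
    interpret V: vectorspace "class_ring :: 'k ring" "obj M t" by (rule vs)
    define n where "n = w \<ominus>\<^bsub>obj M t\<^esub> v"
    have nc: "n \<in> carrier (obj M t)" using wc vc by (simp add: n_def)
    have cn: "c t n = c t w - c t v" unfolding n_def by (rule coordinates_minus[OF co vs wc vc])
    have "j \<in> V_minus_index t" if "c t n j \<noteq> 0" for j
    proof -
      have "j \<in> J" "t \<in> \<beta> j" using c_supp[OF nc that] by auto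
      moreover have "c t w j \<noteq> 0 \<or> c t v j \<noteq> 0" using that cn by auto
      then have "j \<in> V_plus_index t" using w v by (auto simp: quot_class_def supported_def)
      moreover have "\<beta> j \<noteq> C" using w that cn calculation(1) by (auto simp: quot_class_def block_index_def)
      ultimately show ?thesis using V_minus_index_iff[OF t] by blast
    qed
    then have "n \<in> supported t (V_minus_index t)" using nc by (simp add: supported_def)
    moreover have "w = n \<oplus>\<^bsub>obj M t\<^esub> v" using wc vc by (simp add: n_def a_minus_def V.a_assoc V.l_neg)
    ultimately show "w \<in> supported t (V_minus_index t) +>\<^bsub>obj M t\<^esub> v" by (auto simp: a_r_coset_def')
  qed
qed

lemma quot_class_rep:
  assumes t: "t \<in> C" and a: "a \<in> fin_functions block_index"
  obtains v where "v \<in> supported t (V_plus_index t)" "c t v = a"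
proof -
  have am: "a j \<noteq> 0 \<Longrightarrow> j \<in> block_index" for j using fin_functions_supp[OF a] .
  obtain v where v: "v \<in> carrier (obj M t)" "c t v = a"
    by (rule c_surj[of a t]) (use am block_index_alive[OF t] in blast)
  moreover have "v \<in> supported t (V_plus_index t)" using v am V_plus_index_self by (auto simp: supported_def block_index_def)
  ultimately show ?thesis using that by blast
qed

lemma quot_class_inj:
  assumes t: "t \<in> C" and ab: "a \<in> fin_functions block_index" "b \<in> fin_functions block_index" and eq: "quot_class t a = quot_class t b"
  shows "a = b"
proof -
  obtain v where v: "v \<in> supported t (V_plus_index t)" "c t v = a" by (rule quot_class_rep[OF t ab(1)])
  then have "v \<in> quot_class t b" using eq by (auto simp: quot_class_def)
  then have "a j = b j" if "j \<in> block_index" for j using that v(2) by (auto simp: quot_class_def)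
  moreover have "a j = b j" if "j \<notin> block_index" for j
    using fin_functions_supp[OF ab(1), of j] fin_functions_supp[OF ab(2), of j] that by metis
  ultimately show ?thesis by blast
qed

lemma quot_class_coset:
  assumes t: "t \<in> C" and a: "a \<in> fin_functions block_index"
  obtains v where "v \<in> supported t (V_plus_index t)" "c t v = a" "quot_class t a = supported t (V_minus_index t) +>\<^bsub>obj M t\<^esub> v"
  using quot_class_rep[OF t a] coset_quot_class[OF t] by metis

lemma V_quot_carrier:
  assumes t: "t \<in> C"
  shows "carrier (obj (V_quot M C) t) = quot_class t ` fin_functions block_index"
proof -
  have "carrier (obj (V_quot M C) t) = (\<lambda>v. supported t (V_minus_index t) +>\<^bsub>obj M t\<^esub> v) ` supported t (V_plus_index t)"
    by (auto simp: V_quot_def vs_quot_def A_RCOSETS_def RCOSETS_def V_plus_supported V_minus_supported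
        a_r_coset_def r_coset_def)
  also have "\<dots> = quot_class t ` fin_functions block_index"
  proof
    show "(\<lambda>v. supported t (V_minus_index t) +>\<^bsub>obj M t\<^esub> v) ` supported t (V_plus_index t) \<subseteq> quot_class t ` fin_functions block_index"
    proof (rule image_subsetI)
      fix v assume v: "v \<in> supported t (V_plus_index t)"
      define a where "a = (\<lambda>j. if j \<in> block_index then c t v j else 0)"
      have "a \<in> fin_functions block_index" unfolding fin_functions_finite[OF finite_block_index] by (simp add: a_def)
      moreover have "quot_class t (c t v) = quot_class t a" by (auto simp: quot_class_def a_def)
      ultimately show "supported t (V_minus_index t) +>\<^bsub>obj M t\<^esub> v \<in> quot_class t ` fin_functions block_index"
        using coset_quot_class[OF t v] by blast
    qed
    show "quot_class t ` fin_functions block_index \<subseteq> (\<lambda>v. supported t (V_minus_index t) +>\<^bsub>obj M t\<^esub> v) ` supported t (V_plus_index t)"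
      using quot_class_coset[OF t] by blast
  qed
  finally show ?thesis .
qed

lemma V_quot_add:
  assumes t: "t \<in> C" and a: "a \<in> fin_functions block_index" and b: "b \<in> fin_functions block_index"
  shows "quot_class t a \<oplus>\<^bsub>obj (V_quot M C) t\<^esub> quot_class t b = quot_class t (a + b)"
proof -
  have e: "quot_class t a \<oplus>\<^bsub>obj (V_quot M C) t\<^esub> quot_class t b = {x \<oplus>\<^bsub>obj M t\<^esub> y | x y. x \<in> quot_class t a \<and> y \<in> quot_class t b}"
    by (auto simp: V_quot_def vs_quot_def set_add_def set_mult_def)
  show ?thesis unfolding e
  proof
    have "x \<oplus>\<^bsub>obj M t\<^esub> y \<in> quot_class t (a + b)" if "x \<in> quot_class t a" "y \<in> quot_class t b" for x y
      using that supported_closed(2) supported_subset[of t "V_plus_index t"] by (auto simp: quot_class_def c_add subset_iff)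
    then show "{x \<oplus>\<^bsub>obj M t\<^esub> y | x y. x \<in> quot_class t a \<and> y \<in> quot_class t b} \<subseteq> quot_class t (a + b)" by blast
    show "quot_class t (a + b) \<subseteq> {x \<oplus>\<^bsub>obj M t\<^esub> y | x y. x \<in> quot_class t a \<and> y \<in> quot_class t b}"
    proof
      fix w assume w: "w \<in> quot_class t (a + b)"
      \<comment> \<open>Addition of cosets is elementwise, so every member of the sum class has to
        be split; subtracting a representative \<open>v\<close> of the second class does it.\<close>
      obtain v where v: "v \<in> supported t (V_plus_index t)" "c t v = b" by (rule quot_class_rep[OF t b])
      interpret V: vectorspace "class_ring :: 'k ring" "obj M t" by (rule vs)
      have wc: "w \<in> carrier (obj M t)" and vc: "v \<in> carrier (obj M t)"
        using w v supported_subset by (auto simp: quot_class_def)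
      have "(- 1) \<odot>\<^bsub>obj M t\<^esub> v \<in> supported t (V_plus_index t)" using supported_closed(3)[OF v(1)] .
      then have "w \<oplus>\<^bsub>obj M t\<^esub> ((- 1) \<odot>\<^bsub>obj M t\<^esub> v) \<in> supported t (V_plus_index t)"
        using w supported_closed(2) by (auto simp: quot_class_def)
      moreover have "c t (w \<oplus>\<^bsub>obj M t\<^esub> ((- 1) \<odot>\<^bsub>obj M t\<^esub> v)) = c t w - c t v"
        using c_add[OF wc cl(2)[OF vc]] c_smult[OF vc] by (simp add: fscale_def fun_eq_iff)
      ultimately have "w \<oplus>\<^bsub>obj M t\<^esub> ((- 1) \<odot>\<^bsub>obj M t\<^esub> v) \<in> quot_class t a"
        using w v(2) by (auto simp: quot_class_def)
      moreover have "w = w \<oplus>\<^bsub>obj M t\<^esub> ((- 1) \<odot>\<^bsub>obj M t\<^esub> v) \<oplus>\<^bsub>obj M t\<^esub> v"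
        using wc vc cl by (intro c_inj[where t = t]) (auto simp: c_add c_smult fscale_def fun_eq_iff)
      moreover have "v \<in> quot_class t b" using v by (auto simp: quot_class_def)
      ultimately show "w \<in> {x \<oplus>\<^bsub>obj M t\<^esub> y | x y. x \<in> quot_class t a \<and> y \<in> quot_class t b}" by blast
    qed
  qed
qed

lemma V_quot_smult:
  assumes t: "t \<in> C" and a: "a \<in> fin_functions block_index"
  shows "r \<odot>\<^bsub>obj (V_quot M C) t\<^esub> quot_class t a = quot_class t (fscale r a)"
proof -
  obtain v where v: "v \<in> supported t (V_plus_index t)" "c t v = a" by (rule quot_class_rep[OF t a])
  have "supported t (V_minus_index t) +>\<^bsub>obj M t\<^esub> (r \<odot>\<^bsub>obj M t\<^esub> x) = quot_class t (fscale r a)" if x: "x \<in> quot_class t a" for x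
  proof -
    have xp: "x \<in> supported t (V_plus_index t)" using x by (simp add: quot_class_def)
    have "quot_class t (c t (r \<odot>\<^bsub>obj M t\<^esub> x)) = quot_class t (fscale r a)"
      using x supported_subset xp by (auto simp: quot_class_def c_smult subset_iff fscale_def)
    then show ?thesis using coset_quot_class[OF t supported_closed(3)[OF xp]] by simp
  qed
  moreover have "v \<in> quot_class t a" using v by (auto simp: quot_class_def)
  moreover have "r \<odot>\<^bsub>obj (V_quot M C) t\<^esub> quot_class t a =
      (\<Union>x\<in>quot_class t a. supported t (V_minus_index t) +>\<^bsub>obj M t\<^esub> (r \<odot>\<^bsub>obj M t\<^esub> x))"
    by (simp add: V_quot_def vs_quot_def V_minus_supported a_r_coset_def')
  ultimately show ?thesis by auto
qed

lemma V_quot_zero: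
  assumes t: "t \<in> C" shows "\<zero>\<^bsub>obj (V_quot M C) t\<^esub> = quot_class t 0"
proof -
  have "supported t (V_minus_index t) +>\<^bsub>obj M t\<^esub> \<zero>\<^bsub>obj M t\<^esub> = quot_class t 0"
    using coset_quot_class[OF t supported_closed(1)] by (simp add: c_zero)
  moreover have "supported t (V_minus_index t) +>\<^bsub>obj M t\<^esub> \<zero>\<^bsub>obj M t\<^esub> = supported t (V_minus_index t)"
  proof -
    interpret V: vectorspace "class_ring :: 'k ring" "obj M t" by (rule vs)
    show ?thesis using supported_subset[of t "V_minus_index t"] by (force simp: a_r_coset_def')
  qed
  ultimately show ?thesis by (simp add: V_quot_def vs_quot_def V_minus_supported)
qed

lemma V_quot_tr:
  assumes st: "s \<in> C" "t \<in> C" "s \<le> t" and a: "a \<in> fin_functions block_index"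
  shows "tr (V_quot M C) s t (quot_class s a) = quot_class t a"
proof -
  have "supported t (V_minus_index t) +>\<^bsub>obj M t\<^esub> tr M s t x = quot_class t a" if x: "x \<in> quot_class s a" for x
  proof -
    have xp: "x \<in> supported s (V_plus_index s)" and xc: "x \<in> carrier (obj M s)" using x supported_subset by (auto simp: quot_class_def)
    have "tr M s t x \<in> supported t (V_plus_index t)"
      using linear_mapD(1)[OF lin[OF st(3)] xc] c_supp[OF xc] V_plus_index_mono[OF st] xp
      by (auto simp: supported_def c_tr[OF st(3) xc] split: if_splits)
    moreover have "quot_class t (c t (tr M s t x)) = quot_class t a"
      using x st(2) by (auto simp: quot_class_def c_tr[OF st(3) xc] block_index_def)
    ultimately show ?thesis using coset_quot_class[OF st(2)] by simp
  qed
  moreover obtain v where "v \<in> supported s (V_plus_index s)" "c s v = a" by (rule quot_class_rep[OF st(1) a])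
  then have "v \<in> quot_class s a" by (auto simp: quot_class_def)
  moreover have "tr (V_quot M C) s t (quot_class s a) = (\<Union>x\<in>quot_class s a. supported t (V_minus_index t) +>\<^bsub>obj M t\<^esub> tr M s t x)"
    by (simp add: V_quot_def quot_map_def V_minus_supported)
  ultimately show ?thesis by auto
qed

text \<open>A function on the summands equal to \<open>C\<close> is sent to the family of its
  classes at all points. This is onto because any two points of \<open>C\<close> have a common lower
  bound in \<open>C\<close>, so a compatible family has the same coordinates everywhere.\<close>

theorem counting_functor_dim:
  "vectorspace class_ring (counting_functor M C)"
  "vectorspace.fin_dim class_ring (counting_functor M C)"
  "vectorspace.dim class_ring (counting_functor M C) = card {j \<in> J. \<beta> j = C}"
proof -
  let ?\<Theta> = "\<lambda>a. \<lambda>t\<in>C. quot_class t a"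
  let ?CF = "counting_functor M C"
  obtain t0 where t0: "t0 \<in> C" using block_pbox[OF C] by blast
  have bij: "bij_betw ?\<Theta> (fin_functions block_index) (carrier ?CF)"
    unfolding bij_betw_def
  proof
    show "inj_on ?\<Theta> (fin_functions block_index)"
    proof (rule inj_onI)
      fix a b assume ab: "a \<in> fin_functions block_index" "b \<in> fin_functions block_index" "?\<Theta> a = ?\<Theta> b"
      have "quot_class t0 a = quot_class t0 b" using fun_cong[OF ab(3), of t0] t0 by simp
      then show "a = b" by (rule quot_class_inj[OF t0 ab(1,2)])
    qed
    show "?\<Theta> ` fin_functions block_index = carrier ?CF"
    proof
      show "?\<Theta> ` fin_functions block_index \<subseteq> carrier ?CF"
        unfolding counting_functor_def pm_limit_def using V_quot_carrier V_quot_tr by auto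
      show "carrier ?CF \<subseteq> ?\<Theta> ` fin_functions block_index"
      proof
        fix F assume F: "F \<in> carrier ?CF"
        have FE: "F \<in> extensional C" and Fc: "\<And>t. t \<in> C \<Longrightarrow> F t \<in> carrier (obj (V_quot M C) t)"
          and Ft: "\<And>s t. s \<in> C \<Longrightarrow> t \<in> C \<Longrightarrow> s \<le> t \<Longrightarrow> tr (V_quot M C) s t (F s) = F t"
          using F unfolding counting_functor_def pm_limit_def by (auto simp: PiE_def)
        have "\<exists>a\<in>fin_functions block_index. F t = quot_class t a" if "t \<in> C" for t
          using Fc[OF that] V_quot_carrier[OF that] by auto
        then obtain a where a: "\<And>t. t \<in> C \<Longrightarrow> a t \<in> fin_functions block_index" "\<And>t. t \<in> C \<Longrightarrow> F t = quot_class t (a t)"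
          by metis
        have step: "a s = a t" if "s \<in> C" "t \<in> C" "s \<le> t" for s t
          using Ft[OF that] V_quot_tr[OF that a(1)[OF that(1)]] a that quot_class_inj[OF that(2)] by metis
        have "a t = a t0" if t: "t \<in> C" for t
        proof -
          have m: "vmin t t0 \<in> C" using block_min_max[OF C t0] t by blast
          show ?thesis using step[OF m t vmin_le(1)] step[OF m t0 vmin_le(2)] by simp
        qed
        then have "F t = ?\<Theta> (a t0) t" for t using FE a(2)[of t] by (cases "t \<in> C") (simp_all add: extensional_def)
        then have "F = ?\<Theta> (a t0)" by (rule ext)
        then show "F \<in> ?\<Theta> ` fin_functions block_index" using a(1)[OF t0] by blast
      qed
    qed
  qed
  have "coordinates ?CF (inv_into (fin_functions block_index) ?\<Theta>) block_index \<and> vectorspace (class_ring :: 'k ring) ?CF"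
  proof (rule coordinates_of_inverse[OF bij])
    show "?\<Theta> f \<oplus>\<^bsub>?CF\<^esub> ?\<Theta> g = ?\<Theta> (f + g)" if "f \<in> fin_functions block_index" "g \<in> fin_functions block_index" for f g
      unfolding counting_functor_def pm_limit_def using V_quot_add that by (auto simp: fun_eq_iff)
    show "r \<odot>\<^bsub>?CF\<^esub> ?\<Theta> f = ?\<Theta> (fscale r f)" if "f \<in> fin_functions block_index" for r f
      unfolding counting_functor_def pm_limit_def using V_quot_smult that by (auto simp: fun_eq_iff)
    show "\<zero>\<^bsub>?CF\<^esub> = ?\<Theta> 0"
      unfolding counting_functor_def pm_limit_def using V_quot_zero by (auto simp: fun_eq_iff)
  qed
  then have cd: "coordinates ?CF (inv_into (fin_functions block_index) ?\<Theta>) block_index"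
    and v: "vectorspace (class_ring :: 'k ring) ?CF" by blast+
  show "vectorspace class_ring ?CF" by (rule v)
  show "vectorspace.fin_dim class_ring ?CF" by (rule coordinates_dim(1)[OF cd v finite_block_index])
  show "vectorspace.dim class_ring ?CF = card {j \<in> J. \<beta> j = C}"
    using coordinates_dim(2)[OF cd v finite_block_index] by (simp add: block_index_def)
qed

end

end

section \<open>Existence and uniqueness\<close>

text \<open>The isomorphism of \<open>M\<close> with the sum is followed by the isomorphisms of the
  summands with block modules. This makes the count by the counting functor apply to any
  decomposition, whatever its index type.\<close>

lemma block_coordinates_of_decomposition:
  fixes M :: "(real^3, 'k::field, 'v) pers_mod" and N :: "'j \<Rightarrow> (real^3, 'k, 'w) pers_mod"
  assumes pm: "persistence_module M"
    and N: "\<And>j. j \<in> J \<Longrightarrow> persistence_module (N j)"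
    and \<beta>: "\<And>j. j \<in> J \<Longrightarrow> \<beta> j \<in> blocks" "\<And>j. j \<in> J \<Longrightarrow> N j \<cong>\<^sub>P block_module (\<beta> j)"
    and iso: "M \<cong>\<^sub>P pm_dsum J N"
  shows "\<exists>c. block_coordinates M J \<beta> c"
proof -
  obtain f where f: "\<And>t. linear_map class_ring (obj M t) (obj (pm_dsum J N) t) (f t)"
    "\<And>t. bij_betw (f t) (carrier (obj M t)) (carrier (obj (pm_dsum J N) t))"
    "\<And>s t v. s \<le> t \<Longrightarrow> v \<in> carrier (obj M s) \<Longrightarrow> tr (pm_dsum J N) s t (f s v) = f t (tr M s t v)"
    using iso unfolding pm_iso_def by blast
  have "\<exists>h. (\<forall>t. linear_map class_ring (obj (N j) t) (obj (block_module (\<beta> j)) t) (h t) \<and>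
      bij_betw (h t) (carrier (obj (N j) t)) (carrier (obj (block_module (\<beta> j)) t))) \<and>
    (\<forall>s t. s \<le> t \<longrightarrow> (\<forall>v\<in>carrier (obj (N j) s). tr (block_module (\<beta> j)) s t (h s v) = h t (tr (N j) s t v)))"
    if "j \<in> J" for j
    using \<beta>(2)[OF that] unfolding pm_iso_def .
  then obtain h where h: "\<And>j t. j \<in> J \<Longrightarrow> linear_map class_ring (obj (N j) t) (obj (block_module (\<beta> j)) t) (h j t)"
    "\<And>j t. j \<in> J \<Longrightarrow> bij_betw (h j t) (carrier (obj (N j) t)) (carrier (obj (block_module (\<beta> j)) t))"
    "\<And>j s t v. j \<in> J \<Longrightarrow> s \<le> t \<Longrightarrow> v \<in> carrier (obj (N j) s) \<Longrightarrow>
      tr (block_module (\<beta> j)) s t (h j s v) = h j t (tr (N j) s t v)"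
    by metis
  define c where "c t v = (\<lambda>j. if j \<in> J then h j t (f t v j) else 0)" for t v
  have obj_dsum: "obj (pm_dsum J N) t = vs_dsum J (\<lambda>j. obj (N j) t)" for t by (simp add: pm_dsum_def)
  have fin: "f t v \<in> carrier (vs_dsum J (\<lambda>j. obj (N j) t))" if "v \<in> carrier (obj M t)" for t v
    using linear_mapD(1)[OF f(1) that] by (simp add: obj_dsum)
  have fv: "f t v j \<in> carrier (obj (N j) t)" if "v \<in> carrier (obj M t)" "j \<in> J" for t v j
    using fin[OF that(1)] that(2) by (auto simp: vs_dsum_def)
  have h0: "h j t \<zero>\<^bsub>obj (N j) t\<^esub> = 0" if "j \<in> J" for j t
    using linear_map_zero[OF h(1)[OF that]] by (simp add: block_module_def)
  have hz: "t \<in> \<beta> j" if "j \<in> J" "x \<in> carrier (obj (N j) t)" "h j t x \<noteq> 0" for j t x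
    using linear_mapD(1)[OF h(1)[OF that(1)] that(2)] that(3) by (auto simp: block_module_def split: if_splits)
  have "coordinates (obj M t) (c t) {j \<in> J. t \<in> \<beta> j}" for t unfolding coordinates_def
  proof (intro conjI ballI allI)
    show "bij_betw (c t) (carrier (obj M t)) (fin_functions {j \<in> J. t \<in> \<beta> j})" unfolding bij_betw_def
    proof
      show "inj_on (c t) (carrier (obj M t))"
      proof (rule inj_onI)
        fix v w assume vw: "v \<in> carrier (obj M t)" "w \<in> carrier (obj M t)" "c t v = c t w"
        have "f t v j = f t w j" for j
        proof (cases "j \<in> J")
          case True
          have "h j t (f t v j) = h j t (f t w j)" using fun_cong[OF vw(3), of j] True by (simp add: c_def)
          then show ?thesis using h(2)[OF True, of t] fv vw(1,2) True by (auto simp: bij_betw_def dest: inj_onD)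
        next
          case False
          then show ?thesis using fin[OF vw(1)] fin[OF vw(2)] by (auto simp: vs_dsum_def PiE_def extensional_def)
        qed
        then have "f t v = f t w" by (rule ext)
        then show "v = w" using f(2)[of t] vw(1,2) by (auto simp: bij_betw_def dest: inj_onD)
      qed
      show "c t ` carrier (obj M t) = fin_functions {j \<in> J. t \<in> \<beta> j}"
      proof
        show "c t ` carrier (obj M t) \<subseteq> fin_functions {j \<in> J. t \<in> \<beta> j}"
        proof (rule image_subsetI)
          fix v assume v: "v \<in> carrier (obj M t)"
          have "{j. c t v j \<noteq> 0} \<subseteq> {j \<in> J. f t v j \<noteq> \<zero>\<^bsub>obj (N j) t\<^esub>}" using h0 by (auto simp: c_def)
          moreover have "finite {j \<in> J. f t v j \<noteq> \<zero>\<^bsub>obj (N j) t\<^esub>}" using fin[OF v] by (simp add: vs_dsum_def)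
          ultimately have "finite {j. c t v j \<noteq> 0}" by (rule finite_subset)
          then show "c t v \<in> fin_functions {j \<in> J. t \<in> \<beta> j}"
            using hz fv[OF v] by (intro fin_functionsI) (auto simp: c_def split: if_splits)
        qed
        show "fin_functions {j \<in> J. t \<in> \<beta> j} \<subseteq> c t ` carrier (obj M t)"
        proof
          fix a :: "'j \<Rightarrow> 'k" assume a: "a \<in> fin_functions {j \<in> J. t \<in> \<beta> j}"
          have sup: "a j \<noteq> 0 \<Longrightarrow> j \<in> J \<and> t \<in> \<beta> j" for j using fin_functions_supp[OF a] by blast
          define F where "F = (\<lambda>j\<in>J. inv_into (carrier (obj (N j) t)) (h j t) (a j))"
          have aim: "a j \<in> h j t ` carrier (obj (N j) t)" if "j \<in> J" for j
            using h(2)[OF that, of t] sup[of j] by (auto simp: bij_betw_def block_module_def)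
          have Fin: "F j \<in> carrier (obj (N j) t)" and hF: "h j t (F j) = a j" if "j \<in> J" for j
            using aim[OF that] that by (auto simp: F_def inv_into_into f_inv_into_f)
          have zero_in: "\<zero>\<^bsub>obj (N j) t\<^esub> \<in> carrier (obj (N j) t)" if "j \<in> J" for j
            using vs_closed(3)[OF persistence_moduleD(1)[OF N[OF that]]] .
          have "F j = \<zero>\<^bsub>obj (N j) t\<^esub>" if "j \<in> J" "a j = 0" for j
            by (rule inj_onD[OF bij_betw_imp_inj_on[OF h(2)[OF that(1), of t]] _ Fin[OF that(1)] zero_in[OF that(1)]])
              (use that hF h0 in simp)
          then have "{j \<in> J. F j \<noteq> \<zero>\<^bsub>obj (N j) t\<^esub>} \<subseteq> {j. a j \<noteq> 0}" by auto
          moreover have "finite {j. a j \<noteq> 0}" using a by (simp add: fin_functions_def)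
          ultimately have "finite {j \<in> J. F j \<noteq> \<zero>\<^bsub>obj (N j) t\<^esub>}" by (rule finite_subset)
          then have "F \<in> carrier (obj (pm_dsum J N) t)" using Fin by (auto simp: obj_dsum vs_dsum_def F_def)
          then obtain v where v: "v \<in> carrier (obj M t)" "f t v = F"
            using f(2)[of t] unfolding bij_betw_def by (metis imageE)
          have "c t v = a" using sup hF by (auto simp: c_def v(2) fun_eq_iff)
          then show "a \<in> c t ` carrier (obj M t)" using v(1) by blast
        qed
      qed
    qed
    fix v assume v: "v \<in> carrier (obj M t)"
    show "c t (r \<odot>\<^bsub>obj M t\<^esub> v) = fscale r (c t v)" for r
    proof
      fix j
      show "c t (r \<odot>\<^bsub>obj M t\<^esub> v) j = fscale r (c t v) j"
        using linear_mapD(3)[OF f(1) v, of r] linear_mapD(3)[OF h(1) fv[OF v], of j r]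
        by (cases "j \<in> J") (simp_all add: c_def fscale_def obj_dsum vs_dsum_def block_module_def)
    qed
    fix w assume w: "w \<in> carrier (obj M t)"
    show "c t (v \<oplus>\<^bsub>obj M t\<^esub> w) = c t v + c t w"
    proof
      fix j
      show "c t (v \<oplus>\<^bsub>obj M t\<^esub> w) j = (c t v + c t w) j"
        using linear_mapD(2)[OF f(1) v w] linear_mapD(2)[OF h(1) fv[OF v] fv[OF w], of j]
        by (cases "j \<in> J") (simp_all add: c_def obj_dsum vs_dsum_def block_module_def)
    qed
  qed
  moreover have "c t (tr M s t v) = (\<lambda>j. if t \<in> \<beta> j then c s v j else 0)"
    if st: "s \<le> t" and v: "v \<in> carrier (obj M s)" for s t v
  proof
    fix j
    show "c t (tr M s t v) j = (if t \<in> \<beta> j then c s v j else 0)"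
    proof (cases "j \<in> J")
      case True
      have "c t (tr M s t v) j = h j t (tr (N j) s t (f s v j))"
        using f(3)[OF st v, symmetric] True by (simp add: c_def pm_dsum_def)
      also have "\<dots> = tr (block_module (\<beta> j)) s t (h j s (f s v j))" using h(3)[OF True st fv[OF v True]] by simp
      also have "\<dots> = (if t \<in> \<beta> j then c s v j else 0)"
        using hz[OF True fv[OF v True]] True by (auto simp: block_module_def c_def)
      finally show ?thesis .
    qed (simp add: c_def)
  qed
  ultimately have "block_coordinates M J \<beta> c" unfolding block_coordinates_def using \<beta>(1) by simp
  then show ?thesis by (rule exI[of _ c])
qed

text \<open>A regrouping: summands with the same block form an inner sum, numbered by the second
  component of \<sigma>. Finite support in the outer sum comes from the finitely many nonzero
  coordinates.\<close>

lemma decomposition_of_block_coordinates: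
  fixes M :: "(real^3, 'k::field, 'v) pers_mod" and n :: "(real^3) set \<Rightarrow> nat"
  assumes pfd: "pfd_persistence_module M" and bc: "block_coordinates M J \<beta> c"
    and \<sigma>: "bij_betw \<sigma> J (SIGMA B:blocks. {1..n B})" "\<And>j. j \<in> J \<Longrightarrow> fst (\<sigma> j) = \<beta> j"
  shows "M \<cong>\<^sub>P pm_dsum blocks (\<lambda>B. pm_dsum {1..n B} (\<lambda>_. block_module B))"
proof -
  interpret block_coords M J \<beta> c using pfd bc by (simp add: block_coords_def)
  let ?N = "\<lambda>B. pm_dsum {1..n B} (\<lambda>_. block_module B :: (real^3, 'k, 'k) pers_mod)"
  define \<tau> where "\<tau> = inv_into J \<sigma>"
  have \<tau>: "\<tau> (B, i) \<in> J" "\<beta> (\<tau> (B, i)) = B" "\<sigma> (\<tau> (B, i)) = (B, i)" if "B \<in> blocks" "i \<in> {1..n B}" for B i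
  proof -
    have im: "(B, i) \<in> \<sigma> ` J" using \<sigma>(1) that by (simp add: bij_betw_def)
    show 1: "\<tau> (B, i) \<in> J" using im by (simp add: \<tau>_def inv_into_into)
    show 2: "\<sigma> (\<tau> (B, i)) = (B, i)" using im by (simp add: \<tau>_def f_inv_into_f)
    show "\<beta> (\<tau> (B, i)) = B" using \<sigma>(2)[OF 1] 2 by simp
  qed
  have \<sigma>_in: "\<beta> j \<in> blocks" "snd (\<sigma> j) \<in> {1..n (\<beta> j)}" "\<tau> (\<beta> j, snd (\<sigma> j)) = j" if "j \<in> J" for j
  proof -
    have "\<sigma> j \<in> (SIGMA B:blocks. {1..n B})" using \<sigma>(1) that by (auto simp: bij_betw_def)
    moreover have e: "\<sigma> j = (\<beta> j, snd (\<sigma> j))" using \<sigma>(2)[OF that] by (metis prod.collapse)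
    ultimately show "\<beta> j \<in> blocks" "snd (\<sigma> j) \<in> {1..n (\<beta> j)}" by (metis mem_Sigma_iff)+
    show "\<tau> (\<beta> j, snd (\<sigma> j)) = j" using \<sigma>(1) that e by (metis \<tau>_def bij_betw_def inv_into_f_f)
  qed
  define f where "f t v = (\<lambda>B\<in>blocks. \<lambda>i\<in>{1..n B}. c t v (\<tau> (B, i)))" for t v
  have car: "carrier (obj (?N B) t) = ({1..n B} \<rightarrow>\<^sub>E (if t \<in> B then UNIV else {0}))" for B t
    by (auto simp: pm_dsum_def vs_dsum_def block_module_def)
  have zero: "\<zero>\<^bsub>obj (?N B) t\<^esub> = (\<lambda>i\<in>{1..n B}. 0)" for B t
    by (simp add: pm_dsum_def vs_dsum_def block_module_def)
  have add: "F \<oplus>\<^bsub>obj (?N B) t\<^esub> G = (\<lambda>i\<in>{1..n B}. F i + G i)" for B t F G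
    by (simp add: pm_dsum_def vs_dsum_def block_module_def)
  have smult: "r \<odot>\<^bsub>obj (?N B) t\<^esub> F = (\<lambda>i\<in>{1..n B}. r * F i)" for B t F r
    by (simp add: pm_dsum_def vs_dsum_def block_module_def)
  have cT: "carrier (obj (pm_dsum blocks ?N) t) =
      {F \<in> (\<Pi>\<^sub>E B\<in>blocks. carrier (obj (?N B) t)). finite {B \<in> blocks. F B \<noteq> \<zero>\<^bsub>obj (?N B) t\<^esub>}}" for t
    by (subst pm_dsum_def) (simp add: vs_dsum_def)
  have addT: "F \<oplus>\<^bsub>obj (pm_dsum blocks ?N) t\<^esub> G = (\<lambda>B\<in>blocks. F B \<oplus>\<^bsub>obj (?N B) t\<^esub> G B)" for F G t
    by (subst pm_dsum_def) (simp add: vs_dsum_def)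
  have smultT: "r \<odot>\<^bsub>obj (pm_dsum blocks ?N) t\<^esub> F = (\<lambda>B\<in>blocks. r \<odot>\<^bsub>obj (?N B) t\<^esub> F B)" for F r t
    by (subst pm_dsum_def) (simp add: vs_dsum_def)
  have trT: "tr (pm_dsum blocks ?N) s t F =
      (\<lambda>B\<in>blocks. \<lambda>i\<in>{1..n B}. if s \<in> B \<and> t \<in> B then F B i else 0)" for F s t
    by (simp add: pm_dsum_def block_module_def)
  have pmN: "persistence_module (?N B)" if "B \<in> blocks" for B
    using block_convex[OF that] by (intro persistence_module_pm_dsum persistence_module_block_module) blast
  have f_in: "f t v \<in> carrier (obj (pm_dsum blocks ?N) t)" if v: "v \<in> carrier (obj M t)" for t v
  proof -
    have fB: "f t v B \<in> carrier (obj (?N B) t)" if B: "B \<in> blocks" for B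
    proof -
      have "c t v (\<tau> (B, i)) \<in> (if t \<in> B then UNIV else {0})" if "i \<in> {1..n B}" for i
        using c_supp[OF v, of "\<tau> (B, i)"] \<tau>(2)[OF B that] by auto
      then have "(\<lambda>i\<in>{1..n B}. c t v (\<tau> (B, i))) \<in> {1..n B} \<rightarrow>\<^sub>E (if t \<in> B then UNIV else {0})"
        by (rule restrict_PiE_iff[THEN iffD2, OF ballI])
      then show ?thesis unfolding car using B by (simp add: f_def)
    qed
    have fz: "f t v B = \<zero>\<^bsub>obj (?N B) t\<^esub>"
      if "B \<in> blocks" "\<And>i. i \<in> {1..n B} \<Longrightarrow> c t v (\<tau> (B, i)) = 0" for B
    proof -
      have "f t v B = (\<lambda>i\<in>{1..n B}. c t v (\<tau> (B, i)))" using that(1) by (simp add: f_def)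
      also have "\<dots> = (\<lambda>i\<in>{1..n B}. 0)" by (rule restrict_ext) (rule that(2))
      finally show ?thesis unfolding zero .
    qed
    have "{B \<in> blocks. f t v B \<noteq> \<zero>\<^bsub>obj (?N B) t\<^esub>} \<subseteq> \<beta> ` {j. c t v j \<noteq> 0}"
    proof
      fix B assume "B \<in> {B \<in> blocks. f t v B \<noteq> \<zero>\<^bsub>obj (?N B) t\<^esub>}"
      then obtain i where "B \<in> blocks" "i \<in> {1..n B}" "c t v (\<tau> (B, i)) \<noteq> 0" using fz[of B] by blast
      then show "B \<in> \<beta> ` {j. c t v j \<noteq> 0}" using \<tau>(2) by (metis (mono_tags, lifting) image_eqI mem_Collect_eq)
    qed
    moreover have "finite (\<beta> ` {j. c t v j \<noteq> 0})"
      using coordinates_in[OF co v] by (simp add: fin_functions_def)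
    ultimately have "finite {B \<in> blocks. f t v B \<noteq> \<zero>\<^bsub>obj (?N B) t\<^esub>}" by (rule finite_subset)
    then show ?thesis using fB unfolding cT by (auto simp: f_def)
  qed
  have "linear_map class_ring (obj M t) (obj (pm_dsum blocks ?N) t) (f t)" for t
  proof (rule linear_mapI)
    show "vectorspace class_ring (obj M t)" by (rule vs)
    show "vectorspace class_ring (obj (pm_dsum blocks ?N) t)"
      by (rule persistence_moduleD(1)[OF persistence_module_pm_dsum[OF pmN]])
    show "f t v \<in> carrier (obj (pm_dsum blocks ?N) t)" if "v \<in> carrier (obj M t)" for v by (rule f_in[OF that])
    show "f t (v \<oplus>\<^bsub>obj M t\<^esub> w) = f t v \<oplus>\<^bsub>obj (pm_dsum blocks ?N) t\<^esub> f t w"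
      if "v \<in> carrier (obj M t)" "w \<in> carrier (obj M t)" for v w
      unfolding addT add f_def c_add[OF that] by (auto simp: fun_eq_iff)
    show "f t (r \<odot>\<^bsub>obj M t\<^esub> v) = r \<odot>\<^bsub>obj (pm_dsum blocks ?N) t\<^esub> f t v"
      if "v \<in> carrier (obj M t)" for r v
      unfolding smultT smult f_def c_smult[OF that] by (auto simp: fun_eq_iff fscale_def)
  qed
  moreover have "bij_betw (f t) (carrier (obj M t)) (carrier (obj (pm_dsum blocks ?N) t))" for t
    unfolding bij_betw_def
  proof
    have fj: "f t v (\<beta> j) (snd (\<sigma> j)) = c t v j" if "j \<in> J" for v j
      using \<sigma>_in[OF that] by (simp add: f_def)
    show "inj_on (f t) (carrier (obj M t))"
    proof (rule inj_onI)
      fix v w assume vw: "v \<in> carrier (obj M t)" "w \<in> carrier (obj M t)" "f t v = f t w"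
      have "c t v j = c t w j" for j
        using fj[of j v] fj[of j w] vw(3) c_supp[OF vw(1), of j] c_supp[OF vw(2), of j] by (cases "j \<in> J") metis+
      then show "v = w" using vw(1,2) by (intro c_inj[where t = t]) auto
    qed
    show "f t ` carrier (obj M t) = carrier (obj (pm_dsum blocks ?N) t)"
    proof
      show "f t ` carrier (obj M t) \<subseteq> carrier (obj (pm_dsum blocks ?N) t)" using f_in by blast
      show "carrier (obj (pm_dsum blocks ?N) t) \<subseteq> f t ` carrier (obj M t)"
      proof
        fix F assume F: "F \<in> carrier (obj (pm_dsum blocks ?N) t)"
        then have FE: "F \<in> extensional blocks" and FB: "\<And>B. B \<in> blocks \<Longrightarrow> F B \<in> carrier (obj (?N B) t)"
          unfolding cT by (auto simp: PiE_def)
        define a where "a j = (if j \<in> J then F (\<beta> j) (snd (\<sigma> j)) else 0)" for j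
        have "j \<in> J \<and> t \<in> \<beta> j" if "a j \<noteq> 0" for j
        proof -
          have j: "j \<in> J" using that by (auto simp: a_def split: if_splits)
          have "F (\<beta> j) (snd (\<sigma> j)) \<in> (if t \<in> \<beta> j then UNIV else {0})"
            using FB[OF \<sigma>_in(1)[OF j]] \<sigma>_in(2)[OF j] unfolding car by (rule PiE_mem)
          then show ?thesis using that j by (auto simp: a_def split: if_splits)
        qed
        then obtain v where v: "v \<in> carrier (obj M t)" "c t v = a" by (rule c_surj[of a t])
        have "f t v = F"
        proof
          fix B show "f t v B = F B"
          proof (cases "B \<in> blocks")
            case True
            have "c t v (\<tau> (B, i)) = F B i" if "i \<in> {1..n B}" for i
              using \<tau>[OF True that] by (simp add: v(2) a_def)
            moreover have "F B \<in> extensional {1..n B}" using FB[OF True] unfolding car by (simp add: PiE_def)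
            ultimately show ?thesis using True by (auto simp: f_def extensional_def fun_eq_iff)
          next
            case False
            then show ?thesis using FE by (simp add: f_def extensional_def)
          qed
        qed
        then show "F \<in> f t ` carrier (obj M t)" using v(1) by blast
      qed
    qed
  qed
  moreover have "tr (pm_dsum blocks ?N) s t (f s v) = f t (tr M s t v)"
    if "s \<le> t" "v \<in> carrier (obj M s)" for s t v
    unfolding trT using c_supp[OF that(2)] \<tau>(2) by (fastforce simp: f_def c_tr[OF that] fun_eq_iff)
  ultimately show ?thesis unfolding pm_iso_def by blast
qed

lemma pm_iso_refl:
  assumes "persistence_module M" shows "M \<cong>\<^sub>P M"
proof -
  have "linear_map class_ring (obj M t) (obj M t) (\<lambda>v. v)" for t
    by (rule linear_mapI[OF persistence_moduleD(1)[OF assms] persistence_moduleD(1)[OF assms]]) auto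
  moreover have "bij_betw (\<lambda>v. v) (carrier (obj M t)) (carrier (obj M t))" for t
    using bij_betw_id[of "carrier (obj M t)"] by (simp add: id_def)
  ultimately show ?thesis unfolding pm_iso_def by (intro exI[of _ "\<lambda>_ v. v"]) simp
qed

text \<open>By the counting functor the fibre of \<open>\<beta>\<close> over each block
  \<open>B\<close> has \<open>n B\<close> elements, a number that depends on \<open>M\<close> alone;
  numbering the fibres gives \<sigma>. This is the source of uniqueness.\<close>

lemma block_coordinates_bij:
  fixes M :: "(real^3, 'k::field, 'v) pers_mod" and n :: "(real^3) set \<Rightarrow> nat"
  assumes pfd: "pfd_persistence_module M" and bc: "block_coordinates M J \<beta> c"
    and n: "\<And>B. n B = vectorspace.dim class_ring (counting_functor M B)"
  obtains \<sigma> where "bij_betw \<sigma> J (SIGMA B:blocks. {1..n B})" "\<And>j. j \<in> J \<Longrightarrow> fst (\<sigma> j) = \<beta> j"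
proof -
  interpret block_coords M J \<beta> c using pfd bc by (simp add: block_coords_def)
  have "\<exists>h. bij_betw h {j \<in> J. \<beta> j = B} {1..n B}" if B: "B \<in> blocks" for B
  proof -
    have "finite {j \<in> J. \<beta> j = B}" using finite_block_index[OF B] by (simp add: block_index_def[OF B])
    moreover have "card {j \<in> J. \<beta> j = B} = n B" using counting_functor_dim(3)[OF B] n by simp
    ultimately obtain g where "bij_betw g {1..n B} {j \<in> J. \<beta> j = B}" using ex_bij_betw_nat_finite_1 by metis
    then show ?thesis by (intro exI) (rule bij_betw_inv_into)
  qed
  then obtain h where h: "\<And>B. B \<in> blocks \<Longrightarrow> bij_betw (h B) {j \<in> J. \<beta> j = B} {1..n B}" by metis
  define \<sigma> where "\<sigma> j = (\<beta> j, h (\<beta> j) j)" for j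
  have "bij_betw \<sigma> J (SIGMA B:blocks. {1..n B})" unfolding bij_betw_def
  proof
    show "inj_on \<sigma> J"
    proof (rule inj_onI)
      fix i j assume ij: "i \<in> J" "j \<in> J" "\<sigma> i = \<sigma> j"
      then have e: "\<beta> i = \<beta> j" "h (\<beta> j) i = h (\<beta> j) j" by (auto simp: \<sigma>_def)
      have "inj_on (h (\<beta> j)) {l \<in> J. \<beta> l = \<beta> j}" using h[OF \<beta>_block[OF ij(2)]] by (simp add: bij_betw_def)
      then show "i = j" using e ij by (auto dest: inj_onD)
    qed
    show "\<sigma> ` J = (SIGMA B:blocks. {1..n B})"
    proof
      show "\<sigma> ` J \<subseteq> (SIGMA B:blocks. {1..n B})"
        using h[OF \<beta>_block] \<beta>_block unfolding \<sigma>_def bij_betw_def by blast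
      show "(SIGMA B:blocks. {1..n B}) \<subseteq> \<sigma> ` J"
      proof clarify
        fix B i assume B: "B \<in> blocks" and i: "i \<in> {1..n B}"
        have "i \<in> h B ` {j \<in> J. \<beta> j = B}" using h[OF B] i by (simp add: bij_betw_def)
        then obtain j where j: "j \<in> J" "\<beta> j = B" "i = h B j" by blast
        then show "(B, i) \<in> \<sigma> ` J" by (intro image_eqI[of _ _ j]) (auto simp: \<sigma>_def)
      qed
    qed
  qed
  then show ?thesis using that[of \<sigma>] by (simp add: \<sigma>_def)
qed

theorem theorem1p1:
  fixes M :: "(real^3, 'k::field, 'v) pers_mod"
    and n :: "(real^3) set \<Rightarrow> nat"
  assumes "pfd_persistence_module M"
    and "strongly_exact_3 M"
    and "\<And>B. n B = vectorspace.dim class_ring (counting_functor M B)"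
  shows
    "(\<forall>B\<in>blocks. vectorspace class_ring (counting_functor M B) \<and>
        vectorspace.fin_dim class_ring (counting_functor M B)) \<and>
     (\<exists>MB :: (real^3) set \<Rightarrow> (real^3, 'k, nat \<Rightarrow> 'k) pers_mod.
        (\<forall>B\<in>blocks. persistence_module (MB B) \<and> MB B \<cong>\<^sub>P pm_dsum {1..n B} (\<lambda>_. block_module B)) \<and>
        M \<cong>\<^sub>P pm_dsum blocks MB) \<and>
     (\<forall>(J :: 'j set) (N :: 'j \<Rightarrow> (real^3, 'k, 'w) pers_mod).
        (\<forall>j\<in>J. persistence_module (N j) \<and> (\<exists>B\<in>blocks. N j \<cong>\<^sub>P block_module B)) \<and>
        M \<cong>\<^sub>P pm_dsum J N \<longrightarrow>
        (\<exists>\<sigma>. bij_betw \<sigma> J (SIGMA B:blocks. {1..n B}) \<and>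
             (\<forall>j\<in>J. N j \<cong>\<^sub>P block_module (fst (\<sigma> j)))))"
proof (intro conjI allI impI ballI)
  \<comment> \<open>The coordinates of one existing decomposition give both the claims on the
    counting functor and the grouped decomposition.\<close>
  obtain S :: "((real^3) set \<times> (real^3 \<Rightarrow> 'v \<Rightarrow> 'k)) set" and c where bc: "block_coordinates M S fst c"
    using exists_block_coordinates[OF assms(1,2)] by blast
  interpret block_coords M S fst c using assms(1) bc by (simp add: block_coords_def)
  show "vectorspace class_ring (counting_functor M B)" "vectorspace.fin_dim class_ring (counting_functor M B)"
    if "B \<in> blocks" for B
    using counting_functor_dim(1,2)[OF that] by blast+
  let ?N = "\<lambda>B. pm_dsum {1..n B} (\<lambda>_. block_module B :: (real^3, 'k, 'k) pers_mod)"
  obtain \<sigma> where "bij_betw \<sigma> S (SIGMA B:blocks. {1..n B})" "\<And>x. x \<in> S \<Longrightarrow> fst (\<sigma> x) = fst x"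
    using block_coordinates_bij[OF assms(1) bc assms(3)] by metis
  then have iso: "M \<cong>\<^sub>P pm_dsum blocks ?N" by (rule decomposition_of_block_coordinates[OF assms(1) bc])
  have pmN: "persistence_module (?N B)" if "B \<in> blocks" for B
    using block_convex[OF that] by (intro persistence_module_pm_dsum persistence_module_block_module) blast
  show "\<exists>MB :: (real^3) set \<Rightarrow> (real^3, 'k, nat \<Rightarrow> 'k) pers_mod.
        (\<forall>B\<in>blocks. persistence_module (MB B) \<and> MB B \<cong>\<^sub>P pm_dsum {1..n B} (\<lambda>_. block_module B)) \<and>
        M \<cong>\<^sub>P pm_dsum blocks MB"
    by (intro exI[of _ ?N] conjI ballI pmN pm_iso_refl iso)
next
  fix J :: "'j set" and N :: "'j \<Rightarrow> (real^3, 'k, 'w) pers_mod"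
  assume h: "(\<forall>j\<in>J. persistence_module (N j) \<and> (\<exists>B\<in>blocks. N j \<cong>\<^sub>P block_module B)) \<and> M \<cong>\<^sub>P pm_dsum J N"
  then have "\<forall>j\<in>J. \<exists>B. B \<in> blocks \<and> N j \<cong>\<^sub>P block_module B" by blast
  then obtain \<beta> where \<beta>: "\<And>j. j \<in> J \<Longrightarrow> \<beta> j \<in> blocks" "\<And>j. j \<in> J \<Longrightarrow> N j \<cong>\<^sub>P block_module (\<beta> j)"
    by metis
  \<comment> \<open>Here the coordinates come from the given decomposition, so the count ranges over
    \<open>J\<close> itself.\<close>
  have "persistence_module M" using assms(1) by (simp add: pfd_persistence_module_def)
  then obtain c where bc: "block_coordinates M J \<beta> c"
    using block_coordinates_of_decomposition[of M J N \<beta>] h \<beta> by blast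
  obtain \<sigma> where "bij_betw \<sigma> J (SIGMA B:blocks. {1..n B})" "\<And>j. j \<in> J \<Longrightarrow> fst (\<sigma> j) = \<beta> j"
    using block_coordinates_bij[OF assms(1) bc assms(3)] by metis
  then show "\<exists>\<sigma>. bij_betw \<sigma> J (SIGMA B:blocks. {1..n B}) \<and> (\<forall>j\<in>J. N j \<cong>\<^sub>P block_module (fst (\<sigma> j)))"
    using \<beta>(2) by (intro exI[of _ \<sigma>]) simp
qed

end
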